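(* Suppose that the time series $\{x_n\}$ is generated from an autoregression of finite order $L_0\ge 1$, and that the positive integers $L_{\max}^{(N)}$ satisfy $$\lim_{N\to\infty}\frac{L_{\max}^{(N)}}{\log\log N}=\infty,\qquad \lim_{N\to\infty}\frac{L_{\max}^{(N)}}{N^{1/2}}=0 .$$ Then the bridge criterion is consistent: with $$\hat L=\operatorname*{arg\,min}_{1\le L\le L_{\max}^{(N)}}\Bigl\{\log\hat e_L+\frac{2L_{\max}^{(N)}}{N}\sum_{k=1}^{L}\frac1k\Bigr\},$$ one has $\mathrm{pr}(\hat L=L_0)\to1$ as $N\to\infty$. In addition, if $\hat L$ is instead selected (by minimizing the same objective function) from any finite set of integers (candidate orders) that does not depend on $N$ and that contains the true order $L_0$, then $\hat L$ converges not only in probability but also almost surely to $L_0$ as $N\to\infty$.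
   Context: Data model: the data are generated from an autoregression of finite order $L_0$ if $x_n+\psi_{L_0,1}x_{n-1}+\cdots+\psi_{L_0,L_0}x_{n-L_0}=\epsilon_n$, where the $\psi_{L_0,\ell}$ are real and do not depend on $N$, $\psi_{L_0,L_0}\ne0$, the roots of $z^{L_0}+\sum_{\ell=1}^{L_0}\psi_{L_0,\ell}z^{L_0-\ell}$ have modulus less than 1, the $\epsilon_n$ are i.i.d. $\mathcal{N}(0,\sigma^2)$ with $\sigma^2>0$, and $\{x_n\}$ is the stationary process. The observations are $x_1,\ldots,x_{N_0}$, the largest candidate order is $L_{\max}^{(N)}$, and $N=N_0-L_{\max}^{(N)}$. Estimation: with $\hat\gamma_{i,j}=\frac1N\sum_{n=L_{\max}^{(N)}+1}^{N_0}x_{n-i}x_{n-j}$ ($0\le i,j\le L_{\max}^{(N)}$), $\hat\gamma_L=[\hat\gamma_{1,0},\ldots,\hat\gamma_{L,0}]^T$ and $\hat\Gamma_L=[\hat\gamma_{i,j}]_{i,j=1}^L$, the estimated filter of order $L$ is $\hat\Psi_L=[\hat\psi_{L,1},\ldots,\hat\psi_{L,L}]^T=-\hat\Gamma_L^{-1}\hat\gamma_L$, and $$\hat e_L=\frac1N\sum_{n=L_{\max}^{(N)}+1}^{N_0}(x_n+\hat\psi_{L,1}x_{n-1}+\cdots+\hat\psi_{L,L}x_{n-L})^2=\hat\gamma_{0,0}-\hat\gamma_L^T\hat\Gamma_L^{-1}\hat\gamma_L .$$ *)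

theory Defs
  imports
    "HOL-Probability.Probability"
    "Jordan_Normal_Form.Gauss_Jordan_Elimination"
begin

definition strictly_stationary :: "'a measure \<Rightarrow> (int \<Rightarrow> 'a \<Rightarrow> real) \<Rightarrow> bool" where
  "strictly_stationary M x \<longleftrightarrow>
     (\<forall>n. x n \<in> borel_measurable M) \<and>
     (\<forall>h. distr M (PiM UNIV (\<lambda>_. borel)) (\<lambda>\<omega> n. x (n + h) \<omega>) =
          distr M (PiM UNIV (\<lambda>_. borel)) (\<lambda>\<omega> n. x n \<omega>))"

definition gaussian_white_noise :: "'a measure \<Rightarrow> (int \<Rightarrow> 'a \<Rightarrow> real) \<Rightarrow> real \<Rightarrow> bool" where
  "gaussian_white_noise M \<epsilon> \<sigma> \<longleftrightarrow>
     prob_space.indep_vars M (\<lambda>_. borel) \<epsilon> UNIV \<and>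
     (\<forall>n. distributed M lborel (\<epsilon> n) (normal_density 0 \<sigma>))"

(* The noise variance is \<sigma>\<^sup>2, since normal_density takes the standard deviation.
   Because all roots lie in the open unit disc, the two-sided stationary solution of the
   recursion is almost surely unique (the causal one). *)
definition autoregression ::
  "'a measure \<Rightarrow> (int \<Rightarrow> 'a \<Rightarrow> real) \<Rightarrow> (int \<Rightarrow> 'a \<Rightarrow> real) \<Rightarrow> nat \<Rightarrow> (nat \<Rightarrow> real) \<Rightarrow> real \<Rightarrow> bool"
where
  "autoregression M x \<epsilon> L\<^sub>0 \<psi> \<sigma> \<longleftrightarrow>
     \<psi> L\<^sub>0 \<noteq> 0 \<and>
     (\<forall>z::complex. z ^ L\<^sub>0 + (\<Sum>l=1..L\<^sub>0. of_real (\<psi> l) * z ^ (L\<^sub>0 - l)) = 0 \<longrightarrow> cmod z < 1) \<and>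
     0 < \<sigma> \<and> gaussian_white_noise M \<epsilon> \<sigma> \<and>
     strictly_stationary M x \<and>
     (\<forall>n. AE \<omega> in M. x n \<omega> + (\<Sum>l=1..L\<^sub>0. \<psi> l * x (n - int l) \<omega>) = \<epsilon> n \<omega>)"

(* The estimators act on one sample path y. The argument m is the largest candidate order
   and N the effective sample size, so the observations are y 1, ..., y (m + N). *)
definition gamma_hat :: "(int \<Rightarrow> real) \<Rightarrow> nat \<Rightarrow> nat \<Rightarrow> nat \<Rightarrow> nat \<Rightarrow> real" where
  "gamma_hat y m N i j =
     (\<Sum>n=m+1..m+N. y (int n - int i) * y (int n - int j)) / real N"

(* Vectors and matrices are indexed from 0, lags from 1. *)
definition gamma_vec_hat :: "(int \<Rightarrow> real) \<Rightarrow> nat \<Rightarrow> nat \<Rightarrow> nat \<Rightarrow> real Matrix.vec" where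
  "gamma_vec_hat y m N L = Matrix.vec L (\<lambda>i. gamma_hat y m N (Suc i) 0)"

definition Gamma_mat_hat :: "(int \<Rightarrow> real) \<Rightarrow> nat \<Rightarrow> nat \<Rightarrow> nat \<Rightarrow> real Matrix.mat" where
  "Gamma_mat_hat y m N L = Matrix.mat L L (\<lambda>(i, j). gamma_hat y m N (Suc i) (Suc j))"

(* For a singular matrix mat_inverse is None, and the filter is then an unspecified vector. *)
definition filter_hat :: "(int \<Rightarrow> real) \<Rightarrow> nat \<Rightarrow> nat \<Rightarrow> nat \<Rightarrow> real Matrix.vec" where
  "filter_hat y m N L =
     - (the (mat_inverse (Gamma_mat_hat y m N L)) *\<^sub>v gamma_vec_hat y m N L)"

definition psi_hat :: "(int \<Rightarrow> real) \<Rightarrow> nat \<Rightarrow> nat \<Rightarrow> nat \<Rightarrow> nat \<Rightarrow> real" where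
  "psi_hat y m N L l = vec_index (filter_hat y m N L) (l - 1)"

definition e_hat :: "(int \<Rightarrow> real) \<Rightarrow> nat \<Rightarrow> nat \<Rightarrow> nat \<Rightarrow> real" where
  "e_hat y m N L =
     (\<Sum>n=m+1..m+N. (y (int n) + (\<Sum>l=1..L. psi_hat y m N L l * y (int n - int l)))\<^sup>2) / real N"

definition bridge_criterion :: "(int \<Rightarrow> real) \<Rightarrow> nat \<Rightarrow> nat \<Rightarrow> nat \<Rightarrow> real" where
  "bridge_criterion y m N L =
     ln (e_hat y m N L) + 2 * real m / real N * (\<Sum>k=1..L. 1 / real k)"

(* Ties are not resolved: Lhat N may be any random variable whose value minimizes the
   criterion over the candidate set Cand N. *)
definition bridge_selection ::
  "'a measure \<Rightarrow> (int \<Rightarrow> 'a \<Rightarrow> real) \<Rightarrow> (nat \<Rightarrow> nat) \<Rightarrow> (nat \<Rightarrow> nat set) \<Rightarrow> (nat \<Rightarrow> 'a \<Rightarrow> nat) \<Rightarrow> bool"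
where
  "bridge_selection M x Lmax Cand Lhat \<longleftrightarrow>
     (\<forall>N\<ge>1. Lhat N \<in> measurable M (count_space UNIV) \<and>
       (\<forall>\<omega>\<in>space M.
          is_arg_min (bridge_criterion (\<lambda>n. x n \<omega>) (Lmax N) N) (\<lambda>L. L \<in> Cand N) (Lhat N \<omega>)))"

end

theory Submission
  imports Defs "HOL-Computational_Algebra.Fundamental_Theorem_Algebra"
    "Jordan_Normal_Form.Determinant"
begin

text \<open>
  Let \<open>B\<close> be the vector of scores \<open>\<Sum>n. \<epsilon>\<^sub>n x\<^sub>n\<^sub>-\<^sub>l\<close>. Completing the square in the residual sum of squares
  shows that fitting more than the true order lowers \<open>N e\<^sub>L\<close> by at most \<open>\<bar>B\<bar>\<^sup>2 / (\<kappa> N)\<close>, whereas fitting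
  less than the true order raises \<open>e\<^sub>L\<close> by a fixed amount. Here \<open>\<kappa> N\<close> bounds the Gram matrix of the
  lagged observations from below; as \<open>\<epsilon>\<close> is a finite filter of \<open>x\<close>, this follows from Young's
  inequality and the closeness of the Gram matrix of the noise to \<open>N \<sigma>\<^sup>2 I\<close>, which needs only second
  moments and \<open>Lmax\<^sup>2 / N \<longlonglongrightarrow> 0\<close>.

  For finitely many orders, \<open>\<bar>B\<bar>\<^sup>2 = O (N ln (ln N))\<close> almost surely by the upper half of the law of the
  iterated logarithm, obtained from an exponential supermartingale. This is negligible against the
  increments of the penalty, which are of order \<open>Lmax\<close>. The orders in \<open>{K<..Lmax}\<close> are excluded all
  at once: \<open>\<bar>B\<bar>\<^sup>2 \<le> R N Lmax\<close> with probability close to 1 for large \<open>R\<close>, and their additional penalty is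
  \<open>2 Lmax (1/(L\<^sub>0 + 1) + \<dots> + 1/K)\<close> or more, which wins if \<open>K\<close> is large.

  The process \<open>x\<close> differs from the causal filter of \<open>\<epsilon>\<^sub>0, \<epsilon>\<^sub>1, \<dots>\<close> by a geometrically decaying solution of the
  homogeneous recursion, so in \<open>B\<close> the lags of \<open>x\<close> may be replaced by functions of the past noise.
\<close>

section \<open>Gaussian white noise and the maximal inequality\<close>

text \<open>The scales shape the proof. Up to constants, a gain \<open>\<bar>B\<bar>^2 / N^2\<close>
  in the logarithm of the residual mean competes with penalty increments of order
  \<open>Lmax / N\<close>. Over a fixed set of lags the gain is O(ln ln N / N), which the lower
  growth condition on \<open>Lmax\<close> beats. Over all \<open>Lmax\<close> lags it has the same
  order \<open>Lmax / N\<close> as the penalty, and only the divergence of the harmonic series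
  decides. The almost sure constants depend on the lag, so they give nothing uniform over a growing
  number of lags; there Markov's inequality is used, and the conclusion is one in probability.
  Everything about residuals is proved on one sample path from deterministic hypotheses; the
  probability space enters through the almost sure validity of these hypotheses and through two tail
  bounds. The windows \<open>{m+1..m+N}\<close> move with N, so almost sure statements about them
  are read off from differences of partial sums that start at time 0. A time beyond m minus a lag of
  at most m is still positive, which is why the noise is indexed by natural numbers.\<close>

locale gaussian_noise = prob_space M for M :: "'a measure" +
  fixes e :: "nat \<Rightarrow> 'a \<Rightarrow> real" and \<sigma> :: real
  assumes sigma_pos: "0 < \<sigma>"
    and indep_noise: "indep_vars (\<lambda>_. borel) e UNIV"
    and noise_dist: "distributed M lborel (e n) (normal_density 0 \<sigma>)"
begin

text \<open>The sigma algebra of the noise strictly before time k, generated by the whole tuple so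
  that grouping of independent variables applies to it directly. Weights \<open>w k\<close>
  measurable for \<open>past k\<close> are the predictable ones.\<close>

definition past :: "nat \<Rightarrow> 'a measure" where
  "past k = vimage_algebra (space M) (\<lambda>\<omega>. \<lambda>i\<in>{..<k}. e i \<omega>) (Pi\<^sub>M {..<k} (\<lambda>_. borel))"

lemma noise_measurable [measurable]: "e n \<in> borel_measurable M"
  using distributed_measurable[OF noise_dist] by simp

lemma space_past [simp]: "space (past k) = space M"
  by (simp add: past_def)

lemma noise_past:
  assumes "i < k"
  shows "e i \<in> borel_measurable (past k)"
proof -
  have "(\<lambda>\<omega>. \<lambda>i\<in>{..<k}. e i \<omega>) \<in> measurable (past k) (Pi\<^sub>M {..<k} (\<lambda>_. borel))"
    unfolding past_def by (rule measurable_vimage_algebra1) (auto simp: space_PiM)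
  from measurable_compose[OF this measurable_component_singleton[of i]] assms show ?thesis
    by simp
qed

lemma id_measurable_past: "(\<lambda>\<omega>. \<omega>) \<in> measurable M (past k)"
  unfolding past_def by (rule measurable_vimage_algebra2) (auto intro!: measurable_restrict)

lemma past_measurable: "f \<in> measurable (past k) N \<Longrightarrow> f \<in> measurable M N"
  by (rule measurable_compose[OF id_measurable_past])

lemma past_mono:
  assumes "j \<le> k" "f \<in> measurable (past j) N"
  shows "f \<in> measurable (past k) N"
proof -
  have "(\<lambda>\<omega>. \<omega>) \<in> measurable (past k) (past j)"
    unfolding past_def[of j]
  proof (rule measurable_vimage_algebra2)
    show "(\<lambda>\<omega>. \<lambda>i\<in>{..<j}. e i \<omega>) \<in> measurable (past k) (Pi\<^sub>M {..<j} (\<lambda>_. borel))"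
      using assms(1) by (intro measurable_restrict noise_past) auto
  qed simp
  from measurable_compose[OF this assms(2)] show ?thesis .
qed

text \<open>Grouping the independent family into the index blocks \<open>{..<k}\<close> and
  \<open>{k}\<close> makes the two generated sigma algebras independent; the second one contains the
  events of \<open>e k\<close> through the coordinate projection.\<close>

lemma prob_past_Int_noise:
  assumes A: "A \<in> sets (past k)" and B: "B \<in> sets borel"
  shows "prob (A \<inter> (e k -` B \<inter> space M)) = prob A * prob (e k -` B \<inter> space M)"
proof -
  let ?R = "\<lambda>\<omega>. \<lambda>i\<in>{..<k}. e i \<omega>" and ?P = "Pi\<^sub>M {..<k} (\<lambda>_. borel :: real measure)"
  let ?S = "\<lambda>\<omega>. \<lambda>i\<in>{k}. e i \<omega>" and ?Q = "Pi\<^sub>M {k} (\<lambda>_. borel :: real measure)"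
  have "indep_var ?P ?R ?Q ?S"
    by (rule indep_var_restrict[OF indep_noise]) auto
  then have ind: "indep_set (sigma_sets (space M) {?R -` A \<inter> space M |A. A \<in> sets ?P})
      (sigma_sets (space M) {?S -` A \<inter> space M |A. A \<in> sets ?Q})"
    unfolding indep_var_eq by blast
  have A': "A \<in> sigma_sets (space M) {?R -` A \<inter> space M |A. A \<in> sets ?P}"
    using A unfolding past_def sets_vimage_algebra .
  have "(\<lambda>f. f k) \<in> measurable ?Q borel"
    using measurable_component_singleton[of k "{k}" "\<lambda>_. borel :: real measure"] by simp
  from measurable_sets[OF this B]
  have "?S -` ((\<lambda>f. f k) -` B \<inter> space ?Q) \<inter> space M
      \<in> {?S -` A \<inter> space M |A. A \<in> sets ?Q}"
    by blast
  also have "?S -` ((\<lambda>f. f k) -` B \<inter> space ?Q) \<inter> space M = e k -` B \<inter> space M"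
    by (auto simp: space_PiM)
  finally have B': "e k -` B \<inter> space M
      \<in> sigma_sets (space M) {?S -` A \<inter> space M |A. A \<in> sets ?Q}"
    by (rule sigma_sets.Basic)
  show ?thesis
    by (rule indep_setD[OF ind A' B'])
qed

text \<open>The target space N is arbitrary because the supermartingale step applies this to a pair
  of an extended nonnegative and a real variable.\<close>

lemma distr_past_noise:
  assumes X: "X \<in> measurable (past k) N"
  shows "distr M N X \<Otimes>\<^sub>M distr M borel (e k) = distr M (N \<Otimes>\<^sub>M borel) (\<lambda>\<omega>. (X \<omega>, e k \<omega>))"
proof (rule pair_measure_eqI)
  note [measurable] = past_measurable[OF X]
  interpret D1: prob_space "distr M N X" by (rule prob_space_distr) simp
  interpret D2: prob_space "distr M borel (e k)" by (rule prob_space_distr) simp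
  show "sigma_finite_measure (distr M N X)" "sigma_finite_measure (distr M borel (e k))"
    by unfold_locales
  show "sets (distr M N X \<Otimes>\<^sub>M distr M borel (e k))
      = sets (distr M (N \<Otimes>\<^sub>M borel) (\<lambda>\<omega>. (X \<omega>, e k \<omega>)))"
    by (simp cong: sets_pair_measure_cong)
  fix A B assume A': "A \<in> sets (distr M N X)" and B': "B \<in> sets (distr M borel (e k))"
  then have A [measurable]: "A \<in> sets N" and B [measurable]: "B \<in> sets borel" by auto
  have "X -` A \<inter> space M \<in> sets (past k)"
    using measurable_sets[OF X A] by simp
  from prob_past_Int_noise[OF this B]
  have "emeasure M (X -` A \<inter> space M) * emeasure M (e k -` B \<inter> space M)
      = emeasure M ((X -` A \<inter> space M) \<inter> (e k -` B \<inter> space M))"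
    by (simp add: emeasure_eq_measure ennreal_mult)
  also have "(X -` A \<inter> space M) \<inter> (e k -` B \<inter> space M)
      = (\<lambda>\<omega>. (X \<omega>, e k \<omega>)) -` (A \<times> B) \<inter> space M"
    by auto
  finally show "emeasure (distr M N X) A * emeasure (distr M borel (e k)) B
      = emeasure (distr M (N \<Otimes>\<^sub>M borel) (\<lambda>\<omega>. (X \<omega>, e k \<omega>))) (A \<times> B)"
    by (simp add: emeasure_distr)
qed

lemma indep_past:
  fixes X :: "'a \<Rightarrow> real"
  assumes X: "X \<in> borel_measurable (past k)"
  shows "indep_var borel X borel (e k)"
  unfolding indep_var_distribution_eq
  using past_measurable[OF X] distr_past_noise[OF X] by simp

text \<open>One supermartingale step without conditional expectations: under the product law Fubini
  integrates out \<open>e k\<close> while \<open>X\<close> and \<open>Y\<close> are frozen. Here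
  \<open>X\<close> carries the accumulated exponential and \<open>Y\<close> the current weight.
  Nonnegative integrals spare all integrability conditions.\<close>

lemma nn_integral_past_le:
  fixes X :: "'a \<Rightarrow> ennreal" and Y :: "'a \<Rightarrow> real" and G :: "real \<Rightarrow> real \<Rightarrow> ennreal"
  assumes X: "X \<in> borel_measurable (past k)" and Y: "Y \<in> borel_measurable (past k)"
    and G [measurable]: "(\<lambda>(y, v). G y v) \<in> borel_measurable (borel \<Otimes>\<^sub>M borel)"
    and G1: "\<And>y. (\<integral>\<^sup>+v. normal_density 0 \<sigma> v * G y v \<partial>lborel) \<le> 1"
  shows "(\<integral>\<^sup>+\<omega>. X \<omega> * G (Y \<omega>) (e k \<omega>) \<partial>M) \<le> (\<integral>\<^sup>+\<omega>. X \<omega> \<partial>M)"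
proof -
  note [measurable] = past_measurable[OF X] past_measurable[OF Y]
  let ?N = "borel \<Otimes>\<^sub>M borel :: (ennreal \<times> real) measure"
  let ?D1 = "distr M ?N (\<lambda>\<omega>. (X \<omega>, Y \<omega>))" and ?D2 = "distr M borel (e k)"
  have "(\<lambda>\<omega>. (X \<omega>, Y \<omega>)) \<in> measurable (past k) ?N"
    using X Y by measurable
  note eq = distr_past_noise[OF this]
  interpret D2: prob_space ?D2 by (rule prob_space_distr) simp
  have G': "(\<integral>\<^sup>+v. G y v \<partial>?D2) \<le> 1" for y
  proof -
    have "(\<integral>\<^sup>+v. G y v \<partial>?D2) = (\<integral>\<^sup>+\<omega>. G y (e k \<omega>) \<partial>M)"
      by (subst nn_integral_distr) auto
    also have "\<dots> = (\<integral>\<^sup>+v. normal_density 0 \<sigma> v * G y v \<partial>lborel)"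
      by (rule distributed_nn_integral[OF noise_dist, symmetric]) measurable
    finally show ?thesis using G1[of y] by simp
  qed
  have "(\<integral>\<^sup>+\<omega>. X \<omega> * G (Y \<omega>) (e k \<omega>) \<partial>M)
      = (\<integral>\<^sup>+p. fst (fst p) * G (snd (fst p)) (snd p) \<partial>(?D1 \<Otimes>\<^sub>M ?D2))"
    unfolding eq by (subst nn_integral_distr) auto
  also have "\<dots> = (\<integral>\<^sup>+q. (\<integral>\<^sup>+v. fst q * G (snd q) v \<partial>?D2) \<partial>?D1)"
    by (subst D2.nn_integral_fst[symmetric]) auto
  also have "\<dots> \<le> (\<integral>\<^sup>+q. fst q \<partial>?D1)"
  proof (rule nn_integral_mono)
    fix q :: "ennreal \<times> real"
    have "(\<integral>\<^sup>+v. fst q * G (snd q) v \<partial>?D2) = fst q * (\<integral>\<^sup>+v. G (snd q) v \<partial>?D2)"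
      by (rule nn_integral_cmult) simp
    also have "\<dots> \<le> fst q * 1"
      by (rule mult_left_mono[OF G']) simp
    finally show "(\<integral>\<^sup>+v. fst q * G (snd q) v \<partial>?D2) \<le> fst q" by simp
  qed
  also have "\<dots> = (\<integral>\<^sup>+\<omega>. X \<omega> \<partial>M)"
    by (subst nn_integral_distr) auto
  finally show ?thesis .
qed

text \<open>A general exponent \<open>G\<close> serves two purposes: the exponent linear in the
  noise of the maximal inequality, and the quadratic one of the strong law for squares.\<close>

lemma nn_integral_prod_past_le:
  fixes Y :: "nat \<Rightarrow> 'a \<Rightarrow> real" and G :: "real \<Rightarrow> real \<Rightarrow> real"
  assumes Y: "\<And>k. Y k \<in> borel_measurable (past k)"
    and G [measurable]: "(\<lambda>(y, v). G y v) \<in> borel_measurable (borel \<Otimes>\<^sub>M borel)"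
    and G1: "\<And>y. (\<integral>\<^sup>+v. ennreal (normal_density 0 \<sigma> v * exp (G y v)) \<partial>lborel) \<le> 1"
  shows "(\<integral>\<^sup>+\<omega>. ennreal (exp (\<Sum>k<n. G (Y k \<omega>) (e k \<omega>))) \<partial>M) \<le> 1"
proof (induction n)
  case 0
  show ?case by (simp add: emeasure_space_1)
next
  case (Suc n)
  have step: "(\<lambda>\<omega>. G (Y k \<omega>) (e k \<omega>)) \<in> borel_measurable (past n)" if "k < n" for k
  proof -
    have [measurable]: "Y k \<in> borel_measurable (past n)" "e k \<in> borel_measurable (past n)"
      by (rule past_mono[OF less_imp_le[OF that] Y], rule noise_past[OF that])
    show ?thesis by measurable
  qed
  have "(\<lambda>\<omega>. ennreal (exp (\<Sum>k<n. G (Y k \<omega>) (e k \<omega>)))) \<in> borel_measurable (past n)"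
    by (intro measurable_compose[OF borel_measurable_sum, of _ _ _ "\<lambda>x. ennreal (exp x)"] step)
       auto
  from nn_integral_past_le[OF this Y, of "\<lambda>y v. ennreal (exp (G y v))"] G1
  have "(\<integral>\<^sup>+\<omega>. ennreal (exp (\<Sum>k<n. G (Y k \<omega>) (e k \<omega>))) * ennreal (exp (G (Y n \<omega>) (e n \<omega>))) \<partial>M)
     \<le> (\<integral>\<^sup>+\<omega>. ennreal (exp (\<Sum>k<n. G (Y k \<omega>) (e k \<omega>))) \<partial>M)"
    by (simp add: ennreal_mult)
  with Suc show ?case
    by (simp add: exp_add ennreal_mult)
qed

lemma nn_integral_normal_density: "s > 0 \<Longrightarrow> (\<integral>\<^sup>+v. ennreal (normal_density \<mu> s v) \<partial>lborel) = 1"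
  by (subst nn_integral_eq_integral) auto

text \<open>Each factor \<open>exp (w e - \<sigma>^2 w^2 / 2)\<close> has Gaussian mean one for
  fixed w. The process stopped at its first passage over a still exceeds a at time N, so Markov's
  inequality at the single time N bounds the passage probability.\<close>

lemma maximal_inequality:
  fixes w :: "nat \<Rightarrow> 'a \<Rightarrow> real"
  assumes w: "\<And>k. w k \<in> borel_measurable (past k)"
  defines "Z \<equiv> \<lambda>n \<omega>. \<Sum>k<n. w k \<omega> * e k \<omega> - \<sigma>\<^sup>2 * (w k \<omega>)\<^sup>2 / 2"
  shows "prob {\<omega>\<in>space M. \<exists>n\<le>N. a \<le> Z n \<omega>} \<le> exp (- a)"
proof -
  let ?G = "\<lambda>y v. y * v - \<sigma>\<^sup>2 * y\<^sup>2 / 2"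
  have Zp: "Z j \<in> borel_measurable (past k)" if "j \<le> k" for j k
  proof -
    have "(\<lambda>\<omega>. w i \<omega> * e i \<omega> - \<sigma>\<^sup>2 * (w i \<omega>)\<^sup>2 / 2) \<in> borel_measurable (past k)" if "i < j" for i
    proof -
      have [measurable]: "w i \<in> borel_measurable (past k)" "e i \<in> borel_measurable (past k)"
        by (rule past_mono[OF less_imp_le w] noise_past, use \<open>i < j\<close> \<open>j \<le> k\<close> in simp)+
      show ?thesis by measurable
    qed
    then show ?thesis unfolding Z_def by (intro borel_measurable_sum) auto
  qed
  \<comment> \<open>switching the weights off after the first passage stops the process and keeps them adapted\<close>
  define w' where "w' k \<omega> = (if \<exists>j\<le>k. a \<le> Z j \<omega> then 0 else w k \<omega>)" for k \<omega>
  define Z' where "Z' n \<omega> = (\<Sum>k<n. ?G (w' k \<omega>) (e k \<omega>))" for n \<omega>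
  have w': "w' k \<in> borel_measurable (past k)" for k
  proof -
    have passed: "{\<omega>\<in>space (past k). \<exists>j\<le>k. a \<le> Z j \<omega>} \<in> sets (past k)"
    proof -
      have "{\<omega>\<in>space (past k). \<exists>j\<le>k. a \<le> Z j \<omega>} = (\<Union>j\<in>{..k}. {\<omega>\<in>space (past k). a \<le> Z j \<omega>})"
        by auto
      also have "\<dots> \<in> sets (past k)"
      proof (intro sets.finite_UN)
        fix j assume "j \<in> {..k}"
        then have [measurable]: "Z j \<in> borel_measurable (past k)" using Zp by auto
        show "{\<omega>\<in>space (past k). a \<le> Z j \<omega>} \<in> sets (past k)" by measurable
      qed auto
      finally show ?thesis .
    qed
    show ?thesis unfolding w'_def by (rule measurable_If[OF _ w passed]) simp
  qed
  have [measurable]: "Z n \<in> borel_measurable M" "Z' n \<in> borel_measurable M" for n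
  proof -
    show "Z n \<in> borel_measurable M" using past_measurable[OF Zp[of n n]] by simp
    have [measurable]: "w' k \<in> borel_measurable M" for k by (rule past_measurable[OF w'])
    show "Z' n \<in> borel_measurable M" unfolding Z'_def by measurable
  qed
  have pass: "a \<le> Z' N \<omega>" if ex: "\<exists>n\<le>N. a \<le> Z n \<omega>" for \<omega>
  proof -
    define m where "m = (LEAST n. a \<le> Z n \<omega>)"
    have m: "a \<le> Z m \<omega>" "m \<le> N"
      using ex unfolding m_def by (auto intro: LeastI order_trans[OF Least_le])
    have lt: "\<not> a \<le> Z j \<omega>" if "j < m" for j
      using that unfolding m_def by (rule not_less_Least)
    have "Z' n \<omega> = (if n \<le> m then Z n \<omega> else Z m \<omega>)" for n
    proof (induction n)
      case 0 then show ?case by (simp add: Z'_def Z_def)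
    next
      case (Suc n)
      have S: "Z' (Suc n) \<omega> = Z' n \<omega> + ?G (w' n \<omega>) (e n \<omega>)"
        by (simp add: Z'_def)
      show ?case
      proof (cases "n < m")
        case True
        then have "w' n \<omega> = w n \<omega>"
          using lt by (auto simp: w'_def)
        then show ?thesis using S Suc True by (simp add: Z_def)
      next
        case False
        then have "w' n \<omega> = 0"
          using m by (auto simp: w'_def)
        then show ?thesis using S Suc False by (auto simp: le_Suc_eq)
      qed
    qed
    with m show ?thesis by auto
  qed
  have int1: "(\<integral>\<^sup>+\<omega>. ennreal (exp (Z' N \<omega>)) \<partial>M) \<le> 1"
    unfolding Z'_def
  proof (rule nn_integral_prod_past_le[OF w', of ?G])
    fix y :: real
    \<comment> \<open>Exponential tilting only moves the mean of the Gaussian, here to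
      \<open>\<sigma>^2 * y\<close>, so the total mass stays one.\<close>
    have "normal_density 0 \<sigma> v * exp (?G y v) = normal_density (\<sigma>\<^sup>2 * y) \<sigma> v" for v
      unfolding normal_density_def using sigma_pos
      by (simp add: exp_add[symmetric] field_simps power2_eq_square)
    then show "(\<integral>\<^sup>+v. ennreal (normal_density 0 \<sigma> v * exp (?G y v)) \<partial>lborel) \<le> 1"
      using nn_integral_normal_density[OF sigma_pos] by simp
  qed measurable
  have "emeasure M {\<omega>\<in>space M. \<exists>n\<le>N. a \<le> Z n \<omega>}
      \<le> emeasure M {\<omega>\<in>space M. 1 \<le> ennreal (exp (- a)) * ennreal (exp (Z' N \<omega>))}"
  proof (rule emeasure_mono)
    show "{\<omega>\<in>space M. \<exists>n\<le>N. a \<le> Z n \<omega>}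
      \<subseteq> {\<omega>\<in>space M. 1 \<le> ennreal (exp (- a)) * ennreal (exp (Z' N \<omega>))}"
      using pass by (auto simp: ennreal_mult[symmetric] exp_add[symmetric])
  qed measurable
  also have "\<dots> \<le> ennreal (exp (- a)) * (\<integral>\<^sup>+\<omega>. ennreal (exp (Z' N \<omega>)) \<partial>M)"
    by (rule order_trans[OF nn_integral_Markov_inequality[where A = "space M"]])
       (auto intro!: mult_left_mono nn_integral_mono simp: indicator_def)
  also have "\<dots> \<le> ennreal (exp (- a)) * 1"
    by (rule mult_left_mono[OF int1]) simp
  finally show ?thesis
    by (simp add: emeasure_eq_measure)
qed

end

section \<open>Almost sure bounds and second moments\<close>

text \<open>The shift by 16 keeps the iterated logarithm away from zero at every n, since ln 16 = 4
  ln 2 exceeds 2; bounds of iterated-logarithm type can then be stated for all n, including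
  0.\<close>

lemma lnln_ge: "1 / 2 \<le> ln (ln (real n + 16))"
proof -
  have "ln (2::real) \<ge> 1/2"
    using ln2_ge_two_thirds by simp
  moreover have "ln (16::real) = 4 * ln 2"
    using ln_realpow[of 2 4] by simp
  ultimately have "2 \<le> ln (16::real)" by simp
  also have "\<dots> \<le> ln (real n + 16)" by simp
  finally have "2 \<le> ln (real n + 16)" .
  then have "ln 2 \<le> ln (ln (real n + 16))"
    by (subst ln_le_cancel_iff) auto
  with \<open>ln (2::real) \<ge> 1/2\<close> show ?thesis by linarith
qed

section \<open>Law of the iterated logarithm, strong law for the squares, second moments\<close>

context gaussian_noise begin

lemma past_sum_measurable:
  assumes "\<And>i. i < j \<Longrightarrow> f i \<in> borel_measurable (past (Suc i))" "j \<le> k"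
  shows "(\<lambda>\<omega>. \<Sum>i<j. f i \<omega> :: real) \<in> borel_measurable (past k)"
proof (rule borel_measurable_sum)
  fix i assume "i \<in> {..<j}"
  then have "i < j" by simp
  with assms(2) have "Suc i \<le> k" by simp
  from past_mono[OF this assms(1)[OF \<open>i < j\<close>]] show "f i \<in> borel_measurable (past k)" .
qed

text \<open>
  On the block \<open>n \<le> 2\<^sup>k\<^sup>+\<^sup>1\<close> the maximal inequality is applied to \<open>sqrt (ln k / 2\<^sup>k) w\<close> with threshold
  \<open>2 ln k\<close>, so that the exceptional probabilities \<open>1/k\<^sup>2\<close> are summable.
\<close>

lemma AE_eventually_exp_martingale_bound:
  fixes w :: "nat \<Rightarrow> 'a \<Rightarrow> real"
  assumes w: "\<And>k. w k \<in> borel_measurable (past k)"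
  shows "AE \<omega> in M. \<forall>\<^sub>F k in sequentially. \<forall>n\<le>2^(k+1).
           sqrt (ln k / 2^k) * (\<Sum>i<n. w i \<omega> * e i \<omega>)
             < 2 * ln k + \<sigma>\<^sup>2 * (ln k / 2^k) * (\<Sum>i<n. (w i \<omega>)\<^sup>2) / 2"
proof -
  define l where "l k = sqrt (ln (real k) / 2^k)" for k :: nat
  define Z where "Z k n \<omega> = (\<Sum>i<n. (l k * w i \<omega>) * e i \<omega> - \<sigma>\<^sup>2 * (l k * w i \<omega>)\<^sup>2 / 2)" for k n \<omega>
  define A where "A k = {\<omega>\<in>space M. \<exists>n\<le>2^(k+1). 2 * ln (real k) \<le> Z k n \<omega>}" for k
  have [measurable]: "w k \<in> borel_measurable M" for k by (rule past_measurable[OF w])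
  have [measurable]: "Z k n \<in> borel_measurable M" for k n unfolding Z_def by measurable
  have A [measurable]: "A k \<in> sets M" for k unfolding A_def by measurable
  have pA: "prob (A k) \<le> exp (- (2 * ln (real k)))" for k
    unfolding A_def Z_def
  proof (rule maximal_inequality)
    show "(\<lambda>\<omega>. l k * w i \<omega>) \<in> borel_measurable (past i)" for i
      using w[of i] by simp
  qed
  have "summable (\<lambda>k. prob (A k))"
  proof (rule summable_comparison_test_ev[OF _ inverse_power_summable[of 2]])
    show "\<forall>\<^sub>F k in sequentially. norm (prob (A k)) \<le> inverse (real k ^ 2)"
      using eventually_gt_at_top[of 0]
    proof eventually_elim
      case (elim k)
      have "exp (- (2 * ln (real k))) = inverse (real k ^ 2)"
        using elim by (simp add: exp_minus exp_double)
      with pA[of k] show ?case by simp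
    qed
  qed simp
  from borel_cantelli_AE1[OF A _ this]
  have "AE \<omega> in M. \<forall>\<^sub>F k in sequentially. \<omega> \<in> space M - A k"
    by (simp add: emeasure_eq_measure)
  then show ?thesis
  proof eventually_elim
    case (elim \<omega>)
    then show ?case
      using eventually_gt_at_top[of 1]
    proof eventually_elim
      case (elim k)
      have sq: "(l k)\<^sup>2 = ln (real k) / 2^k"
        using elim(2) by (simp add: l_def)
      have "Z k n \<omega> = l k * (\<Sum>i<n. w i \<omega> * e i \<omega>) - \<sigma>\<^sup>2 * (l k)\<^sup>2 * (\<Sum>i<n. (w i \<omega>)\<^sup>2) / 2" for n
        by (simp add: Z_def sum_subtractf sum_distrib_left sum_divide_distrib power_mult_distrib
            algebra_simps)
      then show ?case
        using elim(1) unfolding A_def sq by (fastforce simp: l_def not_le)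
    qed
  qed
qed

text \<open>For n between \<open>2^k\<close> and \<open>2^(k+1)\<close> linear growth of the squared
  weights turns both terms of the block bound into multiples of \<open>ln k\<close>, and
  \<open>ln k\<close> is at most \<open>2 * ln (ln (n + 16))\<close>. The growth condition stands
  inside the almost sure statement, so that D and C may depend on the path. The bounds for
  \<open>w\<close> and \<open>- w\<close> together control the absolute value.\<close>

lemma lil_upper_bound:
  fixes w :: "nat \<Rightarrow> 'a \<Rightarrow> real"
  assumes w: "\<And>k. w k \<in> borel_measurable (past k)"
  shows "AE \<omega> in M. (\<exists>D. \<forall>n. (\<Sum>i<n. (w i \<omega>)\<^sup>2) \<le> D * (real n + 1)) \<longrightarrow>
    (\<exists>C. \<forall>n. (\<Sum>i<n. w i \<omega> * e i \<omega>)\<^sup>2 \<le> C * (real n + 1) * ln (ln (real n + 16)))"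
proof -
  have "(\<lambda>\<omega>. - w k \<omega>) \<in> borel_measurable (past k)" for k
    using w[of k] by simp
  from AE_eventually_exp_martingale_bound[OF w] AE_eventually_exp_martingale_bound[OF this]
  show ?thesis
  proof eventually_elim
    case (elim \<omega>)
    define S where "S n = (\<Sum>i<n. w i \<omega> * e i \<omega>)" for n
    define V where "V n = (\<Sum>i<n. (w i \<omega>)\<^sup>2)" for n
    show ?case
    proof (intro impI)
      assume "\<exists>D. \<forall>n. (\<Sum>i<n. (w i \<omega>)\<^sup>2) \<le> D * (real n + 1)"
      then obtain D where D: "\<And>n. V n \<le> D * (real n + 1)" unfolding V_def by auto
      have D0: "0 \<le> D" using D[of 0] by (simp add: V_def)
      from elim eventually_ge_at_top[of 2]
      have "\<forall>\<^sub>F k in sequentially. 2 \<le> k \<and> (\<forall>n\<le>2^(k+1).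
           sqrt (ln k / 2^k) * \<bar>S n\<bar> < 2 * ln k + \<sigma>\<^sup>2 * (ln k / 2^k) * V n / 2)"
        by eventually_elim (auto simp: S_def V_def abs_if sum_negf)
      then obtain K where K: "\<And>k n. k \<ge> K \<Longrightarrow> 2 \<le> k \<and> (n \<le> 2^(k+1) \<longrightarrow>
           sqrt (ln k / 2^k) * \<bar>S n\<bar> < 2 * ln k + \<sigma>\<^sup>2 * (ln k / 2^k) * V n / 2)"
        unfolding eventually_sequentially by blast
      define L where "L n = ln (ln (real n + 16))" for n :: nat
      \<comment> \<open>The square of the block bound, times the 2 from comparing
        \<open>ln k\<close> with the iterated logarithm of n.\<close>
      define E where "E = (2 + \<sigma>\<^sup>2 * D)\<^sup>2 * 2"
      \<comment> \<open>The finitely many n below the first good block are absorbed by their sum of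
        squares; the factor 2 compensates for \<open>L n\<close> being possibly only 1/2.\<close>
      define C where "C = E + 2 * (\<Sum>n<2^K. (S n)\<^sup>2)"
      have L: "1 / 2 \<le> L n" for n unfolding L_def by (rule lnln_ge)
      have E0: "0 \<le> E" by (simp add: E_def)
      have big: "(S n)\<^sup>2 \<le> E * (real n + 1) * L n" if n: "2^K \<le> n" for n
      proof -
        have "1 \<le> n" using n by (metis le_trans one_le_power one_le_numeral)
        from ex_power_ivl1[OF _ this, of 2] obtain k where k: "2^k \<le> n" "n < 2^(k+1)" by auto
        have "2^K < (2::nat)^(k+1)" using n k by linarith
        then have "K \<le> k" by (simp add: power_strict_increasing_iff flip: power_Suc)
        with K[of k n] k have k2: "2 \<le> k"
          and bd: "sqrt (ln k / 2^k) * \<bar>S n\<bar> < 2 * ln k + \<sigma>\<^sup>2 * (ln k / 2^k) * V n / 2" by auto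
        have lk: "0 < ln (real k)" using k2 by simp
        have n1: "real n + 1 \<le> 2 * 2^k"
        proof -
          have "n + 1 \<le> 2 * 2^k" using k by simp
          then have "real (n + 1) \<le> real (2 * 2^k)" by (rule of_nat_mono)
          then show ?thesis by simp
        qed
        have "V n \<le> D * (2 * 2^k)"
          using D[of n] mult_left_mono[OF n1 D0] by simp
        then have "\<sigma>\<^sup>2 * (ln k / 2^k) * V n / 2 \<le> \<sigma>\<^sup>2 * (ln k / 2^k) * (D * (2 * 2^k)) / 2"
          using lk by (intro divide_right_mono mult_left_mono) auto
        also have "\<dots> = \<sigma>\<^sup>2 * D * ln k" by simp
        finally have le: "sqrt (ln k / 2^k) * \<bar>S n\<bar> \<le> (2 + \<sigma>\<^sup>2 * D) * ln k"
          using bd by (simp add: algebra_simps)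
        have "(ln k / 2^k) * (S n)\<^sup>2 = (sqrt (ln k / 2^k) * \<bar>S n\<bar>)\<^sup>2"
          using lk by (simp add: power_mult_distrib)
        also have "\<dots> \<le> ((2 + \<sigma>\<^sup>2 * D) * ln k)\<^sup>2"
          using le lk by (intro power_mono) auto
        also have "\<dots> = (ln k / 2^k) * ((2 + \<sigma>\<^sup>2 * D)\<^sup>2 * 2^k * ln k)"
          by (simp add: power2_eq_square)
        finally have S1: "(S n)\<^sup>2 \<le> (2 + \<sigma>\<^sup>2 * D)\<^sup>2 * 2^k * ln k"
          using lk by (subst (asm) mult_le_cancel_left_pos) auto
        \<comment> \<open>From here on:
          \<open>k \<le> 2 * ln (n + 16) \<le> (ln (n + 16))^2\<close>, whose logarithm is twice the
          iterated one.\<close>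
        have "real k * ln 2 = ln (2^k)" by (simp add: ln_realpow)
        also have "\<dots> \<le> ln (real n + 16)"
        proof -
          have "(2::real)^k \<le> real n + 16"
            using of_nat_mono[OF k(1), where 'a = real] unfolding of_nat_power of_nat_numeral by linarith
          then show ?thesis by (subst ln_le_cancel_iff) auto
        qed
        finally have "real k * ln 2 \<le> ln (real n + 16)" .
        moreover have "real k * (1/2) \<le> real k * ln 2"
          using ln2_ge_two_thirds by (intro mult_left_mono) auto
        ultimately have "real k \<le> 2 * ln (real n + 16)" by simp
        moreover have l2: "2 \<le> ln (real n + 16)"
        proof -
          have "ln (16::real) = 4 * ln 2"
            using ln_realpow[of 2 4] by simp
          then have "2 \<le> ln (16::real)" using ln2_ge_two_thirds by simp
          also have "\<dots> \<le> ln (real n + 16)" by simp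
          finally show ?thesis .
        qed
        moreover have "2 * ln (real n + 16) \<le> ln (real n + 16) * ln (real n + 16)"
          using l2 by (intro mult_right_mono) auto
        ultimately have "real k \<le> (ln (real n + 16))\<^sup>2"
          unfolding power2_eq_square by linarith
        then have "ln (real k) \<le> ln ((ln (real n + 16))\<^sup>2)"
          using k2 l2 by (subst ln_le_cancel_iff) auto
        also have "\<dots> = 2 * L n"
          using l2 by (simp add: L_def ln_realpow)
        finally have "2^k * ln k \<le> (real n + 1) * (2 * L n)"
        proof (intro mult_mono)
          show "2^k \<le> real n + 1"
            using of_nat_mono[OF k(1), where 'a = real] unfolding of_nat_power of_nat_numeral by linarith
        qed (use lk in auto)
        then have "(2 + \<sigma>\<^sup>2 * D)\<^sup>2 * (2^k * ln k) \<le> (2 + \<sigma>\<^sup>2 * D)\<^sup>2 * ((real n + 1) * (2 * L n))"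
          by (rule mult_left_mono) simp
        with S1 show ?thesis
          by (simp add: E_def algebra_simps)
      qed
      have "(S n)\<^sup>2 \<le> C * (real n + 1) * L n" for n
      proof (cases "2^K \<le> n")
        case True
        have "E \<le> C" by (simp add: C_def sum_nonneg)
        then have "E * ((real n + 1) * L n) \<le> C * ((real n + 1) * L n)"
          using L[of n] by (intro mult_right_mono) auto
        then show ?thesis using big[OF True] unfolding mult.assoc by linarith
      next
        case False
        then have "(S n)\<^sup>2 \<le> (\<Sum>n<2^K. (S n)\<^sup>2)"
          by (intro member_le_sum) auto
        then have "2 * (S n)\<^sup>2 \<le> C"
          using E0 by (simp add: C_def)
        moreover have "C * (1 * (1/2)) \<le> C * ((real n + 1) * L n)"
          using L[of n] E0 by (intro mult_left_mono mult_mono) (auto simp: C_def sum_nonneg)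
        ultimately show ?thesis by (simp add: mult.assoc)
      qed
      then show "\<exists>C. \<forall>n. (\<Sum>i<n. w i \<omega> * e i \<omega>)\<^sup>2 \<le> C * (real n + 1) * ln (ln (real n + 16))"
        unfolding S_def L_def by blast
    qed
  qed
qed

text \<open>The mean of \<open>exp (t * e^2 / (2 * \<sigma>^2))\<close> is \<open>(1 - t)\<close> to
  the power -1/2, so the normalised exponential product has mean at most one. Markov's inequality at
  level \<open>2 * ln n\<close> leaves probabilities \<open>1/n^2\<close>, and Borel-Cantelli
  applies. Negative t is allowed and gives the lower bound in the strong law.\<close>

lemma AE_eventually_sum_squares_bound:
  assumes t: "t < 1"
  shows "AE \<omega> in M. \<forall>\<^sub>F n in sequentially.
    t / (2 * \<sigma>\<^sup>2) * (\<Sum>k<n. (e k \<omega>)\<^sup>2) + real n * ln (1 - t) / 2 < 2 * ln n"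
proof -
  define Z where "Z n \<omega> = (\<Sum>k<n. t * (e k \<omega>)\<^sup>2 / (2 * \<sigma>\<^sup>2) + ln (1 - t) / 2)" for n \<omega>
  define A where "A n = {\<omega>\<in>space M. 2 * ln (real n) \<le> Z n \<omega>}" for n
  have [measurable]: "Z n \<in> borel_measurable M" for n unfolding Z_def by measurable
  have A [measurable]: "A n \<in> sets M" for n unfolding A_def by measurable
  have int1: "(\<integral>\<^sup>+\<omega>. ennreal (exp (Z n \<omega>)) \<partial>M) \<le> 1" for n
    unfolding Z_def
  proof (rule nn_integral_prod_past_le[of "\<lambda>_ _. 0" "\<lambda>_ v. t * v\<^sup>2 / (2 * \<sigma>\<^sup>2) + ln (1 - t) / 2"])
    fix y :: real
    let ?s = "\<sigma> / sqrt (1 - t)"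
    have s2: "?s\<^sup>2 = \<sigma>\<^sup>2 / (1 - t)" using t by (simp add: power_divide)
    have e: "exp (ln (1 - t) / 2) = sqrt (1 - t)"
      using t by (simp add: powr_half_sqrt[symmetric] powr_def)
    \<comment> \<open>A quadratic tilt changes the variance of the Gaussian to
      \<open>\<sigma>^2 / (1 - t)\<close>; the term \<open>ln (1 - t) / 2\<close> is the
      normalisation.\<close>
    have "normal_density 0 \<sigma> v * exp (t * v\<^sup>2 / (2 * \<sigma>\<^sup>2) + ln (1 - t) / 2) = normal_density 0 ?s v" for v
    proof -
      have "- (v\<^sup>2 / (2 * \<sigma>\<^sup>2)) + t * v\<^sup>2 / (2 * \<sigma>\<^sup>2) = - (v\<^sup>2 / (2 * (\<sigma>\<^sup>2 / (1 - t))))"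
        using sigma_pos t by (simp add: field_simps)
      then have "exp (- (v\<^sup>2 / (2 * \<sigma>\<^sup>2))) * exp (t * v\<^sup>2 / (2 * \<sigma>\<^sup>2)) = exp (- (v\<^sup>2 / (2 * (\<sigma>\<^sup>2 / (1 - t)))))"
        by (simp add: exp_add[symmetric])
      moreover have "1 / sqrt (2 * pi * (\<sigma>\<^sup>2 / (1 - t))) = sqrt (1 - t) / sqrt (2 * pi * \<sigma>\<^sup>2)"
        using t by (simp add: real_sqrt_divide real_sqrt_mult)
      ultimately show ?thesis
        unfolding normal_density_def s2 exp_add e by (simp add: mult_ac)
    qed
    then show "(\<integral>\<^sup>+v. ennreal (normal_density 0 \<sigma> v * exp (t * v\<^sup>2 / (2 * \<sigma>\<^sup>2) + ln (1 - t) / 2)) \<partial>lborel) \<le> 1"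
      using nn_integral_normal_density[of ?s] sigma_pos t by simp
  qed measurable
  have pA: "prob (A n) \<le> exp (- (2 * ln (real n)))" for n
  proof -
    have "emeasure M (A n) \<le> emeasure M {\<omega>\<in>space M. 1 \<le> ennreal (exp (- (2 * ln (real n)))) * ennreal (exp (Z n \<omega>))}"
      by (rule emeasure_mono) (auto simp: A_def ennreal_mult[symmetric] exp_add[symmetric])
    also have "\<dots> \<le> ennreal (exp (- (2 * ln (real n)))) * (\<integral>\<^sup>+\<omega>. ennreal (exp (Z n \<omega>)) \<partial>M)"
      by (rule order_trans[OF nn_integral_Markov_inequality[where A = "space M"]])
         (auto intro!: mult_left_mono nn_integral_mono simp: indicator_def)
    also have "\<dots> \<le> ennreal (exp (- (2 * ln (real n)))) * 1"
      by (rule mult_left_mono[OF int1]) simp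
    finally show ?thesis by (simp add: emeasure_eq_measure)
  qed
  have "summable (\<lambda>k. prob (A k))"
  proof (rule summable_comparison_test_ev[OF _ inverse_power_summable[of 2]])
    show "\<forall>\<^sub>F k in sequentially. norm (prob (A k)) \<le> inverse (real k ^ 2)"
      using eventually_gt_at_top[of 0]
    proof eventually_elim
      case (elim k)
      have "exp (- (2 * ln (real k))) = inverse (real k ^ 2)"
        using elim by (simp add: exp_minus exp_double)
      with pA[of k] show ?case by simp
    qed
  qed simp
  from borel_cantelli_AE1[OF A _ this]
  have "AE \<omega> in M. \<forall>\<^sub>F k in sequentially. \<omega> \<in> space M - A k"
    by (simp add: emeasure_eq_measure)
  then show ?thesis
  proof eventually_elim
    case (elim \<omega>)
    then show ?case
    proof eventually_elim
      case (elim n)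
      have "Z n \<omega> = t / (2 * \<sigma>\<^sup>2) * (\<Sum>k<n. (e k \<omega>)\<^sup>2) + real n * ln (1 - t) / 2"
        by (simp add: Z_def sum.distrib sum_distrib_left)
      then show ?case using elim by (auto simp: A_def)
    qed
  qed
qed

text \<open>The exponential bound is used along the countable family \<open>t = 1 / (j + 2)\<close>
  and its negatives. Divided by t it confines the normalised mean to an interval around 1 whose
  half-width is of order t.\<close>

lemma slln_squares: "AE \<omega> in M. (\<lambda>n. (\<Sum>k<n. (e k \<omega>)\<^sup>2) / real n) \<longlonglongrightarrow> \<sigma>\<^sup>2"
proof -
  have "AE \<omega> in M. \<forall>j. \<forall>\<^sub>F n in sequentially.
    (1 / real (j + 2)) / (2 * \<sigma>\<^sup>2) * (\<Sum>k<n. (e k \<omega>)\<^sup>2) + real n * ln (1 - (1 / real (j + 2))) / 2 < 2 * ln n"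
    unfolding AE_all_countable by (intro allI AE_eventually_sum_squares_bound) simp
  moreover have "AE \<omega> in M. \<forall>j. \<forall>\<^sub>F n in sequentially.
    (- (1 / real (j + 2))) / (2 * \<sigma>\<^sup>2) * (\<Sum>k<n. (e k \<omega>)\<^sup>2) + real n * ln (1 - (- (1 / real (j + 2)))) / 2 < 2 * ln n"
    unfolding AE_all_countable
  proof (intro allI AE_eventually_sum_squares_bound)
    fix j :: nat
    have "- (1 / real (j + 2)) \<le> 0" by simp
    also have "\<dots> < (1::real)" by simp
    finally show "- (1 / real (j + 2)) < 1" .
  qed
  ultimately show ?thesis
  proof eventually_elim
    case (elim \<omega>)
    define Q where "Q n = (\<Sum>k<n. (e k \<omega>)\<^sup>2) / (\<sigma>\<^sup>2 * real n)" for n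
    have "Q \<longlonglongrightarrow> 1"
    proof (rule LIMSEQ_I)
      fix r :: real assume r: "r > 0"
      obtain j :: nat where j: "3 / r < real j" using reals_Archimedean2 by blast
      \<comment> \<open>The shift by 2 gives \<open>t \<le> 1/2\<close>, the range in which
        \<open>ln (1 + x)\<close> differs from x by at most \<open>2 * x^2\<close>. With the error
        \<open>4 ln n / n < t^2\<close> the deviation is below \<open>3 * t\<close>, hence the
        choice \<open>3 / r < j\<close>.\<close>
      define t where "t = 1 / real (j + 2)"
      have t: "0 < t" "t \<le> 1/2" by (auto simp: t_def field_simps)
      have tr: "3 * t < r"
      proof -
        have "3 < r * real j" using j r by (simp add: field_simps)
        also have "\<dots> \<le> r * real (j + 2)" using r by simp
        finally show ?thesis by (simp add: t_def field_simps)
      qed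
      have "(\<lambda>n. 4 * (ln (real n) / real n)) \<longlonglongrightarrow> 4 * 0"
        by (intro tendsto_mult tendsto_const lim_ln_over_n)
      then have "\<forall>\<^sub>F n in sequentially. 4 * (ln (real n) / real n) < t\<^sup>2"
        by (rule order_tendstoD(2)) (use t in simp)
      then have "\<forall>\<^sub>F n in sequentially. norm (Q n - 1) < r"
        using elim(1)[rule_format, of j] elim(2)[rule_format, of j] eventually_gt_at_top[of 0]
        unfolding t_def[symmetric]
      proof eventually_elim
        case (elim n)
        have SQ: "(\<Sum>k<n. (e k \<omega>)\<^sup>2) = \<sigma>\<^sup>2 * real n * Q n"
          using elim(4) sigma_pos by (simp add: Q_def)
        have bounds: "- t - 2 * t\<^sup>2 \<le> ln (1 - t)" "t - 2 * t\<^sup>2 \<le> ln (1 + t)"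
          using abs_ln_one_plus_x_minus_x_bound[of t] abs_ln_one_plus_x_minus_x_bound[of "- t"] t
          by auto
        have "real n * (t * Q n + ln (1 - t)) < real n * (4 * (ln n / n))"
          using elim(2,4) sigma_pos unfolding SQ by (simp add: field_simps)
        then have "t * Q n + ln (1 - t) < 4 * (ln n / n)"
          using elim(4) by (subst (asm) mult_less_cancel_left_pos) auto
        then have "t * Q n < t + 3 * t\<^sup>2" using elim(1) bounds by linarith
        then have "t * Q n < t * (1 + 3 * t)" by (simp add: algebra_simps power2_eq_square)
        then have up: "Q n < 1 + 3 * t" using t by (subst (asm) mult_less_cancel_left_pos) auto
        have "real n * (- t * Q n + ln (1 + t)) < real n * (4 * (ln n / n))"
          using elim(3,4) sigma_pos unfolding SQ by (simp add: field_simps)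
        then have "- t * Q n + ln (1 + t) < 4 * (ln n / n)"
          using elim(4) by (subst (asm) mult_less_cancel_left_pos) auto
        then have "t - 3 * t\<^sup>2 < t * Q n" using elim(1) bounds by linarith
        then have "t * (1 - 3 * t) < t * Q n" by (simp add: algebra_simps power2_eq_square)
        then have lo: "1 - 3 * t < Q n" using t by (subst (asm) mult_less_cancel_left_pos) auto
        show ?case using up lo tr by auto
      qed
      then show "\<exists>no. \<forall>n\<ge>no. norm (Q n - 1) < r"
        unfolding eventually_sequentially .
    qed
    then have "(\<lambda>n. \<sigma>\<^sup>2 * Q n) \<longlonglongrightarrow> \<sigma>\<^sup>2 * 1"
      by (intro tendsto_mult tendsto_const)
    then show ?case using sigma_pos by (simp add: Q_def)
  qed
qed

text \<open>Orthogonality of martingale increments: the cross term is a past variable times an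
  independent centred one. The function g is kept general, as both the noise itself and its centred
  square occur.\<close>

lemma second_moment_weighted_sum:
  fixes w :: "nat \<Rightarrow> 'a \<Rightarrow> real" and g :: "real \<Rightarrow> real"
  assumes w: "\<And>k. w k \<in> borel_measurable (past k)"
    and w2: "\<And>k. integrable M (\<lambda>\<omega>. (w k \<omega>)\<^sup>2)"
    and g: "g \<in> borel_measurable borel"
    and g2: "\<And>k. integrable M (\<lambda>\<omega>. (g (e k \<omega>))\<^sup>2)" "\<And>k. expectation (\<lambda>\<omega>. (g (e k \<omega>))\<^sup>2) = v"
    and g1: "\<And>k. expectation (\<lambda>\<omega>. g (e k \<omega>)) = 0"
  shows "integrable M (\<lambda>\<omega>. (\<Sum>k<n. w k \<omega> * g (e k \<omega>))\<^sup>2)"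
    and "expectation (\<lambda>\<omega>. (\<Sum>k<n. w k \<omega> * g (e k \<omega>))\<^sup>2) = v * (\<Sum>k<n. expectation (\<lambda>\<omega>. (w k \<omega>)\<^sup>2))"
proof -
  note [measurable] = g
  have [measurable]: "w k \<in> borel_measurable M" for k by (rule past_measurable[OF w])
  define S where "S n \<omega> = (\<Sum>k<n. w k \<omega> * g (e k \<omega>))" for n \<omega>
  have [measurable]: "S n \<in> borel_measurable M" for n unfolding S_def by measurable
  have Sp: "S n \<in> borel_measurable (past n)" for n
    unfolding S_def
  proof (rule past_sum_measurable)
    fix i
    have [measurable]: "w i \<in> borel_measurable (past (Suc i))" "e i \<in> borel_measurable (past (Suc i))"
      by (rule past_mono[OF _ w], simp) (rule noise_past, simp)
    show "(\<lambda>\<omega>. w i \<omega> * g (e i \<omega>)) \<in> borel_measurable (past (Suc i))" by measurable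
  qed simp
  have gint: "integrable M (\<lambda>\<omega>. g (e k \<omega>))" for k
  proof (rule Bochner_Integration.integrable_bound)
    show "integrable M (\<lambda>\<omega>. 1 + (g (e k \<omega>))\<^sup>2)" using g2 by simp
    show "AE \<omega> in M. norm (g (e k \<omega>)) \<le> norm (1 + (g (e k \<omega>))\<^sup>2)"
    proof (rule AE_I2)
      fix \<omega>
      have "0 \<le> (\<bar>g (e k \<omega>)\<bar> - 1/2)\<^sup>2" by simp
      then have "\<bar>g (e k \<omega>)\<bar> \<le> 1 + (g (e k \<omega>))\<^sup>2"
        by (simp add: power2_eq_square algebra_simps)
      then show "norm (g (e k \<omega>)) \<le> norm (1 + (g (e k \<omega>))\<^sup>2)" by simp
    qed
  qed measurable
  have "integrable M (\<lambda>\<omega>. (S n \<omega>)\<^sup>2) \<and>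
    expectation (\<lambda>\<omega>. (S n \<omega>)\<^sup>2) = v * (\<Sum>k<n. expectation (\<lambda>\<omega>. (w k \<omega>)\<^sup>2))"
  proof (induction n)
    case 0 show ?case by (simp add: S_def)
  next
    case (Suc n)
    have prod: "integrable M (\<lambda>\<omega>. S n \<omega> * w n \<omega>)"
    proof (rule Bochner_Integration.integrable_bound)
      show "integrable M (\<lambda>\<omega>. (S n \<omega>)\<^sup>2 + (w n \<omega>)\<^sup>2)" using Suc w2 by simp
      show "AE \<omega> in M. norm (S n \<omega> * w n \<omega>) \<le> norm ((S n \<omega>)\<^sup>2 + (w n \<omega>)\<^sup>2)"
      proof (rule AE_I2)
        fix \<omega>
        have "0 \<le> (\<bar>S n \<omega>\<bar> - \<bar>w n \<omega>\<bar>)\<^sup>2" "0 \<le> \<bar>S n \<omega>\<bar> * \<bar>w n \<omega>\<bar>" by simp_all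
        then have "\<bar>S n \<omega>\<bar> * \<bar>w n \<omega>\<bar> \<le> (S n \<omega>)\<^sup>2 + (w n \<omega>)\<^sup>2"
          unfolding power2_diff power2_abs by linarith
        then show "norm (S n \<omega> * w n \<omega>) \<le> norm ((S n \<omega>)\<^sup>2 + (w n \<omega>)\<^sup>2)"
          by (simp add: abs_mult)
      qed
    qed measurable
    have ind1: "indep_var borel (\<lambda>\<omega>. S n \<omega> * w n \<omega>) borel (\<lambda>\<omega>. g (e n \<omega>))"
    proof -
      have "(\<lambda>\<omega>. S n \<omega> * w n \<omega>) \<in> borel_measurable (past n)" using Sp w by simp
      from indep_var_compose[OF indep_past[OF this] measurable_ident g]
      show ?thesis by (simp add: o_def id_def)
    qed
    have ind2: "indep_var borel (\<lambda>\<omega>. (w n \<omega>)\<^sup>2) borel (\<lambda>\<omega>. (g (e n \<omega>))\<^sup>2)"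
    proof -
      have "(\<lambda>\<omega>. (w n \<omega>)\<^sup>2) \<in> borel_measurable (past n)" using w by simp
      from indep_var_compose[OF indep_past[OF this] measurable_ident, of "\<lambda>x. (g x)\<^sup>2" borel]
      show ?thesis by (simp add: o_def id_def)
    qed
    \<comment> \<open>T is the cross term, U the new diagonal term in the expansion of the next
      square.\<close>
    define T where "T \<omega> = (S n \<omega> * w n \<omega>) * g (e n \<omega>)" for \<omega>
    define U where "U \<omega> = (w n \<omega>)\<^sup>2 * (g (e n \<omega>))\<^sup>2" for \<omega>
    have "integrable M T" "integrable M U"
      unfolding T_def U_def
      by (rule indep_var_integrable[OF ind1 prod gint] indep_var_integrable[OF ind2 w2 g2(1)])+
    moreover have "expectation T = 0" "expectation U = v * expectation (\<lambda>\<omega>. (w n \<omega>)\<^sup>2)"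
      using indep_var_lebesgue_integral[OF ind1 prod gint] indep_var_lebesgue_integral[OF ind2 w2 g2(1)]
      unfolding T_def U_def by (simp_all only: g1 g2(2) mult_zero_right mult.commute)
    moreover have "(\<lambda>\<omega>. (S (Suc n) \<omega>)\<^sup>2) = (\<lambda>\<omega>. (S n \<omega>)\<^sup>2 + 2 * T \<omega> + U \<omega>)"
      by (simp add: fun_eq_iff S_def T_def U_def power2_sum power_mult_distrib)
    ultimately show ?case
      using Suc by (simp add: algebra_simps)
  qed
  then show "integrable M (\<lambda>\<omega>. (\<Sum>k<n. w k \<omega> * g (e k \<omega>))\<^sup>2)"
    and "expectation (\<lambda>\<omega>. (\<Sum>k<n. w k \<omega> * g (e k \<omega>))\<^sup>2) = v * (\<Sum>k<n. expectation (\<lambda>\<omega>. (w k \<omega>)\<^sup>2))"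
    unfolding S_def by auto
qed

lemma noise_moments:
  shows "integrable M (\<lambda>\<omega>. (e k \<omega>)^j)"
    and "expectation (e k) = 0" "expectation (\<lambda>\<omega>. (e k \<omega>)\<^sup>2) = \<sigma>\<^sup>2"
    and "expectation (\<lambda>\<omega>. ((e k \<omega>)\<^sup>2 - \<sigma>\<^sup>2)\<^sup>2) = 2 * \<sigma>^4"
proof -
  have int: "integrable M (\<lambda>\<omega>. (e k \<omega>)^j)" for j
    using distributed_integrable[OF noise_dist[of k], of "\<lambda>v. v^j"] 
      integrable_normal_moment[OF sigma_pos, of 0 j] by simp
  have ex: "expectation (\<lambda>\<omega>. (e k \<omega>)^j) = (\<integral>v. normal_density 0 \<sigma> v * v^j \<partial>lborel)" for j
    using distributed_integral[OF noise_dist[of k], of "\<lambda>v. v^j"] by simp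
  show "integrable M (\<lambda>\<omega>. (e k \<omega>)^j)" by (rule int)
  show "expectation (e k) = 0"
    using ex[of 1] integral_normal_moment_odd[OF sigma_pos, of 0 0] by simp
  show e2: "expectation (\<lambda>\<omega>. (e k \<omega>)\<^sup>2) = \<sigma>\<^sup>2"
    using ex[of 2] integral_normal_moment_even[OF sigma_pos, of 0 1] by (simp add: fact_numeral)
  have e4: "expectation (\<lambda>\<omega>. (e k \<omega>)^4) = 3 * \<sigma>^4"
    using ex[of 4] integral_normal_moment_even[OF sigma_pos, of 0 2]
    by (simp add: fact_numeral field_simps)
  have "((e k \<omega>)\<^sup>2 - \<sigma>\<^sup>2)\<^sup>2 = (e k \<omega>)^4 - 2 * \<sigma>\<^sup>2 * (e k \<omega>)\<^sup>2 + \<sigma>^4" for \<omega>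
    by (simp add: power2_eq_square power4_eq_xxxx algebra_simps)
  then show "expectation (\<lambda>\<omega>. ((e k \<omega>)\<^sup>2 - \<sigma>\<^sup>2)\<^sup>2) = 2 * \<sigma>^4"
    using int[of 2] int[of 4] e2 e4 prob_space by (simp add: power2_eq_square power4_eq_xxxx)
qed

end

section \<open>Linear recursions with roots in the unit disc\<close>

text \<open>The polynomial p evaluated at the forward shift operator and applied to the sequence u.
  Factoring the characteristic polynomial thereby becomes composing first-order recursions.\<close>

definition shift_action :: "complex poly \<Rightarrow> (nat \<Rightarrow> complex) \<Rightarrow> nat \<Rightarrow> complex" where
  "shift_action p u n = (\<Sum>i\<le>degree p. coeff p i * u (n + i))"

lemma shift_action_eq:
  assumes "degree p \<le> d"
  shows "shift_action p u n = (\<Sum>i\<le>d. coeff p i * u (n + i))"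
  unfolding shift_action_def using assms
  by (intro sum.mono_neutral_left) (auto simp: coeff_eq_0)

lemma shift_action_0 [simp]: "shift_action 0 u n = 0"
  by (simp add: shift_action_def)

lemma shift_action_add: "shift_action (p + q) u n = shift_action p u n + shift_action q u n"
proof -
  define d where "d = max (degree p) (degree q)"
  have "degree (p + q) \<le> d" "degree p \<le> d" "degree q \<le> d"
    by (auto simp: d_def degree_add_le)
  then show ?thesis
    by (simp add: shift_action_eq sum.distrib distrib_right)
qed

lemma shift_action_sum: "shift_action (\<Sum>x\<in>A. f x) u n = (\<Sum>x\<in>A. shift_action (f x) u n)"
  by (induction A rule: infinite_finite_induct) (auto simp: shift_action_add)

lemma shift_action_smult: "shift_action (Polynomial.smult a p) u n = a * shift_action p u n"
  by (simp add: shift_action_eq[OF degree_smult_le] shift_action_def sum_distrib_left mult.assoc)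

lemma shift_action_monom: "shift_action (Polynomial.monom a k) u n = a * u (n + k)"
  by (simp add: shift_action_eq[OF degree_monom_le] if_distrib[of "\<lambda>x. x * _"] cong: if_cong)

lemma shift_action_pCons_0: "shift_action (pCons 0 q) u n = shift_action q (\<lambda>k. u (Suc k)) n"
proof -
  have "shift_action (pCons 0 q) u n = (\<Sum>i\<le>Suc (degree q). coeff (pCons 0 q) i * u (n + i))"
    by (rule shift_action_eq) (rule degree_pCons_le)
  also have "\<dots> = (\<Sum>i\<le>degree q. coeff q i * u (Suc (n + i)))"
    by (subst sum.atMost_Suc_shift) simp
  finally show ?thesis by (simp add: shift_action_def)
qed

lemma shift_action_diff_seq:
  "shift_action q (\<lambda>k. f k - r * g k) n = shift_action q f n - r * shift_action q g n"
  by (simp add: shift_action_def sum_subtractf sum_distrib_left algebra_simps)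

lemma shift_action_linear_factor:
  "shift_action ([:- r, 1:] * q) u n = shift_action q (\<lambda>k. u (Suc k) - r * u k) n"
proof -
  have "[:- r, 1:] * q = Polynomial.smult (- r) q + pCons 0 q" by simp
  then show ?thesis
    by (simp only: shift_action_add shift_action_smult shift_action_pCons_0 shift_action_diff_seq)
       simp
qed

text \<open>A repeated root would produce polynomial factors in a sharp estimate; enlarging the rate
  at each root avoids them.\<close>

lemma first_order_decay:
  fixes u :: "nat \<Rightarrow> complex"
  assumes r: "cmod r < 1" and \<rho>: "0 < \<rho>" "\<rho> < 1"
    and bd: "\<And>n. cmod (u (Suc n) - r * u n) \<le> C * \<rho> ^ n"
  shows "\<exists>C' \<rho>'. 0 < \<rho>' \<and> \<rho>' < 1 \<and> (\<forall>n. cmod (u n) \<le> C' * \<rho>' ^ n)"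
proof -
  \<comment> \<open>A rate strictly between both old rates and 1, so that \<open>s - cmod r\<close>
    is positive; D is then chosen such that \<open>D * s^n\<close> dominates the recursion.\<close>
  define s where "s = (max (cmod r) \<rho> + 1) / 2"
  have s: "cmod r < s" "\<rho> < s" "s < 1" "0 < s"
    using r \<rho> by (auto simp: s_def)
  define D where "D = max (cmod (u 0)) (C / (s - cmod r))"
  have C0: "0 \<le> C" using order_trans[OF norm_ge_zero bd[of 0]] by simp
  have D: "cmod (u 0) \<le> D" "C \<le> D * (s - cmod r)"
    using s by (auto simp: D_def field_simps max_def split: if_splits)
  have "cmod (u n) \<le> D * s ^ n" for n
  proof (induction n)
    case 0 show ?case using D by simp
  next
    case (Suc n)
    have "cmod (u (Suc n)) \<le> cmod (u (Suc n) - r * u n) + cmod (r * u n)"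
      by (metis diff_add_cancel norm_triangle_ineq)
    also have "\<dots> \<le> C * s ^ n + cmod r * (D * s ^ n)"
    proof (rule add_mono)
      have "C * \<rho> ^ n \<le> C * s ^ n"
        using C0 s \<rho> by (intro mult_left_mono power_mono) auto
      with bd[of n] show "cmod (u (Suc n) - r * u n) \<le> C * s ^ n" by linarith
      show "cmod (r * u n) \<le> cmod r * (D * s ^ n)"
        unfolding norm_mult using Suc by (rule mult_left_mono) simp
    qed
    also have "\<dots> \<le> D * (s - cmod r) * s ^ n + cmod r * (D * s ^ n)"
      using D(2) s by (intro add_right_mono mult_right_mono) auto
    also have "\<dots> = D * s ^ Suc n" by (simp add: algebra_simps)
    finally show ?case .
  qed
  with s show ?thesis by blast
qed

text \<open>Induction on the degree: one root r is split off, the cofactor q controls the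
  first-order difference \<open>u (Suc n) - r * u n\<close> by the induction hypothesis, and u
  itself is recovered from that difference.\<close>

lemma recurrence_decay:
  assumes "p \<noteq> 0" and "\<And>z. poly p z = 0 \<Longrightarrow> cmod z < 1" and "0 < \<rho>" "\<rho> < 1"
    and "\<And>n. cmod (shift_action p u n) \<le> C * \<rho> ^ n"
  shows "\<exists>C' \<rho>'. 0 < \<rho>' \<and> \<rho>' < 1 \<and> (\<forall>n. cmod (u n) \<le> C' * \<rho>' ^ n)"
  using assms
proof (induction "degree p" arbitrary: p u C \<rho>)
  case 0
  then obtain a where p: "p = [:a:]" by (metis degree_eq_zeroE)
  with 0 have a: "a \<noteq> 0" by simp
  have "cmod (u n) \<le> C / cmod a * \<rho> ^ n" for n
    using "0.prems"(5)[of n] a by (simp add: p shift_action_def norm_mult field_simps)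
  with 0 show ?case by blast
next
  case (Suc d)
  have "\<not> constant (poly p)"
    using Suc.hyps(2) by (simp add: constant_degree)
  then obtain r where r: "poly p r = 0"
    using fundamental_theorem_of_algebra by blast
  then obtain q where p: "p = [:- r, 1:] * q"
    by (auto simp: poly_eq_0_iff_dvd dvd_def)
  with Suc.prems(1) have q: "q \<noteq> 0" by auto
  have "degree p = Suc (degree q)"
    unfolding p using q by (subst degree_mult_eq) auto
  then have d: "d = degree q" using Suc.hyps(2) by simp
  have "cmod z < 1" if "poly q z = 0" for z
    using Suc.prems(2)[of z] that by (simp add: p)
  moreover have "cmod (shift_action q (\<lambda>k. u (Suc k) - r * u k) n) \<le> C * \<rho> ^ n" for n
    using Suc.prems(5)[of n] by (simp only: p shift_action_linear_factor)
  ultimately obtain C' \<rho>' where C': "0 < \<rho>'" "\<rho>' < 1"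
      "\<And>n. cmod (u (Suc n) - r * u n) \<le> C' * \<rho>' ^ n"
    using Suc.hyps(1)[OF d q _ Suc.prems(3,4), of "\<lambda>k. u (Suc k) - r * u k" C] by blast
  show ?case
    by (rule first_order_decay[OF Suc.prems(2)[OF r] C'])
qed

lemma ar_homogeneous_decay:
  fixes \<psi> :: "nat \<Rightarrow> real" and h :: "int \<Rightarrow> real"
  assumes roots: "\<And>z::complex. z ^ p + (\<Sum>l=1..p. of_real (\<psi> l) * z ^ (p - l)) = 0 \<Longrightarrow> cmod z < 1"
    and h: "\<And>n::nat. h (int n) + (\<Sum>l=1..p. \<psi> l * h (int n - int l)) = 0"
  shows "\<exists>C \<rho>. 0 < \<rho> \<and> \<rho> < 1 \<and> (\<forall>n::nat. \<bar>h (int n)\<bar> \<le> C * \<rho> ^ n)"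
proof -
  define P :: "complex poly" where
    "P = Polynomial.monom 1 p + (\<Sum>l=1..p. Polynomial.monom (of_real (\<psi> l)) (p - l))"
  \<comment> \<open>Shifted by p so that the p initial values of h at negative times become the
    start of the sequence, and the recursion at time n reads \<open>u n\<close> up to
    \<open>u (n + p)\<close>.\<close>
  define u :: "nat \<Rightarrow> complex" where "u k = of_real (h (int k - int p))" for k
  have "(\<Sum>l=1..p. coeff (Polynomial.monom (complex_of_real (\<psi> l)) (p - l)) p) = 0"
    by (intro sum.neutral) auto
  then have "coeff P p = 1" by (simp add: P_def coeff_sum)
  then have P0: "P \<noteq> 0" by auto
  have rootsP: "cmod z < 1" if "poly P z = 0" for z
    using that roots[of z] by (simp add: P_def poly_sum poly_monom)
  have "shift_action P u n = 0" for n
  proof -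
    have "shift_action P u n = of_real (h (int n)) + (\<Sum>l=1..p. of_real (\<psi> l) * u (n + (p - l)))"
      by (simp add: P_def shift_action_add shift_action_sum shift_action_monom u_def)
    also have "(\<Sum>l=1..p. of_real (\<psi> l) * u (n + (p - l))) = (\<Sum>l=1..p. of_real (\<psi> l * h (int n - int l)))"
      by (intro sum.cong) (auto simp: u_def of_nat_diff algebra_simps)
    also have "of_real (h (int n)) + \<dots> = complex_of_real (h (int n) + (\<Sum>l=1..p. \<psi> l * h (int n - int l)))"
      by simp
    finally show ?thesis by (simp only: h of_real_0)
  qed
  then obtain C \<rho> where C: "0 < \<rho>" "\<rho> < 1" "\<And>n. cmod (u n) \<le> C * \<rho> ^ n"
    using recurrence_decay[OF P0 rootsP, of "1/2" u 0] by auto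
  have "\<bar>h (int n)\<bar> \<le> (C * \<rho> ^ p) * \<rho> ^ n" for n
    using C(3)[of "n + p"] by (simp add: u_def power_add mult_ac)
  with C show ?thesis by blast
qed

section \<open>Causal filters and the impulse response of the autoregression\<close>

definition causal_filter :: "(nat \<Rightarrow> real) \<Rightarrow> (nat \<Rightarrow> real) \<Rightarrow> int \<Rightarrow> real" where
  "causal_filter c e k = (if k < 0 then 0 else \<Sum>j\<le>nat k. c j * e (nat k - j))"

text \<open>Coefficients of the reciprocal of \<open>1 + \<psi> 1 X + ... + \<psi> p X^p\<close> as
  a formal power series, so that the recursion is solved algebraically, before any question of
  convergence.\<close>

definition impulse_response :: "(nat \<Rightarrow> real) \<Rightarrow> nat \<Rightarrow> nat \<Rightarrow> real" where
  "impulse_response \<psi> p =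
     fps_nth (inverse (Abs_fps (\<lambda>l. if l = 0 then 1 else if l \<le> p then \<psi> l else 0)))"

text \<open>The filter started at rest is a product of formal power series. The Cauchy product runs
  over all lags up to n, the recursion over lags up to p; the ranges agree because z vanishes at
  negative times and the coefficients vanish beyond p.\<close>

lemma impulse_response_solves:
  fixes \<psi> e :: "nat \<Rightarrow> real" and p :: nat
  defines "z \<equiv> causal_filter (impulse_response \<psi> p) e"
  shows "z (int n) + (\<Sum>l=1..p. \<psi> l * z (int n - int l)) = e n"
proof -
  define a where "a l = (if l = 0 then 1 else if l \<le> p then \<psi> l else 0)" for l
  define Z where "Z = inverse (Abs_fps a) * Abs_fps e"
  have zZ: "z k = (if k < 0 then 0 else fps_nth Z (nat k))" for k
    by (auto simp: z_def causal_filter_def Z_def impulse_response_def fps_mult_nth a_def[abs_def]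
        atLeast0AtMost)
  have "Abs_fps a * inverse (Abs_fps a) = 1"
    by (rule inverse_mult_eq_1') (simp add: a_def)
  then have "Abs_fps a * Z = Abs_fps e"
    by (simp add: Z_def flip: mult.assoc)
  then have "e n = fps_nth (Abs_fps a * Z) n" by simp
  also have "\<dots> = (\<Sum>l=0..n. a l * fps_nth Z (n - l))"
    by (simp add: fps_mult_nth)
  also have "\<dots> = (\<Sum>l=0..n. a l * z (int n - int l))"
    by (intro sum.cong) (auto simp: zZ nat_diff_distrib')
  also have "\<dots> = (\<Sum>l=0..n + p. a l * z (int n - int l))"
    by (intro sum.mono_neutral_left) (auto simp: zZ)
  also have "\<dots> = (\<Sum>l=0..p. a l * z (int n - int l))"
    by (intro sum.mono_neutral_right) (auto simp: a_def)
  also have "\<dots> = z (int n) + (\<Sum>l=1..p. a l * z (int n - int l))"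
    by (simp add: sum.atLeast_Suc_atMost a_def)
  also have "(\<Sum>l=1..p. a l * z (int n - int l)) = (\<Sum>l=1..p. \<psi> l * z (int n - int l))"
    by (intro sum.cong) (auto simp: a_def)
  finally show ?thesis by simp
qed

lemma impulse_response_summable:
  assumes roots: "\<And>z::complex. z ^ p + (\<Sum>l=1..p. of_real (\<psi> l) * z ^ (p - l)) = 0 \<Longrightarrow> cmod z < 1"
  shows "summable (\<lambda>j. \<bar>impulse_response \<psi> p j\<bar>)"
proof -
  define c where "c = impulse_response \<psi> p"
  define z where "z = causal_filter c (\<lambda>k. if k = 0 then 1 else 0)"
  have zc: "z (int n) = c n" for n
  proof -
    have "z (int n) = (\<Sum>j\<le>n. c j * (if n - j = 0 then 1 else 0))"
      by (simp add: z_def causal_filter_def)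
    also have "\<dots> = (\<Sum>j\<le>n. if j = n then c j else 0)"
      by (intro sum.cong) auto
    finally show ?thesis by simp
  qed
  \<comment> \<open>From time 1 on the unit impulse at time 0 has passed, so the shifted response
    obeys the homogeneous recursion and decays geometrically.\<close>
  define h where "h k = z (k + 1)" for k
  have "h (int n) + (\<Sum>l=1..p. \<psi> l * h (int n - int l)) = 0" for n
    using impulse_response_solves[of \<psi> p "\<lambda>k. if k = 0 then 1 else 0" "Suc n"]
    by (simp add: h_def z_def c_def algebra_simps)
  from ar_homogeneous_decay[OF roots this]
  obtain C \<rho> where C: "0 < \<rho>" "\<rho> < 1" "\<And>n::nat. \<bar>h (int n)\<bar> \<le> C * \<rho> ^ n" by auto
  have hc: "h (int n) = c (Suc n)" for n
    using zc[of "Suc n"] by (simp add: h_def add.commute)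
  have "summable (\<lambda>n. \<bar>c (Suc n)\<bar>)"
  proof (rule summable_comparison_test')
    show "summable (\<lambda>n. C * \<rho> ^ n)"
      using C by (intro summable_mult summable_geometric) auto
    show "norm \<bar>c (Suc n)\<bar> \<le> C * \<rho> ^ n" for n
      using C(3)[of n] by (simp add: hc)
  qed
  then show ?thesis
    unfolding c_def using summable_Suc_iff[of "\<lambda>n. \<bar>impulse_response \<psi> p n\<bar>"] by simp
qed

section \<open>Energy bounds for filters with absolutely summable coefficients\<close>

lemma weighted_Cauchy_Schwarz:
  fixes c x :: "'b \<Rightarrow> real"
  shows "(\<Sum>i\<in>I. c i * x i)\<^sup>2 \<le> (\<Sum>i\<in>I. \<bar>c i\<bar>) * (\<Sum>i\<in>I. \<bar>c i\<bar> * (x i)\<^sup>2)"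
proof -
  have "(\<Sum>i\<in>I. c i * x i) = (\<Sum>i\<in>I. sqrt \<bar>c i\<bar> * (sgn (c i) * sqrt \<bar>c i\<bar> * x i))"
    by (intro sum.cong) (auto simp: sgn_if algebra_simps)
  also have "\<dots>\<^sup>2 \<le> (\<Sum>i\<in>I. (sqrt \<bar>c i\<bar>)\<^sup>2) * (\<Sum>i\<in>I. (sgn (c i) * sqrt \<bar>c i\<bar> * x i)\<^sup>2)"
    by (rule Cauchy_Schwarz_ineq_sum)
  also have "\<dots> = (\<Sum>i\<in>I. \<bar>c i\<bar>) * (\<Sum>i\<in>I. \<bar>c i\<bar> * (x i)\<^sup>2)"
    by (intro arg_cong2[of _ _ _ _ "(*)"] sum.cong) (auto simp: power_mult_distrib sgn_if)
  finally show ?thesis .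
qed

lemma causal_filter_square_le:
  assumes "summable (\<lambda>j. \<bar>c j\<bar>)"
  shows "(causal_filter c e (int k))\<^sup>2 \<le> (\<Sum>j. \<bar>c j\<bar>) * (\<Sum>i\<le>k. \<bar>c (k - i)\<bar> * (e i)\<^sup>2)"
proof -
  have "causal_filter c e (int k) = (\<Sum>i\<le>k. c (k - i) * e i)"
    unfolding causal_filter_def by simp (rule sum.reindex_bij_witness[of _ "\<lambda>i. k - i" "\<lambda>i. k - i"], auto)
  then have "(causal_filter c e (int k))\<^sup>2 \<le> (\<Sum>i\<le>k. \<bar>c (k - i)\<bar>) * (\<Sum>i\<le>k. \<bar>c (k - i)\<bar> * (e i)\<^sup>2)"
    using weighted_Cauchy_Schwarz[of "\<lambda>i. c (k - i)" e "{..k}"] by simp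
  also have "(\<Sum>i\<le>k. \<bar>c (k - i)\<bar>) = (\<Sum>j\<le>k. \<bar>c j\<bar>)"
    by (rule sum.reindex_bij_witness[of _ "\<lambda>i. k - i" "\<lambda>i. k - i"]) auto
  also have "\<dots> * (\<Sum>i\<le>k. \<bar>c (k - i)\<bar> * (e i)\<^sup>2) \<le> (\<Sum>j. \<bar>c j\<bar>) * (\<Sum>i\<le>k. \<bar>c (k - i)\<bar> * (e i)\<^sup>2)"
    using assms by (intro mult_right_mono sum_le_suminf sum_nonneg) auto
  finally show ?thesis .
qed

text \<open>Young's inequality for the convolution of an absolutely summable with a square summable
  sequence, cut off at n: one factor comes from weighted Cauchy-Schwarz, the other from
  interchanging the sums, where each \<open>(e i)^2\<close> collects weight at most the sum of the
  \<open>\<bar>c j\<bar>\<close>.\<close>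

lemma causal_filter_energy_le:
  assumes c: "summable (\<lambda>j. \<bar>c j\<bar>)"
  shows "(\<Sum>k<n. (causal_filter c e (int k))\<^sup>2) \<le> (\<Sum>j. \<bar>c j\<bar>)\<^sup>2 * (\<Sum>k<n. (e k)\<^sup>2)"
proof -
  let ?A = "\<Sum>j. \<bar>c j\<bar>"
  have A0: "0 \<le> ?A" by (rule suminf_nonneg[OF c]) simp
  have "(\<Sum>k<n. (causal_filter c e (int k))\<^sup>2) \<le> (\<Sum>k<n. ?A * (\<Sum>i\<le>k. \<bar>c (k - i)\<bar> * (e i)\<^sup>2))"
    by (intro sum_mono causal_filter_square_le c)
  also have "\<dots> = ?A * (\<Sum>k<n. \<Sum>i\<le>k. \<bar>c (k - i)\<bar> * (e i)\<^sup>2)"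
    by (simp add: sum_distrib_left)
  also have "(\<Sum>k<n. \<Sum>i\<le>k. \<bar>c (k - i)\<bar> * (e i)\<^sup>2) = (\<Sum>i<n. \<Sum>k\<in>{i..<n}. \<bar>c (k - i)\<bar> * (e i)\<^sup>2)"
    by (simp add: sum.Sigma, rule sum.reindex_bij_witness[of _ "\<lambda>(i, k). (k, i)" "\<lambda>(k, i). (i, k)"]) auto
  also have "\<dots> \<le> (\<Sum>i<n. ?A * (e i)\<^sup>2)"
  proof (rule sum_mono)
    fix i
    have "(\<Sum>k\<in>{i..<n}. \<bar>c (k - i)\<bar> * (e i)\<^sup>2) = (\<Sum>j<n - i. \<bar>c j\<bar>) * (e i)\<^sup>2"
      unfolding sum_distrib_right
      by (rule sum.reindex_bij_witness[of _ "\<lambda>j. j + i" "\<lambda>k. k - i"]) auto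
    also have "\<dots> \<le> ?A * (e i)\<^sup>2"
      using c by (intro mult_right_mono sum_le_suminf) auto
    finally show "(\<Sum>k\<in>{i..<n}. \<bar>c (k - i)\<bar> * (e i)\<^sup>2) \<le> ?A * (e i)\<^sup>2" .
  qed
  also have "?A * \<dots> = ?A\<^sup>2 * (\<Sum>k<n. (e k)\<^sup>2)"
    by (simp add: sum_distrib_left power2_eq_square mult.assoc)
  finally show ?thesis using A0 by (simp add: mult_left_mono)
qed

section \<open>Least squares along a sample path\<close>

definition resid_energy :: "(int \<Rightarrow> real) \<Rightarrow> nat \<Rightarrow> nat \<Rightarrow> nat \<Rightarrow> (nat \<Rightarrow> real) \<Rightarrow> real" where
  "resid_energy y m N L \<phi> = (\<Sum>n=m+1..m+N. (y (int n) + (\<Sum>l=1..L. \<phi> l * y (int n - int l)))\<^sup>2)"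

definition comb_energy :: "(int \<Rightarrow> real) \<Rightarrow> nat \<Rightarrow> nat \<Rightarrow> nat \<Rightarrow> (nat \<Rightarrow> real) \<Rightarrow> real" where
  "comb_energy y m N L v = (\<Sum>n=m+1..m+N. (\<Sum>l=1..L. v l * y (int n - int l))\<^sup>2)"

lemma e_hat_eq: "e_hat y m N L = resid_energy y m N L (psi_hat y m N L) / real N"
  by (simp add: e_hat_def resid_energy_def)

lemma sum_nth_lag: "(\<Sum>i<L. f (Suc i)) = (\<Sum>l=1..L. f l)"
  by (rule sum.reindex_bij_witness[of _ "\<lambda>l. l - 1" Suc]) auto

lemma mult_gamma_hat:
  "0 < N \<Longrightarrow> real N * gamma_hat y m N i j = (\<Sum>n=m+1..m+N. y (int n - int i) * y (int n - int j))"
  by (simp add: gamma_hat_def)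

lemma comb_energy_eq_quadratic_form:
  "comb_energy y m N L v = real N * (\<Sum>i=1..L. \<Sum>j=1..L. v i * v j * gamma_hat y m N i j)"
proof (cases "N = 0")
  case False
  have "comb_energy y m N L v = (\<Sum>n=m+1..m+N. \<Sum>i=1..L. \<Sum>j=1..L.
      v i * v j * (y (int n - int i) * y (int n - int j)))"
    unfolding comb_energy_def power2_eq_square sum_product by (simp add: mult_ac)
  also have "\<dots> = (\<Sum>i=1..L. \<Sum>j=1..L. \<Sum>n=m+1..m+N. v i * v j * (y (int n - int i) * y (int n - int j)))"
    by (subst sum.swap, rule sum.cong[OF refl], rule sum.swap)
  also have "\<dots> = (\<Sum>i=1..L. \<Sum>j=1..L. v i * v j * (real N * gamma_hat y m N i j))"
    using False by (intro sum.cong refl) (simp add: mult_gamma_hat sum_distrib_left)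
  also have "\<dots> = real N * (\<Sum>i=1..L. \<Sum>j=1..L. v i * v j * gamma_hat y m N i j)"
    by (simp add: sum_distrib_left mult_ac)
  finally show ?thesis .
qed (simp add: comb_energy_def)

text \<open>Coercivity rules out the default case of the estimator: a null vector of the Gram matrix
  would have zero energy, so \<open>mat_inverse\<close> returns a genuine inverse and the filter
  solves the linear system.\<close>

lemma normal_equations:
  assumes N: "0 < N" and \<kappa>: "0 < \<kappa>"
    and pos: "\<And>v. comb_energy y m N L v \<ge> \<kappa> * (\<Sum>l=1..L. (v l)\<^sup>2)"
    and l: "l \<in> {1..L}"
  shows "(\<Sum>j=1..L. gamma_hat y m N l j * psi_hat y m N L j) = - gamma_hat y m N l 0"
proof -
  define G where "G = Gamma_mat_hat y m N L"
  have G: "G \<in> carrier_mat L L" by (simp add: G_def Gamma_mat_hat_def)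
  have Gv: "vec_index (G *\<^sub>v v) i = (\<Sum>j=1..L. gamma_hat y m N (Suc i) j * vec_index v (j - 1))"
    if "v \<in> carrier_vec L" "i < L" for v i
  proof -
    have "vec_index (G *\<^sub>v v) i = (\<Sum>j<L. gamma_hat y m N (Suc i) (Suc j) * vec_index v j)"
      using that by (simp add: G_def Gamma_mat_hat_def scalar_prod_def lessThan_atLeast0)
    also have "\<dots> = (\<Sum>j=1..L. gamma_hat y m N (Suc i) j * vec_index v (j - 1))"
      using sum_nth_lag[of "\<lambda>j. gamma_hat y m N (Suc i) j * vec_index v (j - 1)" L] by simp
    finally show ?thesis .
  qed
  have "det G \<noteq> 0"
  proof
    assume "det G = 0"
    then obtain v where v: "v \<in> carrier_vec L" "v \<noteq> 0\<^sub>v L" "G *\<^sub>v v = 0\<^sub>v L"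
      unfolding det_0_iff_vec_prod_zero_field[OF G] by blast
    define w where "w l = vec_index v (l - 1)" for l
    have "(\<Sum>i=1..L. w i * (\<Sum>j=1..L. gamma_hat y m N i j * w j)) = 0"
    proof (intro sum.neutral ballI)
      fix i assume i: "i \<in> {1..L}"
      then have "(\<Sum>j=1..L. gamma_hat y m N i j * w j) = vec_index (G *\<^sub>v v) (i - 1)"
        using Gv[OF v(1), of "i - 1"] by (auto simp: w_def)
      also have "\<dots> = 0"
      proof -
        have "i - 1 < L" using i by auto
        then show ?thesis unfolding v(3) by (rule index_zero_vec(1))
      qed
      finally show "w i * (\<Sum>j=1..L. gamma_hat y m N i j * w j) = 0" by simp
    qed
    then have "comb_energy y m N L w = 0"
      unfolding comb_energy_eq_quadratic_form by (simp add: sum_distrib_left mult_ac)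
    with pos[of w] have "\<kappa> * (\<Sum>l=1..L. (w l)\<^sup>2) \<le> 0" by simp
    with \<kappa> have "(\<Sum>l=1..L. (w l)\<^sup>2) \<le> 0" by (simp add: mult_le_0_iff)
    then have "(\<Sum>l=1..L. (w l)\<^sup>2) = 0" by (meson order_antisym sum_nonneg zero_le_power2)
    then have w0: "w l = 0" if "l \<in> {1..L}" for l
      using that by (subst (asm) sum_nonneg_eq_0_iff) auto
    have "v = 0\<^sub>v L"
    proof (rule eq_vecI)
      fix i assume "i < dim_vec (0\<^sub>v L :: real Matrix.vec)"
      then show "vec_index v i = vec_index (0\<^sub>v L) i" using w0[of "Suc i"] by (simp add: w_def)
    qed (use v in auto)
    with v show False by simp
  qed
  then have "G \<in> Units (ring_mat TYPE(real) L ())"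
    by (rule det_non_zero_imp_unit[OF G])
  with mat_inverse(1)[OF G, of "()"] obtain B where B: "mat_inverse G = Some B" by fastforce
  from mat_inverse(2)[OF G this] have GB: "G * B = 1\<^sub>m L" "B \<in> carrier_mat L L" by auto
  define g where "g = gamma_vec_hat y m N L"
  have g: "g \<in> carrier_vec L" by (simp add: g_def gamma_vec_hat_def)
  have f: "filter_hat y m N L = - (B *\<^sub>v g)"
    by (simp add: filter_hat_def G_def[symmetric] B g_def)
  have fc: "filter_hat y m N L \<in> carrier_vec L" using GB g by (simp add: f)
  have "G *\<^sub>v filter_hat y m N L = - (G *\<^sub>v (B *\<^sub>v g))"
    unfolding f using G GB g by (intro eq_vecI) auto
  also have "G *\<^sub>v (B *\<^sub>v g) = g"
    using assoc_mult_mat_vec[OF G GB(2) g] GB(1) g by simp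
  finally have "vec_index (G *\<^sub>v filter_hat y m N L) (l - 1) = vec_index (- g) (l - 1)" by simp
  also have "\<dots> = - gamma_hat y m N l 0"
    using l by (auto simp: g_def gamma_vec_hat_def)
  finally show ?thesis
    using Gv[OF fc, of "l - 1"] l by (auto simp: psi_hat_def)
qed

text \<open>An exact expansion, used at two base points: at the fitted filter the linear term
  vanishes, at the true coefficients it is the score.\<close>

lemma resid_energy_add:
  "resid_energy y m N L (\<lambda>l. \<phi> l + d l) = resid_energy y m N L \<phi>
     + 2 * (\<Sum>l=1..L. d l * (\<Sum>n=m+1..m+N. (y (int n) + (\<Sum>j=1..L. \<phi> j * y (int n - int j))) * y (int n - int l)))
     + comb_energy y m N L d"
proof -
  define r where "r n = y (int n) + (\<Sum>j=1..L. \<phi> j * y (int n - int j))" for n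
  define W where "W n = (\<Sum>l=1..L. d l * y (int n - int l))" for n
  have "resid_energy y m N L (\<lambda>l. \<phi> l + d l) = (\<Sum>n=m+1..m+N. (r n + W n)\<^sup>2)"
    by (simp add: resid_energy_def r_def W_def distrib_right sum.distrib add.assoc)
  also have "\<dots> = (\<Sum>n=m+1..m+N. (r n)\<^sup>2) + 2 * (\<Sum>n=m+1..m+N. r n * W n) + (\<Sum>n=m+1..m+N. (W n)\<^sup>2)"
    by (simp add: power2_sum sum.distrib sum_distrib_left mult_ac)
  also have "(\<Sum>n=m+1..m+N. r n * W n) = (\<Sum>l=1..L. d l * (\<Sum>n=m+1..m+N. r n * y (int n - int l)))"
    unfolding W_def sum_distrib_left by (subst sum.swap) (simp add: mult_ac)
  finally show ?thesis
    by (simp add: resid_energy_def comb_energy_def r_def W_def)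
qed

text \<open>By the normal equations the fitted residual is orthogonal to every lag, so any other
  filter adds the nonnegative energy of the difference.\<close>

lemma e_hat_le:
  assumes N: "0 < N" and \<kappa>: "0 < \<kappa>"
    and pos: "\<And>v. comb_energy y m N L v \<ge> \<kappa> * (\<Sum>l=1..L. (v l)\<^sup>2)"
  shows "e_hat y m N L \<le> resid_energy y m N L \<phi> / real N"
proof -
  define f where "f = psi_hat y m N L"
  define d where "d l = \<phi> l - f l" for l
  have "(\<Sum>n=m+1..m+N. (y (int n) + (\<Sum>j=1..L. f j * y (int n - int j))) * y (int n - int l)) = 0"
    if l: "l \<in> {1..L}" for l
  proof -
    have "(\<Sum>n=m+1..m+N. (y (int n) + (\<Sum>j=1..L. f j * y (int n - int j))) * y (int n - int l))
      = (\<Sum>n=m+1..m+N. y (int n - int l) * y (int n - int 0))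
        + (\<Sum>n=m+1..m+N. \<Sum>j=1..L. y (int n - int l) * y (int n - int j) * f j)"
      by (simp add: sum.distrib sum_distrib_left algebra_simps)
    also have "(\<Sum>n=m+1..m+N. \<Sum>j=1..L. y (int n - int l) * y (int n - int j) * f j)
      = (\<Sum>j=1..L. (\<Sum>n=m+1..m+N. y (int n - int l) * y (int n - int j)) * f j)"
      unfolding sum_distrib_right by (rule sum.swap)
    also have "\<dots> = real N * (\<Sum>j=1..L. gamma_hat y m N l j * f j)"
      unfolding sum_distrib_left
      by (intro sum.cong refl) (simp only: mult_gamma_hat[OF N, symmetric] mult.assoc)
    also have "\<dots> = - (real N * gamma_hat y m N l 0)"
      unfolding f_def using normal_equations[OF N \<kappa> pos l] by simp
    also have "real N * gamma_hat y m N l 0 = (\<Sum>n=m+1..m+N. y (int n - int l) * y (int n - int 0))"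
      using N by (rule mult_gamma_hat)
    finally show ?thesis by simp
  qed
  then have "resid_energy y m N L (\<lambda>l. f l + d l) = resid_energy y m N L f + comb_energy y m N L d"
    unfolding resid_energy_add by simp
  moreover have "0 \<le> comb_energy y m N L d"
    by (simp add: comb_energy_def sum_nonneg)
  ultimately have "resid_energy y m N L f \<le> resid_energy y m N L \<phi>"
    by (simp add: d_def)
  then show ?thesis
    using N by (simp add: e_hat_eq f_def divide_right_mono)
qed

lemma resid_energy_extend:
  assumes "L \<le> K"
  shows "resid_energy y m N L \<phi> = resid_energy y m N K (\<lambda>l. if l \<le> L then \<phi> l else 0)"
proof -
  have "(\<Sum>l=1..L. \<phi> l * y (int n - int l)) = (\<Sum>l=1..K. (if l \<le> L then \<phi> l else 0) * y (int n - int l))" for n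
    using assms by (intro sum.mono_neutral_cong_left) auto
  then show ?thesis by (simp add: resid_energy_def)
qed

text \<open>Half the gradient of the residual energy at the true coefficients.\<close>

definition score :: "(int \<Rightarrow> real) \<Rightarrow> (int \<Rightarrow> real) \<Rightarrow> nat \<Rightarrow> nat \<Rightarrow> nat \<Rightarrow> real" where
  "score y \<eta> m N l = (\<Sum>n=m+1..m+N. \<eta> (int n) * y (int n - int l))"

text \<open>Here t is the Euclidean distance of the two coefficient vectors padded with zeros to
  length K. Only t enters the bound, so overfitting can be treated by minimising over t, and
  underfitting by the lower bound on t that comes from the missing coefficient
  \<open>\<psi> p\<close>.\<close>

lemma resid_energy_lower:
  assumes \<eta>: "\<And>n. \<eta> n = y n + (\<Sum>l=1..p. \<psi> l * y (n - int l))"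
    and LK: "L \<le> K" "p \<le> K"
    and pos: "\<And>v. comb_energy y m N K v \<ge> \<kappa> * (\<Sum>l=1..K. (v l)\<^sup>2)"
  shows "\<exists>t\<ge>0. (L < p \<longrightarrow> \<bar>\<psi> p\<bar> \<le> t) \<and> resid_energy y m N L \<phi> \<ge> (\<Sum>n=m+1..m+N. (\<eta> (int n))\<^sup>2)
    - 2 * t * sqrt (\<Sum>l=1..K. (score y \<eta> m N l)\<^sup>2) + \<kappa> * t\<^sup>2"
proof -
  define a where "a l = (if l \<le> p then \<psi> l else 0)" for l
  define d where "d l = (if l \<le> L then \<phi> l else 0) - a l" for l
  define t where "t = sqrt (\<Sum>l=1..K. (d l)\<^sup>2)"
  have eta: "y (int n) + (\<Sum>l=1..K. a l * y (int n - int l)) = \<eta> (int n)" for n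
  proof -
    have "(\<Sum>l=1..p. \<psi> l * y (int n - int l)) = (\<Sum>l=1..K. a l * y (int n - int l))"
      using LK unfolding a_def by (intro sum.mono_neutral_cong_left) auto
    then show ?thesis by (simp add: \<eta>)
  qed
  have "resid_energy y m N L \<phi> = resid_energy y m N K (\<lambda>l. a l + d l)"
    unfolding resid_energy_extend[OF LK(1)] by (simp add: d_def)
  also have "\<dots> = (\<Sum>n=m+1..m+N. (\<eta> (int n))\<^sup>2) + 2 * (\<Sum>l=1..K. d l * score y \<eta> m N l) + comb_energy y m N K d"
    unfolding resid_energy_add unfolding resid_energy_def eta by (simp add: score_def)
  finally have R: "resid_energy y m N L \<phi> = \<dots>" .
  have "\<bar>\<Sum>l=1..K. d l * score y \<eta> m N l\<bar> \<le> t * sqrt (\<Sum>l=1..K. (score y \<eta> m N l)\<^sup>2)"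
  proof -
    have "\<bar>\<Sum>l=1..K. d l * score y \<eta> m N l\<bar> = sqrt ((\<Sum>l=1..K. d l * score y \<eta> m N l)\<^sup>2)" by simp
    also have "\<dots> \<le> sqrt ((\<Sum>l=1..K. (d l)\<^sup>2) * (\<Sum>l=1..K. (score y \<eta> m N l)\<^sup>2))"
      by (intro real_sqrt_le_mono Cauchy_Schwarz_ineq_sum)
    finally show ?thesis by (simp add: real_sqrt_mult t_def)
  qed
  moreover have "t\<^sup>2 = (\<Sum>l=1..K. (d l)\<^sup>2)" by (simp add: t_def sum_nonneg)
  moreover have "\<bar>\<psi> p\<bar> \<le> t" if "L < p"
  proof -
    have "(d p)\<^sup>2 \<le> (\<Sum>l=1..K. (d l)\<^sup>2)"
      using that LK by (intro member_le_sum) auto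
    moreover have "d p = - \<psi> p" using that by (simp add: d_def a_def)
    ultimately show ?thesis unfolding t_def by (intro real_le_rsqrt) auto
  qed
  moreover have "0 \<le> t" by (simp add: t_def sum_nonneg)
  ultimately show ?thesis
    using R pos[of d] by (intro exI[of _ t]) auto
qed

text \<open>
  The squared Frobenius distance of the Gram matrix of the lagged noise from its mean. The first \<open>p\<close>
  points of the window are left out: there the recursion reaches back behind the window.
\<close>

definition gram_defect :: "(int \<Rightarrow> real) \<Rightarrow> nat \<Rightarrow> nat \<Rightarrow> nat \<Rightarrow> nat \<Rightarrow> real \<Rightarrow> real" where
  "gram_defect \<eta> p m N L s = (\<Sum>i=1..L. \<Sum>j=1..L.
     ((\<Sum>n=m+1+p..m+N. \<eta> (int n - int i) * \<eta> (int n - int j) - (if i = j then s else 0)))\<^sup>2)"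

text \<open>The Gram matrix is \<open>(N - p) * s\<close> times the identity plus an error matrix,
  whose quadratic form is bounded by its Frobenius norm through Cauchy-Schwarz over pairs of
  indices.\<close>

lemma noise_comb_energy_lower:
  assumes "p \<le> N"
  shows "(\<Sum>n=m+1+p..m+N. (\<Sum>i=1..L. v i * \<eta> (int n - int i))\<^sup>2)
    \<ge> (real (N - p) * s - sqrt (gram_defect \<eta> p m N L s)) * (\<Sum>i=1..L. (v i)\<^sup>2)"
proof -
  define D where "D i j = (\<Sum>n=m+1+p..m+N. \<eta> (int n - int i) * \<eta> (int n - int j) - (if i = j then s else 0))" for i j
  let ?v2 = "\<Sum>i=1..L. (v i)\<^sup>2"
  have "(\<Sum>n=m+1+p..m+N. (\<Sum>i=1..L. v i * \<eta> (int n - int i))\<^sup>2)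
    = (\<Sum>n=m+1+p..m+N. \<Sum>i=1..L. \<Sum>j=1..L. v i * v j * (\<eta> (int n - int i) * \<eta> (int n - int j)))"
    unfolding power2_eq_square sum_product by (simp add: mult_ac)
  also have "\<dots> = (\<Sum>i=1..L. \<Sum>j=1..L. \<Sum>n=m+1+p..m+N. v i * v j * (\<eta> (int n - int i) * \<eta> (int n - int j)))"
    by (subst sum.swap, rule sum.cong[OF refl], rule sum.swap)
  also have "\<dots> = (\<Sum>i=1..L. \<Sum>j=1..L. v i * v j * D i j + (if j = i then real (N - p) * s * (v i)\<^sup>2 else 0))"
    using assms
    by (intro sum.cong refl) (auto simp: D_def sum_subtractf sum_distrib_left algebra_simps power2_eq_square)
  also have "\<dots> = (\<Sum>i=1..L. \<Sum>j=1..L. v i * v j * D i j) + real (N - p) * s * ?v2"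
    by (simp add: sum.distrib sum_distrib_left)
  finally have eq: "(\<Sum>n=m+1+p..m+N. (\<Sum>i=1..L. v i * \<eta> (int n - int i))\<^sup>2)
    = (\<Sum>i=1..L. \<Sum>j=1..L. v i * v j * D i j) + real (N - p) * s * ?v2" .
  have v4: "(\<Sum>x\<in>{1..L} \<times> {1..L}. (v (fst x) * v (snd x))\<^sup>2) = ?v2\<^sup>2"
    by (simp add: power2_eq_square sum_product sum.cartesian_product case_prod_beta mult_ac)
  have pairs: "(\<Sum>i=1..L. \<Sum>j=1..L. v i * v j * D i j) = (\<Sum>x\<in>{1..L} \<times> {1..L}. (v (fst x) * v (snd x)) * D (fst x) (snd x))"
    by (simp add: sum.cartesian_product case_prod_beta)
  have "(\<Sum>i=1..L. \<Sum>j=1..L. v i * v j * D i j)\<^sup>2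
    \<le> (\<Sum>x\<in>{1..L} \<times> {1..L}. (v (fst x) * v (snd x))\<^sup>2) * (\<Sum>x\<in>{1..L} \<times> {1..L}. (D (fst x) (snd x))\<^sup>2)"
    unfolding pairs by (rule Cauchy_Schwarz_ineq_sum)
  also have "\<dots> = ?v2\<^sup>2 * gram_defect \<eta> p m N L s"
    unfolding v4 by (simp add: gram_defect_def D_def sum.cartesian_product case_prod_beta)
  finally have "\<bar>\<Sum>i=1..L. \<Sum>j=1..L. v i * v j * D i j\<bar> \<le> sqrt (?v2\<^sup>2 * gram_defect \<eta> p m N L s)"
    by (intro real_le_rsqrt) simp
  also have "\<dots> = sqrt (gram_defect \<eta> p m N L s) * ?v2"
    by (simp add: real_sqrt_mult sum_nonneg)
  finally show ?thesis unfolding eq by (simp add: algebra_simps)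
qed

text \<open>A combination of lagged noise is the finite autoregressive filter applied to the same
  combination W of lagged observations, hence has at most \<open>A^2\<close> times its energy. The 4
  arises from \<open>(N - p) * s \<ge> N * s / 2\<close>, of which the defect takes at most
  half.\<close>

lemma comb_energy_lower:
  assumes \<eta>: "\<And>n. \<eta> n = y n + (\<Sum>l=1..p. \<psi> l * y (n - int l))"
    and N: "2 * p \<le> N" and s: "0 < s"
    and defect: "gram_defect \<eta> p m N L s \<le> (real N * s / 4)\<^sup>2"
  shows "comb_energy y m N L v \<ge> s / (4 * (1 + (\<Sum>l=1..p. \<bar>\<psi> l\<bar>))\<^sup>2) * real N * (\<Sum>l=1..L. (v l)\<^sup>2)"
proof -
  define A where "A = 1 + (\<Sum>l=1..p. \<bar>\<psi> l\<bar>)"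
  define a where "a l = (if l = 0 then 1 else \<psi> l)" for l
  define W where "W k = (\<Sum>i=1..L. v i * y (k - int i))" for k
  have A: "(\<Sum>l=0..p. \<bar>a l\<bar>) = A"
    by (simp add: sum.atLeast_Suc_atMost a_def A_def)
  have A1: "1 \<le> A" by (simp add: A_def sum_nonneg)
  have conv: "(\<Sum>i=1..L. v i * \<eta> (int n - int i)) = (\<Sum>l=0..p. a l * W (int n - int l))" for n
  proof -
    have "\<eta> k = (\<Sum>l=0..p. a l * y (k - int l))" for k
      by (simp add: sum.atLeast_Suc_atMost \<eta> a_def)
    then have "(\<Sum>i=1..L. v i * \<eta> (int n - int i)) = (\<Sum>i=1..L. \<Sum>l=0..p. a l * (v i * y (int n - int l - int i)))"
      by (simp add: sum_distrib_left algebra_simps)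
    also have "\<dots> = (\<Sum>l=0..p. a l * W (int n - int l))"
      unfolding W_def sum_distrib_left by (rule sum.swap)
    finally show ?thesis .
  qed
  have "real N * s / 4 \<le> real (N - p) * s - sqrt (gram_defect \<eta> p m N L s)"
  proof -
    have "sqrt (gram_defect \<eta> p m N L s) \<le> real N * s / 4"
      using defect s by (intro real_le_lsqrt) auto
    moreover have "real N / 2 * s \<le> real (N - p) * s"
      using N s by (intro mult_right_mono) auto
    ultimately show ?thesis by simp
  qed
  then have "real N * s / 4 * (\<Sum>i=1..L. (v i)\<^sup>2)
      \<le> (real (N - p) * s - sqrt (gram_defect \<eta> p m N L s)) * (\<Sum>i=1..L. (v i)\<^sup>2)"
    by (intro mult_right_mono sum_nonneg) auto
  also have "\<dots> \<le> (\<Sum>n=m+1+p..m+N. (\<Sum>i=1..L. v i * \<eta> (int n - int i))\<^sup>2)"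
    by (rule noise_comb_energy_lower) (use N in simp)
  also have "\<dots> \<le> (\<Sum>n=m+1+p..m+N. A * (\<Sum>l=0..p. \<bar>a l\<bar> * (W (int n - int l))\<^sup>2))"
    unfolding conv A[symmetric] by (intro sum_mono weighted_Cauchy_Schwarz)
  also have "\<dots> = A * (\<Sum>l=0..p. \<bar>a l\<bar> * (\<Sum>n=m+1+p..m+N. (W (int n - int l))\<^sup>2))"
    unfolding sum_distrib_left[symmetric] by (subst sum.swap) (simp add: sum_distrib_left)
  also have "\<dots> \<le> A * (\<Sum>l=0..p. \<bar>a l\<bar> * comb_energy y m N L v)"
  proof (intro mult_left_mono sum_mono)
    fix l assume l: "l \<in> {0..p}"
    \<comment> \<open>The omitted first p points leave room: shifted back by
      \<open>l \<le> p\<close>, the shortened window still lies in the full one.\<close>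
    have "(\<Sum>n=m+1+p..m+N. (W (int n - int l))\<^sup>2) = (\<Sum>n=m+1+p-l..m+N-l. (W (int n))\<^sup>2)"
      using l by (intro sum.reindex_bij_witness[of _ "\<lambda>n. n + l" "\<lambda>n. n - l"]) (auto simp: of_nat_diff)
    also have "\<dots> \<le> (\<Sum>n=m+1..m+N. (W (int n))\<^sup>2)"
      using l by (intro sum_mono2) auto
    finally show "(\<Sum>n=m+1+p..m+N. (W (int n - int l))\<^sup>2) \<le> comb_energy y m N L v"
      by (simp add: comb_energy_def W_def)
  qed (use A1 in auto)
  also have "\<dots> = A\<^sup>2 * comb_energy y m N L v"
    unfolding sum_distrib_right[symmetric] A by (simp add: power2_eq_square)
  finally show ?thesis
    using A1 unfolding A_def[symmetric] by (simp add: field_simps)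
qed

section \<open>Comparison of the criterion values on a sample path\<close>

text \<open>The deterministic setting: \<eta> is the exact residual of the true recursion at all
  integer times, and s stands for the noise variance.\<close>

locale ar_path =
  fixes y \<eta> :: "int \<Rightarrow> real" and \<psi> :: "nat \<Rightarrow> real" and p :: nat and s :: real
  assumes eta: "\<eta> n = y n + (\<Sum>l=1..p. \<psi> l * y (n - int l))"
    and p_pos: "1 \<le> p" and psi_p: "\<psi> p \<noteq> 0" and s_pos: "0 < s"
begin

definition \<kappa> :: real where "\<kappa> = s / (4 * (1 + (\<Sum>l=1..p. \<bar>\<psi> l\<bar>))\<^sup>2)"

definition noise_energy :: "nat \<Rightarrow> nat \<Rightarrow> real" where
  "noise_energy m N = (\<Sum>n=m+1..m+N. (\<eta> (int n))\<^sup>2) / real N"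

definition score_energy :: "nat \<Rightarrow> nat \<Rightarrow> nat \<Rightarrow> real" where
  "score_energy m N K = (\<Sum>l=1..K. (score y \<eta> m N l)\<^sup>2)"

lemma kappa_pos: "0 < \<kappa>"
proof -
  have "0 < 1 + (\<Sum>l=1..p. \<bar>\<psi> l\<bar>)" by (rule add_pos_nonneg) (auto intro: sum_nonneg)
  then show ?thesis using s_pos by (simp add: \<kappa>_def)
qed

lemma score_energy_nonneg: "0 \<le> score_energy m N K"
  by (simp add: score_energy_def sum_nonneg)

lemma gram_defect_mono:
  assumes "L \<le> K"
  shows "gram_defect \<eta> p m N L s \<le> gram_defect \<eta> p m N K s"
  unfolding gram_defect_def using assms
  by (intro order_trans[OF sum_mono[OF sum_mono2] sum_mono2]) (auto intro: sum_nonneg)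

text \<open>Everything is measured at the common order K, so one Gram bound and one score bound
  serve all orders \<open>L \<le> K\<close> at once.\<close>

lemma e_hat_lower:
  assumes N: "0 < N" "2 * p \<le> N" and K: "L \<le> K" "p \<le> K"
    and defect: "gram_defect \<eta> p m N K s \<le> (real N * s / 4)\<^sup>2"
  shows "\<exists>t\<ge>0. (L < p \<longrightarrow> \<bar>\<psi> p\<bar> \<le> t) \<and>
    noise_energy m N - 2 * t * (sqrt (score_energy m N K) / real N) + \<kappa> * t\<^sup>2 \<le> e_hat y m N L"
proof -
  have "\<kappa> * real N * (\<Sum>l=1..K. (v l)\<^sup>2) \<le> comb_energy y m N K v" for v
    unfolding \<kappa>_def by (rule comb_energy_lower[OF eta N(2) s_pos defect])
  from resid_energy_lower[OF eta K this, of "psi_hat y m N L"]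
  obtain t where t: "t \<ge> 0" "L < p \<longrightarrow> \<bar>\<psi> p\<bar> \<le> t"
    "(\<Sum>n=m+1..m+N. (\<eta> (int n))\<^sup>2) - 2 * t * sqrt (score_energy m N K) + \<kappa> * real N * t\<^sup>2
       \<le> resid_energy y m N L (psi_hat y m N L)"
    unfolding score_energy_def by auto
  from t(3) have "((\<Sum>n=m+1..m+N. (\<eta> (int n))\<^sup>2) - 2 * t * sqrt (score_energy m N K) + \<kappa> * real N * t\<^sup>2) / real N
      \<le> e_hat y m N L"
    unfolding e_hat_eq by (rule divide_right_mono) simp
  also have "((\<Sum>n=m+1..m+N. (\<eta> (int n))\<^sup>2) - 2 * t * sqrt (score_energy m N K) + \<kappa> * real N * t\<^sup>2) / real N
     = noise_energy m N - 2 * t * (sqrt (score_energy m N K) / real N) + \<kappa> * t\<^sup>2"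
    using N(1) by (simp add: noise_energy_def add_divide_distrib diff_divide_distrib)
  finally show ?thesis using t by blast
qed

lemma e_hat_lower_overfit:
  assumes "0 < N" "2 * p \<le> N" "L \<le> K" "p \<le> K"
    and "gram_defect \<eta> p m N K s \<le> (real N * s / 4)\<^sup>2"
  shows "noise_energy m N - score_energy m N K / (\<kappa> * (real N)\<^sup>2) \<le> e_hat y m N L"
proof -
  define \<beta> where "\<beta> = sqrt (score_energy m N K) / real N"
  obtain t where t: "noise_energy m N - 2 * t * \<beta> + \<kappa> * t\<^sup>2 \<le> e_hat y m N L"
    using e_hat_lower[OF assms] unfolding \<beta>_def by blast
  have "0 \<le> \<kappa> * (t - \<beta> / \<kappa>)\<^sup>2" using kappa_pos by simp
  also have "\<dots> = \<kappa> * t\<^sup>2 - 2 * t * \<beta> + \<beta>\<^sup>2 / \<kappa>"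
    using kappa_pos by (simp add: power2_eq_square field_simps)
  finally have "- (\<beta>\<^sup>2 / \<kappa>) \<le> \<kappa> * t\<^sup>2 - 2 * t * \<beta>" by simp
  moreover have "\<beta>\<^sup>2 / \<kappa> = score_energy m N K / (\<kappa> * (real N)\<^sup>2)"
    by (simp add: \<beta>_def power_divide score_energy_nonneg)
  ultimately show ?thesis using t by linarith
qed

text \<open>The smallness of the score keeps the linear term below half of the quadratic one for
  every \<open>t \<ge> \<bar>\<psi> p\<bar>\<close>; the other half is the fixed loss.\<close>

lemma e_hat_lower_underfit:
  assumes "0 < N" "2 * p \<le> N" "L < p" "p \<le> K"
    and "gram_defect \<eta> p m N K s \<le> (real N * s / 4)\<^sup>2"
    and \<beta>: "4 * (sqrt (score_energy m N K) / real N) \<le> \<kappa> * \<bar>\<psi> p\<bar>"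
  shows "noise_energy m N + \<kappa> * (\<psi> p)\<^sup>2 / 2 \<le> e_hat y m N L"
proof -
  define \<beta> where "\<beta> = sqrt (score_energy m N K) / real N"
  have "L \<le> K" using assms by simp
  from e_hat_lower[OF assms(1,2) this assms(4,5)] assms(3)
  obtain t where t: "\<bar>\<psi> p\<bar> \<le> t" "noise_energy m N - 2 * t * \<beta> + \<kappa> * t\<^sup>2 \<le> e_hat y m N L"
    unfolding \<beta>_def by blast
  have "2 * t * \<beta> \<le> 2 * t * (\<kappa> * \<bar>\<psi> p\<bar> / 4)"
    using \<beta> t(1) unfolding \<beta>_def[symmetric] by (intro mult_left_mono) auto
  also have "\<dots> = \<kappa> * (t * \<bar>\<psi> p\<bar>) / 2" by simp
  also have "\<dots> \<le> \<kappa> * (t * t) / 2"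
    using t(1) kappa_pos by (intro divide_right_mono mult_left_mono) auto
  finally have "\<kappa> * t\<^sup>2 / 2 \<le> \<kappa> * t\<^sup>2 - 2 * t * \<beta>"
    by (simp add: power2_eq_square mult_ac)
  moreover have "(\<psi> p)\<^sup>2 \<le> t\<^sup>2"
    using t(1) by (metis abs_ge_zero power2_abs power_mono)
  then have "\<kappa> * (\<psi> p)\<^sup>2 / 2 \<le> \<kappa> * t\<^sup>2 / 2"
    using kappa_pos by (intro divide_right_mono mult_left_mono) auto
  ultimately show ?thesis using t(2) by linarith
qed

text \<open>At order p the true coefficients compete in the least squares problem, and their mean
  residual is the noise energy.\<close>

lemma e_hat_true_order_le:
  assumes N: "0 < N" "2 * p \<le> N" and K: "p \<le> K"
    and defect: "gram_defect \<eta> p m N K s \<le> (real N * s / 4)\<^sup>2"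
  shows "e_hat y m N p \<le> noise_energy m N"
proof -
  have d: "gram_defect \<eta> p m N p s \<le> (real N * s / 4)\<^sup>2"
    using gram_defect_mono[OF K] defect by (rule order_trans)
  have "\<kappa> * real N * (\<Sum>l=1..p. (v l)\<^sup>2) \<le> comb_energy y m N p v" for v
    unfolding \<kappa>_def by (rule comb_energy_lower[OF eta N(2) s_pos d])
  then have "e_hat y m N p \<le> resid_energy y m N p \<psi> / real N"
    using N kappa_pos by (intro e_hat_le[of _ "\<kappa> * real N"]) auto
  also have "resid_energy y m N p \<psi> = (\<Sum>n=m+1..m+N. (\<eta> (int n))\<^sup>2)"
    by (simp add: resid_energy_def eta)
  finally show ?thesis by (simp add: noise_energy_def)
qed

text \<open>With x = g/q at most 1/2, where q is the noise energy,
  \<open>ln (1 - x) \<ge> - x - 2 * x^2 \<ge> - 2 * x\<close>. The larger order thus lowers the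
  logarithm by at most \<open>2 * g / q\<close>, which the additional penalty exceeds.\<close>

lemma true_order_beats_larger:
  assumes N: "0 < N" "2 * p \<le> N" "p \<le> L" "L \<le> K"
    and defect: "gram_defect \<eta> p m N K s \<le> (real N * s / 4)\<^sup>2"
    and Q: "0 < noise_energy m N"
    and g: "score_energy m N K / (\<kappa> * (real N)\<^sup>2) \<le> g" "g \<le> noise_energy m N / 2"
    and pen: "2 * g / noise_energy m N < 2 * real m / real N * (\<Sum>k=p+1..L. 1 / real k)"
  shows "bridge_criterion y m N p < bridge_criterion y m N L"
proof -
  define q where "q = noise_energy m N"
  have g0: "0 \<le> g"
    using g(1) kappa_pos score_energy_nonneg by (meson divide_nonneg_nonneg less_imp_le mult_nonneg_nonneg order_trans zero_le_power2)
  have pK: "p \<le> K" using N by simp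
  have up: "e_hat y m N p \<le> q"
    unfolding q_def by (rule e_hat_true_order_le[OF N(1,2) pK defect])
  have low: "q - g \<le> e_hat y m N L'" if "L' \<le> K" for L'
    using e_hat_lower_overfit[OF N(1,2) that pK defect] g(1) unfolding q_def by linarith
  have q: "0 < q" "g \<le> q / 2" using Q g by (simp_all add: q_def)
  have "- 2 * (g / q) \<le> - (g / q) - 2 * (g / q)\<^sup>2"
  proof -
    have "(g / q) * (g / q) \<le> (g / q) * (1 / 2)"
      using q g0 by (intro mult_left_mono) (auto simp: field_simps)
    then show ?thesis by (simp add: power2_eq_square)
  qed
  also have "\<dots> \<le> ln (1 - g / q)"
    using q g0 by (intro ln_one_minus_pos_lower_bound) (auto simp: field_simps)
  finally have "ln q - 2 * (g / q) \<le> ln q + ln (1 - g / q)" by simp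
  also have "\<dots> = ln (q * (1 - g / q))"
    using q g0 by (subst ln_mult) (auto simp: field_simps)
  also have "q * (1 - g / q) = q - g" using q by (simp add: field_simps)
  also have "ln (q - g) \<le> ln (e_hat y m N L)"
    using low[OF N(4)] q by (subst ln_le_cancel_iff) auto
  finally have L: "ln q - 2 * (g / q) \<le> ln (e_hat y m N L)" .
  have "ln (e_hat y m N p) \<le> ln q"
    using up low[OF pK] q by (subst ln_le_cancel_iff) auto
  moreover have "(\<Sum>k=1..L. 1 / real k) = (\<Sum>k=1..p. 1 / real k) + (\<Sum>k=p+1..L. 1 / real k)"
    using N(3) by (metis Suc_eq_plus1 le_add2 sum.ub_add_nat add_diff_inverse_nat not_less)
  ultimately show ?thesis
    using L pen unfolding bridge_criterion_def q_def[symmetric] by (simp add: distrib_left)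
qed

text \<open>The penalty of the smaller order is simply dropped. Order 0 is covered too, since an
  arbitrary finite candidate set may contain it.\<close>

lemma true_order_beats_smaller:
  assumes N: "0 < N" "2 * p \<le> N" "L < p" "p \<le> K"
    and defect: "gram_defect \<eta> p m N K s \<le> (real N * s / 4)\<^sup>2"
    and Q: "0 < noise_energy m N"
    and g: "score_energy m N K / (\<kappa> * (real N)\<^sup>2) \<le> noise_energy m N / 2"
    and \<beta>: "4 * (sqrt (score_energy m N K) / real N) \<le> \<kappa> * \<bar>\<psi> p\<bar>"
    and pen: "ln (noise_energy m N) + 2 * real m / real N * (\<Sum>k=1..p. 1 / real k)
      < ln (noise_energy m N + \<kappa> * (\<psi> p)\<^sup>2 / 2)"
  shows "bridge_criterion y m N p < bridge_criterion y m N L"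
proof -
  have "0 < e_hat y m N p"
    using e_hat_lower_overfit[OF N(1,2) N(4) N(4) defect] g Q by linarith
  then have "ln (e_hat y m N p) \<le> ln (noise_energy m N)"
    using e_hat_true_order_le[OF N(1,2,4) defect] by simp
  moreover have "0 < noise_energy m N + \<kappa> * (\<psi> p)\<^sup>2 / 2"
    using Q kappa_pos by (intro add_pos_nonneg) auto
  then have "ln (noise_energy m N + \<kappa> * (\<psi> p)\<^sup>2 / 2) \<le> ln (e_hat y m N L)"
    using e_hat_lower_underfit[OF N defect \<beta>] by simp
  moreover have "0 \<le> 2 * real m / real N * (\<Sum>k=1..L. 1 / real k)"
    by (intro mult_nonneg_nonneg sum_nonneg) auto
  ultimately show ?thesis
    using pen unfolding bridge_criterion_def by linarith
qed

text \<open>On the scale \<open>m / N\<close> the gain of a larger order is a multiple of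
  \<open>b N\<close>, which vanishes, against a penalty increment of at least
  \<open>2 / (p + 1)\<close>. For smaller orders the loss stays fixed while the penalty up to p
  vanishes.\<close>

lemma eventually_true_order_beats_fixed:
  fixes m :: "nat \<Rightarrow> nat"
  assumes K: "p \<le> K"
    and m1: "\<forall>\<^sub>F N in sequentially. 1 \<le> m N" and mN: "(\<lambda>N. real (m N) / real N) \<longlonglongrightarrow> 0"
    and Q: "(\<lambda>N. noise_energy (m N) N) \<longlonglongrightarrow> s"
    and score: "\<And>l. l \<in> {1..K} \<Longrightarrow> (\<lambda>N. (score y \<eta> (m N) N l)\<^sup>2 / (real N * real (m N))) \<longlonglongrightarrow> 0"
    and defect: "(\<lambda>N. gram_defect \<eta> p (m N) N K s / (real N)\<^sup>2) \<longlonglongrightarrow> 0"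
  shows "\<forall>\<^sub>F N in sequentially. \<forall>L\<le>K. L \<noteq> p \<longrightarrow>
    bridge_criterion y (m N) N p < bridge_criterion y (m N) N L"
proof -
  define b where "b N = score_energy (m N) N K / (real N * real (m N))" for N
  define g where "g N = score_energy (m N) N K / (\<kappa> * (real N)\<^sup>2)" for N
  have b: "b \<longlonglongrightarrow> 0"
    unfolding b_def score_energy_def sum_divide_distrib by (rule tendsto_null_sum) (use score in auto)
  have ev0: "\<forall>\<^sub>F N in sequentially. 1 \<le> m N \<and> 0 < N \<and> 2 * p \<le> N"
    using m1 eventually_gt_at_top[of 0] eventually_ge_at_top[of "2 * p"] by eventually_elim auto
  have g: "g \<longlonglongrightarrow> 0"
  proof -
    have "(\<lambda>N. b N * (real (m N) / real N) / \<kappa>) \<longlonglongrightarrow> 0 * 0 / \<kappa>"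
      using kappa_pos by (intro tendsto_intros b mN) auto
    moreover have "\<forall>\<^sub>F N in sequentially. b N * (real (m N) / real N) / \<kappa> = g N"
      using ev0 by eventually_elim (simp add: b_def g_def power2_eq_square)
    ultimately show ?thesis by (simp add: tendsto_cong)
  qed
  have e1: "\<forall>\<^sub>F N in sequentially. gram_defect \<eta> p (m N) N K s \<le> (real N * s / 4)\<^sup>2"
  proof -
    have "\<forall>\<^sub>F N in sequentially. gram_defect \<eta> p (m N) N K s / (real N)\<^sup>2 < (s / 4)\<^sup>2"
      by (rule order_tendstoD(2)[OF defect]) (use s_pos in simp)
    with ev0 show ?thesis
      by eventually_elim (simp add: field_simps power2_eq_square)
  qed
  have e2: "\<forall>\<^sub>F N in sequentially. s / 2 < noise_energy (m N) N"
    by (rule order_tendstoD(1)[OF Q]) (use s_pos in simp)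
  have e3: "\<forall>\<^sub>F N in sequentially. g N < s / 4"
    by (rule order_tendstoD(2)[OF g]) (use s_pos in simp)
  \<comment> \<open>This threshold makes \<open>2 * g / (s / 2)\<close> smaller than the penalty of
    the single additional order p + 1.\<close>
  have e4: "\<forall>\<^sub>F N in sequentially. b N < \<kappa> * (s / 2) * (1 / real (p + 1))"
    by (rule order_tendstoD(2)[OF b]) (use s_pos kappa_pos in simp)
  have e5: "\<forall>\<^sub>F N in sequentially. 4 * (sqrt (score_energy (m N) N K) / real N) < \<kappa> * \<bar>\<psi> p\<bar>"
  proof (rule order_tendstoD(2))
    have "(\<lambda>N. 4 * sqrt (\<kappa> * g N)) \<longlonglongrightarrow> 4 * sqrt (\<kappa> * 0)"
      by (intro tendsto_intros g)
    moreover have "\<forall>\<^sub>F N in sequentially. 4 * sqrt (\<kappa> * g N) = 4 * (sqrt (score_energy (m N) N K) / real N)"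
      using ev0 by eventually_elim (use kappa_pos in \<open>simp add: g_def real_sqrt_divide\<close>)
    ultimately show "(\<lambda>N. 4 * (sqrt (score_energy (m N) N K) / real N)) \<longlonglongrightarrow> 0"
      by (simp add: tendsto_cong)
  qed (use kappa_pos psi_p in simp)
  have e6: "\<forall>\<^sub>F N in sequentially. ln (noise_energy (m N) N) + 2 * real (m N) / real N * (\<Sum>k=1..p. 1 / real k)
      < ln (noise_energy (m N) N + \<kappa> * (\<psi> p)\<^sup>2 / 2)"
  proof -
    have pos: "0 < s + \<kappa> * (\<psi> p)\<^sup>2 / 2"
      using s_pos kappa_pos by (intro add_pos_nonneg) auto
    have "(\<lambda>N. ln (noise_energy (m N) N + \<kappa> * (\<psi> p)\<^sup>2 / 2)
        - (ln (noise_energy (m N) N) + 2 * (real (m N) / real N) * (\<Sum>k=1..p. 1 / real k)))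
      \<longlonglongrightarrow> ln (s + \<kappa> * (\<psi> p)\<^sup>2 / 2) - (ln s + 2 * 0 * (\<Sum>k=1..p. 1 / real k))"
      using s_pos pos by (intro tendsto_intros Q mN) auto
    moreover have "ln s < ln (s + \<kappa> * (\<psi> p)\<^sup>2 / 2)"
      using s_pos kappa_pos psi_p by (subst ln_less_cancel_iff) (auto intro: add_pos_nonneg)
    ultimately have "\<forall>\<^sub>F N in sequentially. 0 < ln (noise_energy (m N) N + \<kappa> * (\<psi> p)\<^sup>2 / 2)
        - (ln (noise_energy (m N) N) + 2 * (real (m N) / real N) * (\<Sum>k=1..p. 1 / real k))"
      by (intro order_tendstoD(1)) auto
    then show ?thesis by eventually_elim simp
  qed
  show ?thesis
    using ev0 e1 e2 e3 e4 e5 e6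
  proof eventually_elim
    case (elim N)
    have Qpos: "0 < noise_energy (m N) N" and gQ: "g N \<le> noise_energy (m N) N / 2"
      using elim s_pos by linarith+
    show ?case
    proof (intro allI impI)
      fix L assume L: "L \<le> K" "L \<noteq> p"
      show "bridge_criterion y (m N) N p < bridge_criterion y (m N) N L"
      proof (cases "L < p")
        case True
        show ?thesis
          by (rule true_order_beats_smaller[OF _ _ True K])
             (use elim Qpos gQ in \<open>auto simp: g_def\<close>)
      next
        case False
        then have pL: "p + 1 \<le> L" using L by simp
        have "1 / real (p + 1) \<le> (\<Sum>k=p+1..L. 1 / real k)"
          using pL by (intro member_le_sum) auto
        then have "2 * real (m N) / real N * (1 / real (p + 1))
            \<le> 2 * real (m N) / real N * (\<Sum>k=p+1..L. 1 / real k)"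
          by (intro mult_left_mono) auto
        moreover have "2 * g N / noise_energy (m N) N < 2 * real (m N) / real N * (1 / real (p + 1))"
        proof -
          have gb: "g N = b N * (real (m N) / real N) / \<kappa>"
            using elim by (simp add: b_def g_def power2_eq_square)
          have "2 * g N / noise_energy (m N) N \<le> 2 * g N / (s / 2)"
            using elim s_pos kappa_pos Qpos
            by (intro divide_left_mono) (auto simp: g_def score_energy_nonneg)
          also have "\<dots> = (2 * real (m N) / real N) * (b N / (\<kappa> * (s / 2)))"
            using kappa_pos by (simp add: gb mult_ac)
          also have "\<dots> < (2 * real (m N) / real N) * (1 / real (p + 1))"
            using elim kappa_pos s_pos by (intro mult_strict_left_mono) (auto simp: field_simps)
          finally show ?thesis .
        qed
        ultimately show ?thesis
          using elim Qpos gQ L pL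
          by (intro true_order_beats_larger[where K = K and g = "g N"]) (auto simp: g_def)
      qed
    qed
  qed
qed

text \<open>Gain and penalty are both multiples of \<open>2 * m / N\<close>, and the condition on K
  compares the factors. The score and Gram bounds are premises inside the eventuality because they
  hold only with high probability for each N.\<close>

lemma eventually_true_order_beats_large:
  fixes m :: "nat \<Rightarrow> nat"
  assumes m: "filterlim m at_top sequentially" and mN: "(\<lambda>N. real (m N) / real N) \<longlonglongrightarrow> 0"
    and Q: "(\<lambda>N. noise_energy (m N) N) \<longlonglongrightarrow> s"
    and K: "p \<le> K" "2 * R / (\<kappa> * s) < (\<Sum>k=p+1..K. 1 / real k)"
  shows "\<forall>\<^sub>F N in sequentially. score_energy (m N) N (m N) \<le> R * real N * real (m N) \<longrightarrow>
    gram_defect \<eta> p (m N) N (m N) s \<le> (real N * s / 4)\<^sup>2 \<longrightarrow>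
    (\<forall>L. K < L \<and> L \<le> m N \<longrightarrow> bridge_criterion y (m N) N p < bridge_criterion y (m N) N L)"
proof -
  have ev0: "\<forall>\<^sub>F N in sequentially. 1 \<le> m N \<and> 0 < N \<and> 2 * p \<le> N"
    using filterlim_at_top[THEN iffD1, OF m, rule_format, of 1]
      eventually_gt_at_top[of 0] eventually_ge_at_top[of "2 * p"] by eventually_elim auto
  have e2: "\<forall>\<^sub>F N in sequentially. s / 2 < noise_energy (m N) N"
    by (rule order_tendstoD(1)[OF Q]) (use s_pos in simp)
  have "(\<lambda>N. R / \<kappa> * (real (m N) / real N)) \<longlonglongrightarrow> R / \<kappa> * 0"
    by (intro tendsto_intros mN)
  then have e3: "\<forall>\<^sub>F N in sequentially. R / \<kappa> * (real (m N) / real N) < s / 4"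
    by (rule order_tendstoD(2)) (use s_pos in simp)
  show ?thesis
    using ev0 e2 e3
  proof eventually_elim
    case (elim N)
    define g where "g = R / \<kappa> * (real (m N) / real N)"
    show ?case
    proof (intro impI allI)
      fix L assume b: "score_energy (m N) N (m N) \<le> R * real N * real (m N)"
        and defect: "gram_defect \<eta> p (m N) N (m N) s \<le> (real N * s / 4)\<^sup>2" and L: "K < L \<and> L \<le> m N"
      have R0: "0 \<le> R"
      proof -
        have "0 \<le> R * (real N * real (m N))"
          using order_trans[OF score_energy_nonneg b] by (simp add: mult.assoc)
        moreover have "0 < real N * real (m N)" using elim by simp
        ultimately show ?thesis unfolding zero_le_mult_iff by (meson not_le)
      qed
      have "score_energy (m N) N (m N) / (\<kappa> * (real N)\<^sup>2) \<le> R * real N * real (m N) / (\<kappa> * (real N)\<^sup>2)"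
        using b kappa_pos by (intro divide_right_mono) auto
      also have "\<dots> = g" using elim by (simp add: g_def power2_eq_square)
      finally have gle: "score_energy (m N) N (m N) / (\<kappa> * (real N)\<^sup>2) \<le> g" .
      have "2 * g / noise_energy (m N) N \<le> 2 * g / (s / 2)"
        using elim s_pos kappa_pos R0 by (intro divide_left_mono) (auto simp: g_def)
      also have "\<dots> = 2 * real (m N) / real N * (2 * R / (\<kappa> * s))"
        by (simp add: g_def mult_ac)
      also have "\<dots> < 2 * real (m N) / real N * (\<Sum>k=p+1..K. 1 / real k)"
        using elim K(2) by (intro mult_strict_left_mono) auto
      also have "\<dots> \<le> 2 * real (m N) / real N * (\<Sum>k=p+1..L. 1 / real k)"
        using L by (intro mult_left_mono sum_mono2) auto
      finally have pen: "2 * g / noise_energy (m N) N < 2 * real (m N) / real N * (\<Sum>k=p+1..L. 1 / real k)" .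
      have "g < s / 4" using elim(3) by (simp add: g_def)
      then have "g \<le> noise_energy (m N) N / 2" "0 < noise_energy (m N) N"
        using elim(2) s_pos by linarith+
      then show "bridge_criterion y (m N) N p < bridge_criterion y (m N) N L"
        using elim L K by (intro true_order_beats_larger[OF _ _ _ _ defect _ gle _ pen]) auto
    qed
  qed
qed

end

section \<open>Window sums of the noise\<close>

lemma lnln_at_top: "filterlim (\<lambda>N. ln (ln (real N))) at_top sequentially"
  by (intro filterlim_compose[OF ln_at_top] filterlim_real_sequentially)

text \<open>Both window ends are below \<open>3 * N\<close> eventually, so the iterated-logarithm
  bound is O(N ln ln N) there; division by N m leaves \<open>ln (ln N) / m\<close>. This is where
  the lower growth condition on m is decisive.\<close>

lemma window_square_tendsto_0:
  fixes S :: "nat \<Rightarrow> real" and m a b :: "nat \<Rightarrow> nat"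
  assumes S: "\<And>n. (S n)\<^sup>2 \<le> C * (real n + 1) * ln (ln (real n + 16))"
    and m: "filterlim (\<lambda>N. real (m N) / ln (ln (real N))) at_top sequentially"
    and mN: "(\<lambda>N. real (m N) / real N) \<longlonglongrightarrow> 0"
    and ab: "\<And>N. a N \<le> m N + N + d" "\<And>N. b N \<le> m N + N + d"
  shows "(\<lambda>N. (S (b N) - S (a N))\<^sup>2 / (real N * real (m N))) \<longlonglongrightarrow> 0"
proof -
  have C0: "0 \<le> C"
  proof -
    have "0 \<le> C * ln (ln (16::real))" using order_trans[OF zero_le_power2 S[of 0]] by simp
    moreover have "0 < ln (ln (16::real))"
      using lnln_ge[of 0] unfolding of_nat_0 add_0 by linarith
    ultimately show ?thesis by (simp add: zero_le_mult_iff)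
  qed
  have "(\<lambda>N. 24 * C * inverse (real (m N) / ln (ln (real N)))) \<longlonglongrightarrow> 24 * C * 0"
    by (intro tendsto_intros tendsto_inverse_0_at_top m)
  then have lim: "(\<lambda>N. 24 * C * inverse (real (m N) / ln (ln (real N)))) \<longlonglongrightarrow> 0" by simp
  have ev1: "\<forall>\<^sub>F N in sequentially. real (m N) / real N < 1"
    by (rule order_tendstoD(2)[OF mN]) simp
  have ev2: "\<forall>\<^sub>F N in sequentially. 1 \<le> ln (ln (real N))"
    using lnln_at_top by (simp add: filterlim_at_top)
  have ev3: "\<forall>\<^sub>F N in sequentially. 1 \<le> real (m N) / ln (ln (real N))"
    using m by (simp add: filterlim_at_top)
  have "\<forall>\<^sub>F N in sequentially. norm ((S (b N) - S (a N))\<^sup>2 / (real N * real (m N)))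
      \<le> 24 * C * inverse (real (m N) / ln (ln (real N)))"
    using ev1 ev2 ev3 eventually_ge_at_top[of "d + 20"]
  proof eventually_elim
    case (elim N)
    have N: "0 < real N" "real d + 20 \<le> real N" using elim(4) by linarith+
    have mN: "real (m N) < real N" using elim(1) N by simp
    have m0: "0 < real (m N)" using elim(2,3) by (cases "m N = 0") auto
    have lnN: "0 < ln (real N)" using N by simp
    \<comment> \<open>The 6 combines \<open>k + 1 \<le> 3 * N\<close> with
      \<open>ln (ln (k + 16)) \<le> 2 * ln (ln N)\<close>; the square of the difference of two such
      terms makes it 24.\<close>
    have key: "(S k)\<^sup>2 \<le> 6 * C * (real N * ln (ln (real N)))" if k: "k \<le> m N + N + d" for k
    proof -
      have k': "real k \<le> real (m N) + real N + real d" using k by linarith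
      have "2 * real N + real N \<le> real N * real N"
        using mult_right_mono[of 3 "real N" "real N"] N by simp
      then have "real k + 16 \<le> (real N)\<^sup>2"
        unfolding power2_eq_square using k' mN N by linarith
      then have "ln (real k + 16) \<le> ln ((real N)\<^sup>2)"
        using N by (subst ln_le_cancel_iff) auto
      also have "\<dots> = 2 * ln (real N)" using N by (simp add: ln_realpow)
      finally have l1: "ln (real k + 16) \<le> 2 * ln (real N)" .
      have l0: "0 < ln (real k + 16)" by simp
      have "ln (ln (real k + 16)) \<le> ln (2 * ln (real N))"
        using l1 l0 lnN by (subst ln_le_cancel_iff) auto
      also have "\<dots> = ln 2 + ln (ln (real N))" using lnN by (simp add: ln_mult)
      also have "\<dots> \<le> 2 * ln (ln (real N))" using ln_2_less_1 elim(2) by linarith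
      finally have l2: "ln (ln (real k + 16)) \<le> 2 * ln (ln (real N))" .
      have l3: "0 \<le> ln (ln (real k + 16))" using lnln_ge[of k] by linarith
      have "(real k + 1) * ln (ln (real k + 16)) \<le> (3 * real N) * (2 * ln (ln (real N)))"
        using k' mN N by (intro mult_mono[OF _ l2 _ l3]) auto
      then have "C * ((real k + 1) * ln (ln (real k + 16))) \<le> C * ((3 * real N) * (2 * ln (ln (real N))))"
        using C0 by (rule mult_left_mono)
      with S[of k] show ?thesis by (simp add: mult_ac)
    qed
    have "(S (b N) - S (a N))\<^sup>2 \<le> 2 * (S (b N))\<^sup>2 + 2 * (S (a N))\<^sup>2"
      using zero_le_power2[of "S (b N) + S (a N)"] by (simp add: power2_sum power2_diff)
    also have "\<dots> \<le> 24 * C * (real N * ln (ln (real N)))"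
      using key[OF ab(1)] key[OF ab(2)] by linarith
    finally have "(S (b N) - S (a N))\<^sup>2 / (real N * real (m N)) \<le> 24 * C * (real N * ln (ln (real N))) / (real N * real (m N))"
      using N m0 by (intro divide_right_mono) auto
    also have "\<dots> = 24 * C * inverse (real (m N) / ln (ln (real N)))"
      using N by simp
    finally show ?case using N m0 by simp
  qed
  then show ?thesis
    using lim by (rule Lim_null_comparison)
qed

text \<open>The end \<open>b N\<close> may be much smaller than N, so the limit of
  \<open>f n / n\<close> cannot be composed with b. An affine bound \<open>r / 4 * n + D\<close>,
  valid for all n, takes its place.\<close>

lemma window_mean_tendsto_0:
  fixes f :: "nat \<Rightarrow> real" and m b :: "nat \<Rightarrow> nat"
  assumes f: "(\<lambda>n. f n / real n) \<longlonglongrightarrow> 0"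
    and mN: "(\<lambda>N. real (m N) / real N) \<longlonglongrightarrow> 0"
    and b: "\<And>N. b N \<le> m N + N + d"
  shows "(\<lambda>N. f (b N) / real N) \<longlonglongrightarrow> 0"
proof (rule LIMSEQ_I)
  fix r :: real assume r: "0 < r"
  then have "\<forall>\<^sub>F n in sequentially. \<bar>f n / real n\<bar> < r / 4"
    using tendstoD[OF f, of "r / 4"] by (simp add: dist_real_def)
  then obtain n0 where n0: "\<And>n. n \<ge> n0 \<Longrightarrow> \<bar>f n / real n\<bar> < r / 4"
    unfolding eventually_sequentially by blast
  define D where "D = (\<Sum>n\<le>n0. \<bar>f n\<bar>)"
  have bd: "\<bar>f n\<bar> \<le> r / 4 * real n + D" for n
  proof (cases "n \<le> n0")
    case True
    then have "\<bar>f n\<bar> \<le> D" unfolding D_def by (intro member_le_sum) auto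
    moreover have "0 \<le> r / 4 * real n" using r by simp
    ultimately show ?thesis by linarith
  next
    case False
    then have "\<bar>f n\<bar> < r / 4 * real n"
      using n0[of n] by (simp add: field_simps)
    moreover have "0 \<le> D" by (simp add: D_def sum_nonneg)
    ultimately show ?thesis by linarith
  qed
  have "(\<lambda>N. D / real N) \<longlonglongrightarrow> 0" by (rule lim_const_over_n)
  then have "\<forall>\<^sub>F N in sequentially. D / real N < r / 4"
    by (rule order_tendstoD(2)) (use r in simp)
  moreover have "\<forall>\<^sub>F N in sequentially. real (m N) / real N < 1"
    by (rule order_tendstoD(2)[OF mN]) simp
  ultimately have "\<forall>\<^sub>F N in sequentially. norm (f (b N) / real N - 0) < r"
    using eventually_ge_at_top[of "d + 1"]
  proof eventually_elim
    case (elim N)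
    have N: "0 < real N" "real d \<le> real N" using elim(3) by linarith+
    have "real (b N) \<le> 3 * real N"
      using elim(2) N of_nat_mono[OF b[of N], where 'a = real] by simp
    then have "r / 4 * real (b N) \<le> r / 4 * (3 * real N)"
      using r by (intro mult_left_mono) auto
    moreover have "D < r / 4 * real N" using elim(1) N by (simp add: field_simps)
    ultimately have "\<bar>f (b N)\<bar> < r * real N" using bd[of "b N"] by simp
    then show ?case using N by (simp add: field_simps)
  qed
  then show "\<exists>no. \<forall>N\<ge>no. norm (f (b N) / real N - 0) < r"
    unfolding eventually_sequentially .
qed

text \<open>Reindexed by the later of the two noise times, so that the earlier factor becomes a
  predictable weight of \<open>e k\<close>.\<close>

lemma lag_product_sum_eq:
  fixes E :: "nat \<Rightarrow> real"
  assumes ij: "i \<le> j" "j \<le> m"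
  shows "(\<Sum>n=m+1+p..m+N. E (nat (int n - int i)) * E (nat (int n - int j)) - r)
    = (\<Sum>k\<in>{m+1+p-i..<m+N+1-i}. E (k - (j - i)) * E k - r)"
proof (rule sum.reindex_bij_witness[of _ "\<lambda>k. k + i" "\<lambda>n. n - i"])
  fix n assume "n \<in> {m+1+p..m+N}"
  then show "E (n - i - (j - i)) * E (n - i) - r = E (nat (int n - int i)) * E (nat (int n - int j)) - r"
    using ij by (simp add: nat_diff_distrib')
qed (use ij in auto)

section \<open>Lagged products and filtered noise as martingale sums\<close>

context gaussian_noise begin

lemma energy_bound: "AE \<omega> in M. \<exists>D. \<forall>n. (\<Sum>k<n. (e k \<omega>)\<^sup>2) \<le> D * (real n + 1)"
  using slln_squares
proof eventually_elim
  case (elim \<omega>)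
  then have "Bseq (\<lambda>n. (\<Sum>k<n. (e k \<omega>)\<^sup>2) / real n)"
    by (intro convergent_imp_Bseq convergentI)
  then obtain D where D: "0 < D" "\<And>n. norm ((\<Sum>k<n. (e k \<omega>)\<^sup>2) / real n) \<le> D"
    by (auto elim: BseqE)
  have "(\<Sum>k<n. (e k \<omega>)\<^sup>2) \<le> D * (real n + 1)" for n
  proof (cases "n = 0")
    case False
    have "(\<Sum>k<n. (e k \<omega>)\<^sup>2) / real n \<le> D" using D(2)[of n] by (simp add: sum_nonneg)
    then have "(\<Sum>k<n. (e k \<omega>)\<^sup>2) \<le> D * real n" using False by (simp add: field_simps)
    then show ?thesis using D(1) by (simp add: algebra_simps)
  qed (use D in simp)
  then show ?case by blast
qed

lemma lil_noise_lag:
  assumes d: "1 \<le> d"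
  shows "AE \<omega> in M. \<exists>C. \<forall>n. (\<Sum>k<n. (if d \<le> k then e (k - d) \<omega> else 0) * e k \<omega>)\<^sup>2
    \<le> C * (real n + 1) * ln (ln (real n + 16))"
proof -
  define w where "w k \<omega> = (if d \<le> k then e (k - d) \<omega> else 0)" for k \<omega>
  have "w k \<in> borel_measurable (past k)" for k
    using noise_past[of "k - d" k] d by (cases "d \<le> k") (simp_all add: w_def[abs_def])
  from lil_upper_bound[of w, OF this] energy_bound
  show ?thesis
  proof eventually_elim
    case (elim \<omega>)
    from elim(2) obtain D where D: "\<And>n. (\<Sum>k<n. (e k \<omega>)\<^sup>2) \<le> D * (real n + 1)" by auto
    have "(\<Sum>k<n. (w k \<omega>)\<^sup>2) \<le> D * (real n + 1)" for n
    proof -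
      have "(\<Sum>k<n. (w k \<omega>)\<^sup>2) = (\<Sum>k\<in>{d..<n}. (e (k - d) \<omega>)\<^sup>2)"
        unfolding w_def by (intro sum.mono_neutral_cong_right) auto
      also have "\<dots> = (\<Sum>i<n - d. (e i \<omega>)\<^sup>2)"
        by (rule sum.reindex_bij_witness[of _ "\<lambda>i. i + d" "\<lambda>k. k - d"]) auto
      also have "\<dots> \<le> (\<Sum>i<n. (e i \<omega>)\<^sup>2)" by (intro sum_mono2) auto
      finally show ?thesis using D[of n] by linarith
    qed
    with elim(1) show ?case unfolding w_def by blast
  qed
qed

lemma causal_filter_past:
  assumes "j < int k"
  shows "(\<lambda>\<omega>. causal_filter c (\<lambda>i. e i \<omega>) j) \<in> borel_measurable (past k)"
proof (cases "j < 0")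
  case False
  have "(\<lambda>\<omega>. \<Sum>i\<le>nat j. c i * e (nat j - i) \<omega>) \<in> borel_measurable (past k)"
  proof (rule borel_measurable_sum)
    fix i
    have [measurable]: "e (nat j - i) \<in> borel_measurable (past k)"
      using assms False by (intro noise_past) linarith
    show "(\<lambda>\<omega>. c i * e (nat j - i) \<omega>) \<in> borel_measurable (past k)" by measurable
  qed
  then show ?thesis using False by (simp add: causal_filter_def)
qed (simp add: causal_filter_def)

text \<open>A lag of at least 1 makes the filtered noise a predictable weight; its energy grows at
  most linearly by Young's inequality and the strong law for squares.\<close>

lemma lil_filter_lag:
  assumes c: "summable (\<lambda>j. \<bar>c j\<bar>)" and l: "1 \<le> l"
  shows "AE \<omega> in M. \<exists>C. \<forall>n. (\<Sum>k<n. causal_filter c (\<lambda>i. e i \<omega>) (int k - int l) * e k \<omega>)\<^sup>2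
    \<le> C * (real n + 1) * ln (ln (real n + 16))"
proof -
  define w where "w k \<omega> = causal_filter c (\<lambda>i. e i \<omega>) (int k - int l)" for k \<omega>
  have "w k \<in> borel_measurable (past k)" for k
    unfolding w_def[abs_def] using l by (intro causal_filter_past) simp
  from lil_upper_bound[of w, OF this] energy_bound
  show ?thesis
  proof eventually_elim
    case (elim \<omega>)
    from elim(2) obtain D where D: "\<And>n. (\<Sum>k<n. (e k \<omega>)\<^sup>2) \<le> D * (real n + 1)" by auto
    let ?A = "(\<Sum>j. \<bar>c j\<bar>)\<^sup>2"
    have "(\<Sum>k<n. (w k \<omega>)\<^sup>2) \<le> (?A * D) * (real n + 1)" for n
    proof -
      have "(\<Sum>k<n. (w k \<omega>)\<^sup>2) = (\<Sum>k\<in>{l..<n}. (causal_filter c (\<lambda>i. e i \<omega>) (int (k - l)))\<^sup>2)"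
        unfolding w_def
        by (intro sum.mono_neutral_cong_right) (auto simp: of_nat_diff causal_filter_def)
      also have "\<dots> = (\<Sum>i<n - l. (causal_filter c (\<lambda>i. e i \<omega>) (int i))\<^sup>2)"
        by (rule sum.reindex_bij_witness[of _ "\<lambda>i. i + l" "\<lambda>k. k - l"]) auto
      also have "\<dots> \<le> (\<Sum>i<n. (causal_filter c (\<lambda>i. e i \<omega>) (int i))\<^sup>2)"
        by (intro sum_mono2) auto
      also have "\<dots> \<le> ?A * (\<Sum>k<n. (e k \<omega>)\<^sup>2)"
        by (rule causal_filter_energy_le[OF c])
      also have "\<dots> \<le> ?A * (D * (real n + 1))"
        by (intro mult_left_mono D) simp
      finally show ?thesis by (simp add: mult.assoc)
    qed
    with elim(1) show ?case unfolding w_def by blast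
  qed
qed

text \<open>Setting the weights before a to zero keeps them predictable and turns the window into an
  initial segment.\<close>

lemma second_moment_window:
  fixes w :: "nat \<Rightarrow> 'a \<Rightarrow> real" and g :: "real \<Rightarrow> real"
  assumes w: "\<And>k. w k \<in> borel_measurable (past k)"
    and w2: "\<And>k. integrable M (\<lambda>\<omega>. (w k \<omega>)\<^sup>2)" "\<And>k. expectation (\<lambda>\<omega>. (w k \<omega>)\<^sup>2) \<le> B"
    and g: "g \<in> borel_measurable borel"
    and g2: "\<And>k. integrable M (\<lambda>\<omega>. (g (e k \<omega>))\<^sup>2)" "\<And>k. expectation (\<lambda>\<omega>. (g (e k \<omega>))\<^sup>2) = v"
    and g1: "\<And>k. expectation (\<lambda>\<omega>. g (e k \<omega>)) = 0"
  shows "integrable M (\<lambda>\<omega>. (\<Sum>k\<in>{a..<n}. w k \<omega> * g (e k \<omega>))\<^sup>2)"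
    and "expectation (\<lambda>\<omega>. (\<Sum>k\<in>{a..<n}. w k \<omega> * g (e k \<omega>))\<^sup>2) \<le> v * (real (n - a) * B)"
proof -
  define u where "u k \<omega> = (if a \<le> k then w k \<omega> else 0)" for k \<omega>
  have u: "u k \<in> borel_measurable (past k)" for k
    using w[of k] by (cases "a \<le> k") (simp_all add: u_def[abs_def])
  have u2: "integrable M (\<lambda>\<omega>. (u k \<omega>)\<^sup>2)" for k
    using w2[of k] by (cases "a \<le> k") (simp_all add: u_def)
  have eq: "(\<Sum>k\<in>{a..<n}. w k \<omega> * g (e k \<omega>)) = (\<Sum>k<n. u k \<omega> * g (e k \<omega>))" for \<omega>
    unfolding u_def by (intro sum.mono_neutral_cong_left) auto
  have v0: "0 \<le> v" unfolding g2(2)[of 0, symmetric] by simp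
  note sm = second_moment_weighted_sum[of u g v n, OF u u2 g g2 g1]
  show "integrable M (\<lambda>\<omega>. (\<Sum>k\<in>{a..<n}. w k \<omega> * g (e k \<omega>))\<^sup>2)"
    unfolding eq by (rule sm(1))
  have "expectation (\<lambda>\<omega>. (\<Sum>k\<in>{a..<n}. w k \<omega> * g (e k \<omega>))\<^sup>2) = v * (\<Sum>k<n. expectation (\<lambda>\<omega>. (u k \<omega>)\<^sup>2))"
    unfolding eq by (rule sm(2))
  also have "(\<Sum>k<n. expectation (\<lambda>\<omega>. (u k \<omega>)\<^sup>2)) = (\<Sum>k\<in>{a..<n}. expectation (\<lambda>\<omega>. (w k \<omega>)\<^sup>2))"
    by (intro sum.mono_neutral_cong_right) (auto simp: u_def)
  also have "v * \<dots> \<le> v * (\<Sum>k\<in>{a..<n}. B)"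
    using v0 w2 by (intro mult_left_mono sum_mono) auto
  finally show "expectation (\<lambda>\<omega>. (\<Sum>k\<in>{a..<n}. w k \<omega> * g (e k \<omega>))\<^sup>2) \<le> v * (real (n - a) * B)" by simp
qed

lemma causal_filter_measurable [measurable]:
  "(\<lambda>\<omega>. causal_filter c (\<lambda>i. e i \<omega>) j) \<in> borel_measurable M"
  by (rule past_measurable[OF causal_filter_past[of j "nat (j + 1)"]]) linarith

lemma causal_filter_second_moment:
  assumes c: "summable (\<lambda>j. \<bar>c j\<bar>)"
  shows "integrable M (\<lambda>\<omega>. (causal_filter c (\<lambda>i. e i \<omega>) j)\<^sup>2)"
    and "expectation (\<lambda>\<omega>. (causal_filter c (\<lambda>i. e i \<omega>) j)\<^sup>2) \<le> (\<Sum>j. \<bar>c j\<bar>)\<^sup>2 * \<sigma>\<^sup>2"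
proof -
  let ?A = "\<Sum>j. \<bar>c j\<bar>"
  have A0: "0 \<le> ?A" by (rule suminf_nonneg[OF c]) simp
  have "integrable M (\<lambda>\<omega>. (causal_filter c (\<lambda>i. e i \<omega>) j)\<^sup>2) \<and>
    expectation (\<lambda>\<omega>. (causal_filter c (\<lambda>i. e i \<omega>) j)\<^sup>2) \<le> ?A\<^sup>2 * \<sigma>\<^sup>2"
  proof (cases "j < 0")
    case True then show ?thesis by (simp add: causal_filter_def)
  next
    case False
    then obtain k where k: "j = int k" by (metis nonneg_int_cases not_less)
    define b where "b \<omega> = ?A * (\<Sum>i\<le>k. \<bar>c (k - i)\<bar> * (e i \<omega>)\<^sup>2)" for \<omega>
    have le: "(causal_filter c (\<lambda>i. e i \<omega>) j)\<^sup>2 \<le> b \<omega>" for \<omega>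
      unfolding k b_def by (rule causal_filter_square_le[OF c])
    have bint: "integrable M b"
      unfolding b_def[abs_def] by (intro integrable_mult_right Bochner_Integration.integrable_sum noise_moments(1))
    have int: "integrable M (\<lambda>\<omega>. (causal_filter c (\<lambda>i. e i \<omega>) j)\<^sup>2)"
      by (intro Bochner_Integration.integrable_bound[OF bint])
         (auto intro!: AE_I2 order_trans[OF le abs_ge_self])
    have "expectation (\<lambda>\<omega>. (causal_filter c (\<lambda>i. e i \<omega>) j)\<^sup>2) \<le> expectation b"
      by (intro integral_mono int bint le)
    also have "expectation b = ?A * (\<Sum>i\<le>k. \<bar>c (k - i)\<bar> * \<sigma>\<^sup>2)"
      unfolding b_def[abs_def] by (simp add: noise_moments)
    also have "(\<Sum>i\<le>k. \<bar>c (k - i)\<bar> * \<sigma>\<^sup>2) = (\<Sum>j\<le>k. \<bar>c j\<bar>) * \<sigma>\<^sup>2"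
      unfolding sum_distrib_right
      by (rule sum.reindex_bij_witness[of _ "\<lambda>i. k - i" "\<lambda>i. k - i"]) auto
    also have "?A * \<dots> \<le> ?A * (?A * \<sigma>\<^sup>2)"
      using A0 c by (intro mult_left_mono mult_right_mono sum_le_suminf) auto
    finally show ?thesis using int by (simp add: power2_eq_square mult.assoc)
  qed
  then show "integrable M (\<lambda>\<omega>. (causal_filter c (\<lambda>i. e i \<omega>) j)\<^sup>2)"
    and "expectation (\<lambda>\<omega>. (causal_filter c (\<lambda>i. e i \<omega>) j)\<^sup>2) \<le> ?A\<^sup>2 * \<sigma>\<^sup>2" by auto
qed

text \<open>The score with the observations replaced by the causal filter of the noise: a martingale
  sum, with second moments computed directly.\<close>

definition causal_score :: "(nat \<Rightarrow> real) \<Rightarrow> nat \<Rightarrow> nat \<Rightarrow> nat \<Rightarrow> 'a \<Rightarrow> real" where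
  "causal_score c m N l \<omega> = (\<Sum>n=m+1..m+N. e n \<omega> * causal_filter c (\<lambda>i. e i \<omega>) (int n - int l))"

lemma causal_score_measurable [measurable]: "causal_score c m N l \<in> borel_measurable M"
  unfolding causal_score_def[abs_def] by measurable

lemma causal_score_second_moment:
  assumes c: "summable (\<lambda>j. \<bar>c j\<bar>)" and l: "1 \<le> l"
  shows "integrable M (\<lambda>\<omega>. (causal_score c m N l \<omega>)\<^sup>2)"
    and "expectation (\<lambda>\<omega>. (causal_score c m N l \<omega>)\<^sup>2) \<le> \<sigma>\<^sup>2 * (real N * ((\<Sum>j. \<bar>c j\<bar>)\<^sup>2 * \<sigma>\<^sup>2))"
proof -
  have eq: "causal_score c m N l \<omega> = (\<Sum>k\<in>{m+1..<m+N+1}. causal_filter c (\<lambda>i. e i \<omega>) (int k - int l) * e k \<omega>)" for \<omega>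
    unfolding causal_score_def by (intro sum.cong) auto
  have "(\<lambda>\<omega>. causal_filter c (\<lambda>i. e i \<omega>) (int k - int l)) \<in> borel_measurable (past k)" for k
    using l by (intro causal_filter_past) simp
  note sm = second_moment_window[of "\<lambda>k \<omega>. causal_filter c (\<lambda>i. e i \<omega>) (int k - int l)" _ "\<lambda>x. x" "\<sigma>\<^sup>2" "m+1" "m+N+1",
      OF this causal_filter_second_moment[OF c] _ _ noise_moments(3,2)]
  show "integrable M (\<lambda>\<omega>. (causal_score c m N l \<omega>)\<^sup>2)"
    unfolding eq by (rule sm(1)) (simp_all add: noise_moments)
  show "expectation (\<lambda>\<omega>. (causal_score c m N l \<omega>)\<^sup>2) \<le> \<sigma>\<^sup>2 * (real N * ((\<Sum>j. \<bar>c j\<bar>)\<^sup>2 * \<sigma>\<^sup>2))"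
    unfolding eq using sm(2) by (simp add: noise_moments)
qed

text \<open>Each of the L scores has second moment of order N. The resulting bound depends on R
  alone, so that R can be fixed before N and the number of lags grow.\<close>

lemma prob_causal_score_large:
  assumes c: "summable (\<lambda>j. \<bar>c j\<bar>)" and R: "0 < R" and N: "0 < N" and L: "0 < L"
  shows "prob {\<omega>\<in>space M. R * real N * real L < (\<Sum>l=1..L. (causal_score c m N l \<omega>)\<^sup>2)}
    \<le> \<sigma>^4 * (\<Sum>j. \<bar>c j\<bar>)\<^sup>2 / R"
proof -
  let ?u = "\<lambda>\<omega>. \<Sum>l=1..L. (causal_score c m N l \<omega>)\<^sup>2" and ?A = "\<Sum>j. \<bar>c j\<bar>"
  have int: "integrable M ?u"
    by (intro Bochner_Integration.integrable_sum causal_score_second_moment(1)[OF c]) simp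
  have pos: "0 < R * real N * real L" using R N L by simp
  have "expectation ?u = (\<Sum>l=1..L. expectation (\<lambda>\<omega>. (causal_score c m N l \<omega>)\<^sup>2))"
    by (intro Bochner_Integration.integral_sum causal_score_second_moment(1)[OF c]) simp
  also have "\<dots> \<le> (\<Sum>l=1..L. \<sigma>\<^sup>2 * (real N * (?A\<^sup>2 * \<sigma>\<^sup>2)))"
    by (intro sum_mono causal_score_second_moment(2)[OF c]) simp
  also have "\<dots> = real L * real N * (\<sigma>^4 * ?A\<^sup>2)" by (simp add: power4_eq_xxxx power2_eq_square)
  finally have ex: "expectation ?u \<le> real L * real N * (\<sigma>^4 * ?A\<^sup>2)" .
  have "prob {\<omega>\<in>space M. R * real N * real L < ?u \<omega>} \<le> prob {\<omega>\<in>space M. R * real N * real L \<le> ?u \<omega>}"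
    by (intro finite_measure_mono) auto
  also have "\<dots> \<le> expectation ?u / (R * real N * real L)"
    by (rule integral_Markov_inequality_measure[OF int, where A = "space M"])
       (use pos in \<open>auto intro!: AE_I2 sum_nonneg\<close>)
  also have "\<dots> \<le> real L * real N * (\<sigma>^4 * ?A\<^sup>2) / (R * real N * real L)"
    using ex pos by (intro divide_right_mono) auto
  also have "\<dots> = \<sigma>^4 * ?A\<^sup>2 / R" using N L by simp
  finally show ?thesis .
qed

lemma gram_defect_measurable [measurable]:
  "(\<lambda>\<omega>. gram_defect (\<lambda>k. e (nat k) \<omega>) p m N L s) \<in> borel_measurable M"
  unfolding gram_defect_def by measurable

text \<open>On the diagonal the centred squares have variance \<open>2 * \<sigma>^4\<close>; off the
  diagonal the past factor is the weight and the increments have second moment at most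
  \<open>\<sigma>^4\<close>.\<close>

lemma lag_product_second_moment:
  fixes i j m p N :: nat
  assumes ij: "i \<le> j" "j \<le> m"
  defines "T \<equiv> \<lambda>\<omega>. \<Sum>n=m+1+p..m+N. e (nat (int n - int i)) \<omega> * e (nat (int n - int j)) \<omega> - (if i = j then \<sigma>\<^sup>2 else 0)"
  shows "integrable M (\<lambda>\<omega>. (T \<omega>)\<^sup>2)" "expectation (\<lambda>\<omega>. (T \<omega>)\<^sup>2) \<le> 2 * \<sigma>^4 * real N"
proof -
  let ?a = "m+1+p-i" and ?n = "m+N+1-i"
  have cnt: "real (?n - ?a) \<le> real N" by simp
  have "integrable M (\<lambda>\<omega>. (T \<omega>)\<^sup>2) \<and> expectation (\<lambda>\<omega>. (T \<omega>)\<^sup>2) \<le> 2 * \<sigma>^4 * real N"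
  proof (cases "i = j")
    case True
    have T: "T \<omega> = (\<Sum>k\<in>{?a..<?n}. 1 * ((e k \<omega>)\<^sup>2 - \<sigma>\<^sup>2))" for \<omega>
      unfolding T_def lag_product_sum_eq[OF ij, where E = "\<lambda>k. e k \<omega>"] using True by (simp add: power2_eq_square)
    have i2: "integrable M (\<lambda>\<omega>. ((e k \<omega>)\<^sup>2 - \<sigma>\<^sup>2)\<^sup>2)" for k
    proof -
      have "((e k \<omega>)\<^sup>2 - \<sigma>\<^sup>2)\<^sup>2 = (e k \<omega>)^4 - 2 * \<sigma>\<^sup>2 * (e k \<omega>)\<^sup>2 + \<sigma>^4" for \<omega>
        by (simp add: power2_eq_square power4_eq_xxxx algebra_simps)
      then show ?thesis
        by (simp add: noise_moments(1))
    qed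
    have e0: "expectation (\<lambda>\<omega>. (e k \<omega>)\<^sup>2 - \<sigma>\<^sup>2) = 0" for k
      using noise_moments(1)[of k 2] noise_moments(3)[of k] by (simp add: prob_space)
    note sm = second_moment_window[of "\<lambda>_ _. 1" 1 "\<lambda>x. x\<^sup>2 - \<sigma>\<^sup>2" "2 * \<sigma>^4" ?a ?n, OF _ _ _ _ i2 noise_moments(4) e0]
    have "integrable M (\<lambda>\<omega>. (T \<omega>)\<^sup>2)"
      unfolding T by (rule sm(1)) (simp_all add: prob_space)
    moreover have "expectation (\<lambda>\<omega>. (T \<omega>)\<^sup>2) \<le> 2 * \<sigma>^4 * (real (?n - ?a) * 1)"
      unfolding T by (rule sm(2)) (simp_all add: prob_space)
    moreover have "2 * \<sigma>^4 * (real (?n - ?a) * 1) \<le> 2 * \<sigma>^4 * real N"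
      using cnt by (intro mult_left_mono) auto
    ultimately show ?thesis by linarith
  next
    case False
    with ij have lt: "i < j" by simp
    define w where "w k \<omega> = (if j - i \<le> k then e (k - (j - i)) \<omega> else 0)" for k \<omega>
    have T: "T \<omega> = (\<Sum>k\<in>{?a..<?n}. w k \<omega> * e k \<omega>)" for \<omega>
      unfolding T_def lag_product_sum_eq[OF ij, where E = "\<lambda>k. e k \<omega>"] using False ij
      by (intro sum.cong) (auto simp: w_def)
    have wp: "w k \<in> borel_measurable (past k)" for k
      using noise_past[of "k - (j - i)" k] lt by (cases "j - i \<le> k") (simp_all add: w_def[abs_def])
    have wi: "integrable M (\<lambda>\<omega>. (w k \<omega>)\<^sup>2)" for k
      by (cases "j - i \<le> k") (simp_all add: w_def noise_moments(1))
    have we: "expectation (\<lambda>\<omega>. (w k \<omega>)\<^sup>2) \<le> \<sigma>\<^sup>2" for k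
      by (cases "j - i \<le> k") (simp_all add: w_def noise_moments(3))
    note sm = second_moment_window[of w "\<sigma>\<^sup>2" "\<lambda>x. x" "\<sigma>\<^sup>2" ?a ?n, OF wp wi we _ noise_moments(1,3,2)]
    have "integrable M (\<lambda>\<omega>. (T \<omega>)\<^sup>2)"
      unfolding T by (rule sm(1)) simp
    moreover have "expectation (\<lambda>\<omega>. (T \<omega>)\<^sup>2) \<le> \<sigma>\<^sup>2 * (real (?n - ?a) * \<sigma>\<^sup>2)"
      unfolding T by (rule sm(2)) simp
    moreover have "\<sigma>\<^sup>2 * (real (?n - ?a) * \<sigma>\<^sup>2) \<le> 2 * \<sigma>^4 * real N"
    proof -
      have "\<sigma>\<^sup>2 * (real (?n - ?a) * \<sigma>\<^sup>2) = \<sigma>^4 * real (?n - ?a)"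
        by (simp add: power4_eq_xxxx power2_eq_square)
      also have "\<dots> \<le> (2 * \<sigma>^4) * real N"
        using cnt by (intro mult_mono) auto
      finally show ?thesis .
    qed
    ultimately show ?thesis by linarith
  qed
  then show "integrable M (\<lambda>\<omega>. (T \<omega>)\<^sup>2)" "expectation (\<lambda>\<omega>. (T \<omega>)\<^sup>2) \<le> 2 * \<sigma>^4 * real N" by auto
qed

text \<open>There are \<open>L^2\<close> entries with second moment at most
  \<open>2 * \<sigma>^4 * N\<close>; dividing by \<open>N^2 * \<sigma>^4 / 16\<close> gives the 32.
  With L = \<open>Lmax\<close> this is where the upper growth condition on \<open>Lmax\<close> comes
  from.\<close>

lemma prob_gram_defect_large:
  assumes N: "0 < N" and L: "L \<le> m"
  shows "prob {\<omega>\<in>space M. (real N * \<sigma>\<^sup>2 / 4)\<^sup>2 < gram_defect (\<lambda>k. e (nat k) \<omega>) p m N L (\<sigma>\<^sup>2)}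
    \<le> 32 * (real L)\<^sup>2 / real N"
proof -
  define T where "T i j \<omega> = (\<Sum>n=m+1+p..m+N. e (nat (int n - int i)) \<omega> * e (nat (int n - int j)) \<omega>
    - (if i = j then \<sigma>\<^sup>2 else 0))" for i j \<omega>
  have ordered: "integrable M (\<lambda>\<omega>. (T i j \<omega>)\<^sup>2) \<and> expectation (\<lambda>\<omega>. (T i j \<omega>)\<^sup>2) \<le> 2 * \<sigma>^4 * real N"
    if "i \<le> j" "j \<le> m" for i j
    unfolding T_def using lag_product_second_moment[OF that] by blast
  have T: "integrable M (\<lambda>\<omega>. (T i j \<omega>)\<^sup>2) \<and> expectation (\<lambda>\<omega>. (T i j \<omega>)\<^sup>2) \<le> 2 * \<sigma>^4 * real N"
    if "i \<in> {1..L}" "j \<in> {1..L}" for i j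
  proof (cases "i \<le> j")
    case True
    then show ?thesis using ordered[of i j] that L by simp
  next
    case False
    then have sym: "T i j = T j i" by (simp add: T_def fun_eq_iff mult.commute)
    show ?thesis unfolding sym using ordered[of j i] False that L by simp
  qed
  let ?u = "\<lambda>\<omega>. gram_defect (\<lambda>k. e (nat k) \<omega>) p m N L (\<sigma>\<^sup>2)"
  have u: "?u \<omega> = (\<Sum>i=1..L. \<Sum>j=1..L. (T i j \<omega>)\<^sup>2)" for \<omega>
    by (simp add: gram_defect_def T_def)
  have row: "integrable M (\<lambda>\<omega>. \<Sum>j=1..L. (T i j \<omega>)\<^sup>2)"
      "expectation (\<lambda>\<omega>. \<Sum>j=1..L. (T i j \<omega>)\<^sup>2) = (\<Sum>j=1..L. expectation (\<lambda>\<omega>. (T i j \<omega>)\<^sup>2))"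
    if "i \<in> {1..L}" for i
  proof -
    show "integrable M (\<lambda>\<omega>. \<Sum>j=1..L. (T i j \<omega>)\<^sup>2)"
      by (rule Bochner_Integration.integrable_sum) (rule T[THEN conjunct1, OF that])
    show "expectation (\<lambda>\<omega>. \<Sum>j=1..L. (T i j \<omega>)\<^sup>2) = (\<Sum>j=1..L. expectation (\<lambda>\<omega>. (T i j \<omega>)\<^sup>2))"
      by (rule Bochner_Integration.integral_sum) (rule T[THEN conjunct1, OF that])
  qed
  have int: "integrable M ?u"
    unfolding u by (rule Bochner_Integration.integrable_sum) (rule row(1))
  have "expectation ?u = (\<Sum>i=1..L. expectation (\<lambda>\<omega>. \<Sum>j=1..L. (T i j \<omega>)\<^sup>2))"
    unfolding u by (rule Bochner_Integration.integral_sum) (rule row(1))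
  also have "\<dots> = (\<Sum>i=1..L. \<Sum>j=1..L. expectation (\<lambda>\<omega>. (T i j \<omega>)\<^sup>2))"
    by (rule sum.cong[OF refl row(2)])
  also have "\<dots> \<le> (\<Sum>i=1..L. \<Sum>j=1..L. 2 * \<sigma>^4 * real N)"
    by (intro sum_mono) (rule T[THEN conjunct2])
  finally have ex: "expectation ?u \<le> (real L)\<^sup>2 * (2 * \<sigma>^4 * real N)" by (simp add: power2_eq_square)
  have pos: "0 < (real N * \<sigma>\<^sup>2 / 4)\<^sup>2" using N sigma_pos by simp
  have "prob {\<omega>\<in>space M. (real N * \<sigma>\<^sup>2 / 4)\<^sup>2 < ?u \<omega>} \<le> prob {\<omega>\<in>space M. (real N * \<sigma>\<^sup>2 / 4)\<^sup>2 \<le> ?u \<omega>}"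
    by (intro finite_measure_mono) auto
  also have "\<dots> \<le> expectation ?u / (real N * \<sigma>\<^sup>2 / 4)\<^sup>2"
    by (rule integral_Markov_inequality_measure[OF int, where A = "space M"])
       (use pos in \<open>auto intro!: AE_I2 sum_nonneg simp: u\<close>)
  also have "\<dots> \<le> (real L)\<^sup>2 * (2 * \<sigma>^4 * real N) / (real N * \<sigma>\<^sup>2 / 4)\<^sup>2"
    using ex by (intro divide_right_mono) auto
  also have "\<dots> = 32 * (real L)\<^sup>2 / real N"
    using N sigma_pos by (simp add: power2_eq_square power4_eq_xxxx field_simps)
  finally show ?thesis .
qed

end

section \<open>Asymptotics along a typical sample path\<close>

lemma sum_atLeastLessThan_diff:
  fixes f :: "nat \<Rightarrow> real"
  assumes "a \<le> b"
  shows "(\<Sum>k\<in>{a..<b}. f k) = (\<Sum>k<b. f k) - (\<Sum>k<a. f k)"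
proof -
  have "{..<b} - {..<a} = {a..<b}" by auto
  then show ?thesis using assms sum_diff[of "{..<b}" "{..<a}" f] by simp
qed

lemma sum_atLeastAtMost_diff:
  fixes f :: "nat \<Rightarrow> real"
  shows "(\<Sum>k=m+1..m+N. f k) = (\<Sum>k<m+N+1. f k) - (\<Sum>k<m+1. f k)"
proof -
  have "{m+1..m+N} = {m+1..<m+N+1}" by auto
  then show ?thesis using sum_atLeastLessThan_diff[of "m+1" "m+N+1" f] by simp
qed

lemma square_sum_le: "(a + b :: real)\<^sup>2 \<le> 2 * a\<^sup>2 + 2 * b\<^sup>2"
  using zero_le_power2[of "a - b"] by (simp add: power2_sum power2_diff)

lemma geometric_sum_le:
  fixes \<rho> :: real
  assumes "0 < \<rho>" "\<rho> < 1"
  shows "(\<Sum>i<n. \<rho> ^ i) \<le> 1 / (1 - \<rho>)"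
proof -
  have "(\<Sum>i<n. \<rho> ^ i) \<le> (\<Sum>i. \<rho> ^ i)"
    using assms by (intro sum_le_suminf summable_geometric) auto
  then show ?thesis using assms by (simp add: suminf_geometric)
qed

text \<open>At time n and lag l the argument of h is n - l, so decay is available in both the
  distance of n from m and that of l from m. Both geometric series converge, which makes the bound
  uniform in the number m of lags.\<close>

lemma transient_score_bound:
  fixes E :: "nat \<Rightarrow> real" and h :: "int \<Rightarrow> real"
  assumes \<rho>: "0 < \<rho>" "\<rho> < 1" and h: "\<And>n::nat. \<bar>h (int n)\<bar> \<le> C * \<rho> ^ n"
  shows "(\<Sum>l=1..m. (\<Sum>n=m+1..m+N. E n * h (int n - int l))\<^sup>2)
    \<le> (C / (1 - \<rho>))\<^sup>2 * (\<Sum>n=m+1..m+N. (E n)\<^sup>2)"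
proof -
  let ?Q = "\<Sum>n=m+1..m+N. (E n)\<^sup>2"
  have C0: "0 \<le> C" using order_trans[OF abs_ge_zero h[of 0]] by simp
  have Q0: "0 \<le> ?Q" by (simp add: sum_nonneg)
  have row: "(\<Sum>n=m+1..m+N. E n * h (int n - int l))\<^sup>2 \<le> ?Q * (C\<^sup>2 * (\<rho> ^ (m - l) * (1 / (1 - \<rho>))))"
    if l: "l \<in> {1..m}" for l
  proof -
    have "(\<Sum>n=m+1..m+N. E n * h (int n - int l))\<^sup>2 \<le> ?Q * (\<Sum>n=m+1..m+N. (h (int n - int l))\<^sup>2)"
      by (rule Cauchy_Schwarz_ineq_sum)
    also have "(\<Sum>n=m+1..m+N. (h (int n - int l))\<^sup>2) \<le> (\<Sum>n=m+1..m+N. C\<^sup>2 * (\<rho> ^ (m - l) * \<rho> ^ (n - (m+1))))"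
    proof (rule sum_mono)
      fix n assume n: "n \<in> {m+1..m+N}"
      have "h (int n - int l) = h (int (n - l))" using n l by (simp add: of_nat_diff)
      then have "(h (int n - int l))\<^sup>2 = \<bar>h (int (n - l))\<bar>\<^sup>2" by simp
      also have "\<dots> \<le> (C * \<rho> ^ (n - l))\<^sup>2" using h by (intro power_mono) auto
      also have "\<dots> = C\<^sup>2 * (\<rho> ^ (n - l))\<^sup>2" by (simp add: power_mult_distrib)
      \<comment> \<open>The square doubles the exponent, more than enough since \<open>n - l\<close>
        exceeds \<open>(m - l) + (n - (m + 1))\<close> by one.\<close>
      also have "(\<rho> ^ (n - l))\<^sup>2 \<le> \<rho> ^ (m - l + (n - (m+1)))"
        unfolding power_mult[symmetric] using \<rho> n l by (intro power_decreasing) auto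
      finally show "(h (int n - int l))\<^sup>2 \<le> C\<^sup>2 * (\<rho> ^ (m - l) * \<rho> ^ (n - (m+1)))"
        using C0 by (simp add: power_add mult_left_mono)
    qed
    also have "\<dots> = C\<^sup>2 * (\<rho> ^ (m - l) * (\<Sum>n=m+1..m+N. \<rho> ^ (n - (m+1))))"
      by (simp add: sum_distrib_left)
    also have "(\<Sum>n=m+1..m+N. \<rho> ^ (n - (m+1))) = (\<Sum>i<N. \<rho> ^ i)"
      by (rule sum.reindex_bij_witness[of _ "\<lambda>i. i + (m+1)" "\<lambda>n. n - (m+1)"]) auto
    also have "C\<^sup>2 * (\<rho> ^ (m - l) * (\<Sum>i<N. \<rho> ^ i)) \<le> C\<^sup>2 * (\<rho> ^ (m - l) * (1 / (1 - \<rho>)))"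
      using \<rho> by (intro mult_left_mono geometric_sum_le) auto
    finally show ?thesis using Q0 by (simp add: mult_left_mono)
  qed
  have "(\<Sum>l=1..m. (\<Sum>n=m+1..m+N. E n * h (int n - int l))\<^sup>2)
      \<le> (\<Sum>l=1..m. ?Q * (C\<^sup>2 * (\<rho> ^ (m - l) * (1 / (1 - \<rho>)))))"
    by (rule sum_mono[OF row])
  also have "\<dots> = ?Q * (C\<^sup>2 * ((\<Sum>l=1..m. \<rho> ^ (m - l)) * (1 / (1 - \<rho>))))"
  proof -
    have "(\<Sum>l=1..m. q * (a * (f l * b))) = q * (a * ((\<Sum>l=1..m. f l) * b))"
      for q a b :: real and f :: "nat \<Rightarrow> real"
      by (simp add: sum_distrib_left sum_distrib_right)
    then show ?thesis .
  qed
  also have "(\<Sum>l=1..m. \<rho> ^ (m - l)) = (\<Sum>i<m. \<rho> ^ i)"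
    by (rule sum.reindex_bij_witness[of _ "\<lambda>i. m - i" "\<lambda>l. m - l"]) auto
  also have "?Q * (C\<^sup>2 * ((\<Sum>i<m. \<rho> ^ i) * (1 / (1 - \<rho>)))) \<le> ?Q * (C\<^sup>2 * (1 / (1 - \<rho>) * (1 / (1 - \<rho>))))"
    using \<rho> Q0 by (intro mult_left_mono mult_right_mono geometric_sum_le) auto
  also have "\<dots> = (C / (1 - \<rho>))\<^sup>2 * ?Q"
    by (simp add: power2_eq_square)
  finally show ?thesis .
qed

lemma gram_defect_cong:
  assumes "\<And>n::nat. \<eta> (int n) = E n" "L \<le> m"
  shows "gram_defect \<eta> p m N L s = gram_defect (\<lambda>k. E (nat k)) p m N L s"
proof -
  have "\<eta> (int n - int i) = E (nat (int n - int i))" if "i \<le> L" "n \<in> {m+1+p..m+N}" for n i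
    using assms(1)[of "n - i"] that assms(2) by (simp add: of_nat_diff nat_diff_distrib')
  then show ?thesis
    unfolding gram_defect_def by (intro sum.cong refl arg_cong[of _ _ "\<lambda>x. x\<^sup>2"]) auto
qed

text \<open>The almost sure properties of one path, after which limits in N are deterministic. The
  constants in the two iterated-logarithm bounds may depend on the lag.\<close>

locale ar_noise_path = ar_path +
  fixes E :: "nat \<Rightarrow> real" and c :: "nat \<Rightarrow> real" and m :: "nat \<Rightarrow> nat"
  assumes eta_E: "\<eta> (int n) = E n"
    and slln_E: "(\<lambda>n. (\<Sum>k<n. (E k)\<^sup>2) / real n) \<longlonglongrightarrow> s"
    and lil_lag: "1 \<le> d \<Longrightarrow> \<exists>C. \<forall>n. (\<Sum>k<n. (if d \<le> k then E (k - d) else 0) * E k)\<^sup>2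
      \<le> C * (real n + 1) * ln (ln (real n + 16))"
    and lil_filter: "1 \<le> l \<Longrightarrow> \<exists>C. \<forall>n. (\<Sum>k<n. causal_filter c E (int k - int l) * E k)\<^sup>2
      \<le> C * (real n + 1) * ln (ln (real n + 16))"
    and transient: "\<exists>C \<rho>. 0 < \<rho> \<and> \<rho> < 1 \<and> (\<forall>n::nat. \<bar>y (int n) - causal_filter c E (int n)\<bar> \<le> C * \<rho> ^ n)"
    and m_lnln: "filterlim (\<lambda>N. real (m N) / ln (ln (real N))) at_top sequentially"
    and m_small: "(\<lambda>N. real (m N) / real N) \<longlonglongrightarrow> 0"
begin

lemma m_real_at_top: "filterlim (\<lambda>N. real (m N)) at_top sequentially"
proof (rule filterlim_at_top_mono[OF m_lnln])
  have "\<forall>\<^sub>F N in sequentially. 1 \<le> ln (ln (real N))"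
    using lnln_at_top by (simp add: filterlim_at_top)
  then show "\<forall>\<^sub>F N in sequentially. real (m N) / ln (ln (real N)) \<le> real (m N)"
  proof eventually_elim
    case (elim N)
    have "real (m N) * 1 \<le> real (m N) * ln (ln (real N))" using elim by (intro mult_left_mono) auto
    then show ?case using elim by (simp add: field_simps)
  qed
qed

lemma m_at_top: "filterlim m at_top sequentially"
  unfolding filterlim_at_top
proof
  fix Z
  have "\<forall>\<^sub>F N in sequentially. real Z \<le> real (m N)"
    by (rule filterlim_at_top[THEN iffD1, OF m_real_at_top, rule_format])
  then show "\<forall>\<^sub>F N in sequentially. Z \<le> m N" by eventually_elim simp
qed

text \<open>Centring precedes the passage to moving windows, since the window lemma needs averages
  that tend to 0.\<close>

lemma centered_squares_mean:
  "(\<lambda>n. (\<Sum>k<n. (E k)\<^sup>2 - s) / real n) \<longlonglongrightarrow> 0"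
proof -
  have "(\<lambda>n. (\<Sum>k<n. (E k)\<^sup>2) / real n - s) \<longlonglongrightarrow> s - s"
    by (intro tendsto_intros slln_E)
  moreover have "\<forall>\<^sub>F n in sequentially. (\<Sum>k<n. (E k)\<^sup>2) / real n - s = (\<Sum>k<n. (E k)\<^sup>2 - s) / real n"
    using eventually_gt_at_top[of 0]
    by eventually_elim (simp add: sum_subtractf diff_divide_distrib)
  ultimately show ?thesis by (simp add: tendsto_cong)
qed

lemma centered_squares_window:
  assumes "\<And>N. a N \<le> m N + N + d" "\<And>N. b N \<le> m N + N + d"
  shows "(\<lambda>N. ((\<Sum>k<b N. (E k)\<^sup>2 - s) - (\<Sum>k<a N. (E k)\<^sup>2 - s)) / real N) \<longlonglongrightarrow> 0"
proof -
  have "(\<lambda>N. (\<Sum>k<b N. (E k)\<^sup>2 - s) / real N - (\<Sum>k<a N. (E k)\<^sup>2 - s) / real N) \<longlonglongrightarrow> 0 - 0"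
    by (intro tendsto_diff window_mean_tendsto_0[OF centered_squares_mean m_small, where d = d] assms)
  then show ?thesis by (simp add: diff_divide_distrib)
qed

lemma noise_energy_tendsto: "(\<lambda>N. noise_energy (m N) N) \<longlonglongrightarrow> s"
proof -
  have "(\<lambda>N. ((\<Sum>k<m N + N + 1. (E k)\<^sup>2 - s) - (\<Sum>k<m N + 1. (E k)\<^sup>2 - s)) / real N + s) \<longlonglongrightarrow> 0 + s"
    by (intro tendsto_add tendsto_const centered_squares_window[of _ 1]) auto
  moreover have "\<forall>\<^sub>F N in sequentially.
    ((\<Sum>k<m N + N + 1. (E k)\<^sup>2 - s) - (\<Sum>k<m N + 1. (E k)\<^sup>2 - s)) / real N + s = noise_energy (m N) N"
    using eventually_gt_at_top[of 0]
  proof eventually_elim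
    case (elim N)
    show ?case
      unfolding sum_atLeastAtMost_diff[symmetric] noise_energy_def eta_E
      using elim by (simp add: sum_subtractf diff_divide_distrib)
  qed
  ultimately show ?thesis by (simp add: tendsto_cong)
qed

definition filter_score :: "nat \<Rightarrow> nat \<Rightarrow> real" where
  "filter_score N l = (\<Sum>n=m N+1..m N+N. E n * causal_filter c E (int n - int l))"

definition transient_score :: "nat \<Rightarrow> nat \<Rightarrow> real" where
  "transient_score N l = (\<Sum>n=m N+1..m N+N. E n * (y (int n - int l) - causal_filter c E (int n - int l)))"

lemma score_split: "score y \<eta> (m N) N l = filter_score N l + transient_score N l"
  by (simp add: score_def filter_score_def transient_score_def eta_E sum.distrib[symmetric]
      distrib_left[symmetric])

text \<open>The transient costs O(N) for all lags together, against the normalisation N m.\<close>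

lemma transient_energy_tendsto:
  "(\<lambda>N. (\<Sum>l=1..m N. (transient_score N l)\<^sup>2) / (real N * real (m N))) \<longlonglongrightarrow> 0"
proof -
  obtain C \<rho> where C: "0 < \<rho>" "\<rho> < 1" "\<And>n::nat. \<bar>y (int n) - causal_filter c E (int n)\<bar> \<le> C * \<rho> ^ n"
    using transient by blast
  define D where "D = (C / (1 - \<rho>))\<^sup>2"
  have "(\<lambda>N. D * noise_energy (m N) N * inverse (real (m N))) \<longlonglongrightarrow> D * s * 0"
    by (intro tendsto_intros noise_energy_tendsto tendsto_inverse_0_at_top m_real_at_top)
  then have lim: "(\<lambda>N. D * noise_energy (m N) N * inverse (real (m N))) \<longlonglongrightarrow> 0" by simp
  have "\<forall>\<^sub>F N in sequentially. norm ((\<Sum>l=1..m N. (transient_score N l)\<^sup>2) / (real N * real (m N)))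
      \<le> D * noise_energy (m N) N * inverse (real (m N))"
    using eventually_gt_at_top[of 0]
  proof eventually_elim
    case (elim N)
    have "(\<Sum>l=1..m N. (transient_score N l)\<^sup>2) \<le> D * (\<Sum>n=m N+1..m N+N. (E n)\<^sup>2)"
      unfolding transient_score_def D_def
      by (rule transient_score_bound[OF C(1,2), of "\<lambda>k. y k - causal_filter c E k"]) (rule C(3))
    also have "(\<Sum>n=m N+1..m N+N. (E n)\<^sup>2) = real N * noise_energy (m N) N"
      using elim by (simp add: noise_energy_def eta_E)
    finally have "(\<Sum>l=1..m N. (transient_score N l)\<^sup>2) / (real N * real (m N))
        \<le> D * (real N * noise_energy (m N) N) / (real N * real (m N))"
      by (rule divide_right_mono) simp
    also have "\<dots> = D * noise_energy (m N) N * inverse (real (m N))"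
      using elim by (simp add: field_simps)
    finally show ?case by (simp add: sum_nonneg)
  qed
  then show ?thesis using lim by (rule Lim_null_comparison)
qed

lemma score_square_tendsto:
  assumes l: "1 \<le> l"
  shows "(\<lambda>N. (score y \<eta> (m N) N l)\<^sup>2 / (real N * real (m N))) \<longlonglongrightarrow> 0"
proof -
  obtain C where C: "\<And>n. (\<Sum>k<n. causal_filter c E (int k - int l) * E k)\<^sup>2
      \<le> C * (real n + 1) * ln (ln (real n + 16))"
    using lil_filter[OF l] by blast
  have "(\<lambda>N. ((\<Sum>k<m N + N + 1. causal_filter c E (int k - int l) * E k)
      - (\<Sum>k<m N + 1. causal_filter c E (int k - int l) * E k))\<^sup>2 / (real N * real (m N))) \<longlonglongrightarrow> 0"
    by (rule window_square_tendsto_0[OF C m_lnln m_small, where d = 1]) auto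
  then have filt: "(\<lambda>N. (filter_score N l)\<^sup>2 / (real N * real (m N))) \<longlonglongrightarrow> 0"
    unfolding sum_atLeastAtMost_diff[symmetric] filter_score_def by (simp add: mult.commute)
  have "(\<lambda>N. 2 * ((filter_score N l)\<^sup>2 / (real N * real (m N)))
      + 2 * ((\<Sum>l=1..m N. (transient_score N l)\<^sup>2) / (real N * real (m N)))) \<longlonglongrightarrow> 2 * 0 + 2 * 0"
    by (intro tendsto_intros filt transient_energy_tendsto)
  then have lim: "(\<lambda>N. 2 * ((filter_score N l)\<^sup>2 / (real N * real (m N)))
      + 2 * ((\<Sum>l=1..m N. (transient_score N l)\<^sup>2) / (real N * real (m N)))) \<longlonglongrightarrow> 0" by simp
  have "\<forall>\<^sub>F N in sequentially. norm ((score y \<eta> (m N) N l)\<^sup>2 / (real N * real (m N)))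
      \<le> 2 * ((filter_score N l)\<^sup>2 / (real N * real (m N)))
      + 2 * ((\<Sum>l=1..m N. (transient_score N l)\<^sup>2) / (real N * real (m N)))"
    using filterlim_at_top[THEN iffD1, OF m_at_top, rule_format, of l]
  proof eventually_elim
    case (elim N)
    have "(transient_score N l)\<^sup>2 \<le> (\<Sum>l=1..m N. (transient_score N l)\<^sup>2)"
      using l elim by (intro member_le_sum) auto
    then have "(score y \<eta> (m N) N l)\<^sup>2 \<le> 2 * (filter_score N l)\<^sup>2 + 2 * (\<Sum>l=1..m N. (transient_score N l)\<^sup>2)"
      unfolding score_split using square_sum_le[of "filter_score N l" "transient_score N l"] by linarith
    then have "(score y \<eta> (m N) N l)\<^sup>2 / (real N * real (m N))
        \<le> (2 * (filter_score N l)\<^sup>2 + 2 * (\<Sum>l=1..m N. (transient_score N l)\<^sup>2)) / (real N * real (m N))"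
      by (rule divide_right_mono) simp
    then show ?case by (simp add: add_divide_distrib)
  qed
  then show ?thesis using lim by (rule Lim_null_comparison)
qed

text \<open>The square of a sum costs a factor 2 on each part, and the transient part is eventually
  below N m.\<close>

lemma eventually_score_energy_le:
  "\<forall>\<^sub>F N in sequentially. \<forall>R. (\<Sum>l=1..m N. (filter_score N l)\<^sup>2) \<le> R * real N * real (m N) \<longrightarrow>
    score_energy (m N) N (m N) \<le> (2 * R + 2) * real N * real (m N)"
proof -
  have "\<forall>\<^sub>F N in sequentially. (\<Sum>l=1..m N. (transient_score N l)\<^sup>2) / (real N * real (m N)) < 1"
    by (rule order_tendstoD(2)[OF transient_energy_tendsto]) simp
  then show ?thesis
    using eventually_gt_at_top[of 0] filterlim_at_top[THEN iffD1, OF m_at_top, rule_format, of 1]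
  proof eventually_elim
    case (elim N)
    have "0 < real N * real (m N)" using elim by simp
    then have tr: "(\<Sum>l=1..m N. (transient_score N l)\<^sup>2) < real N * real (m N)"
      using elim(1) by (simp only: divide_less_eq_1_pos)
    have "score_energy (m N) N (m N) \<le> (\<Sum>l=1..m N. 2 * (filter_score N l)\<^sup>2 + 2 * (transient_score N l)\<^sup>2)"
      unfolding score_energy_def score_split by (intro sum_mono square_sum_le)
    also have "\<dots> = 2 * (\<Sum>l=1..m N. (filter_score N l)\<^sup>2) + 2 * (\<Sum>l=1..m N. (transient_score N l)\<^sup>2)"
      by (simp add: sum.distrib sum_distrib_left)
    finally have le: "score_energy (m N) N (m N) \<le> \<dots>" .
    show ?case
    proof (intro allI impI)
      fix R assume "(\<Sum>l=1..m N. (filter_score N l)\<^sup>2) \<le> R * real N * real (m N)"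
      with le tr have "score_energy (m N) N (m N) \<le> 2 * (R * real N * real (m N)) + 2 * (real N * real (m N))"
        by linarith
      also have "\<dots> = (2 * R + 2) * real N * real (m N)" by (simp add: algebra_simps)
      finally show "score_energy (m N) N (m N) \<le> (2 * R + 2) * real N * real (m N)" .
    qed
  qed
qed

text \<open>Diagonal entries follow from the strong law for squares. Off the diagonal the
  iterated-logarithm bound gives convergence at scale N m, and a further factor \<open>m / N\<close>
  changes the scale to \<open>N^2\<close>.\<close>

lemma lag_product_tendsto:
  assumes ij: "1 \<le> i" "i \<le> j"
  shows "(\<lambda>N. (\<Sum>n=m N+1+p..m N+N. E (nat (int n - int i)) * E (nat (int n - int j))
    - (if i = j then s else 0))\<^sup>2 / (real N)\<^sup>2) \<longlonglongrightarrow> 0"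
proof -
  let ?a = "\<lambda>N. m N + 1 + p - i" and ?b = "\<lambda>N. m N + N + 1 - i"
  have ev: "\<forall>\<^sub>F N in sequentially. j \<le> m N \<and> p \<le> N \<and> 0 < N \<and> 0 < m N"
    using filterlim_at_top[THEN iffD1, OF m_at_top, rule_format, of "j + 1"]
      eventually_gt_at_top[of 0] eventually_ge_at_top[of p] by eventually_elim auto
  show ?thesis
  proof (cases "i = j")
    case True
    have "(\<lambda>N. ((\<Sum>k<?b N. (E k)\<^sup>2 - s) - (\<Sum>k<?a N. (E k)\<^sup>2 - s)) / real N) \<longlonglongrightarrow> 0"
      by (rule centered_squares_window[of _ "p + 1"]) auto
    from tendsto_power[OF this, of 2]
    have "(\<lambda>N. (((\<Sum>k<?b N. (E k)\<^sup>2 - s) - (\<Sum>k<?a N. (E k)\<^sup>2 - s)) / real N)\<^sup>2) \<longlonglongrightarrow> 0"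
      by (simp only: zero_power2)
    moreover have "\<forall>\<^sub>F N in sequentially. (((\<Sum>k<?b N. (E k)\<^sup>2 - s) - (\<Sum>k<?a N. (E k)\<^sup>2 - s)) / real N)\<^sup>2
      = (\<Sum>n=m N+1+p..m N+N. E (nat (int n - int i)) * E (nat (int n - int j)) - (if i = j then s else 0))\<^sup>2 / (real N)\<^sup>2"
      using ev
    proof eventually_elim
      case (elim N)
      have "?a N \<le> ?b N" using elim by (intro diff_le_mono) simp
      from sum_atLeastLessThan_diff[OF this, of "\<lambda>k. (E k)\<^sup>2 - s"]
      show ?case
        using lag_product_sum_eq[OF ij(2), of "m N" E s p N] elim True
        by (simp add: power_divide power2_eq_square)
    qed
    ultimately show ?thesis by (rule Lim_transform_eventually)
  next
    case False
    then have d: "1 \<le> j - i" using ij by simp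
    define w where "w k = (if j - i \<le> k then E (k - (j - i)) else 0)" for k
    obtain C where C: "\<And>n. (\<Sum>k<n. w k * E k)\<^sup>2 \<le> C * (real n + 1) * ln (ln (real n + 16))"
      using lil_lag[OF d] unfolding w_def by blast
    have "(\<lambda>N. ((\<Sum>k<?b N. w k * E k) - (\<Sum>k<?a N. w k * E k))\<^sup>2 / (real N * real (m N))) \<longlonglongrightarrow> 0"
      by (rule window_square_tendsto_0[OF C m_lnln m_small, where d = "p + 1"]) auto
    then have "(\<lambda>N. ((\<Sum>k<?b N. w k * E k) - (\<Sum>k<?a N. w k * E k))\<^sup>2 / (real N * real (m N))
        * (real (m N) / real N)) \<longlonglongrightarrow> 0 * 0"
      by (intro tendsto_mult m_small)
    moreover have "\<forall>\<^sub>F N in sequentially.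
      ((\<Sum>k<?b N. w k * E k) - (\<Sum>k<?a N. w k * E k))\<^sup>2 / (real N * real (m N)) * (real (m N) / real N)
      = (\<Sum>n=m N+1+p..m N+N. E (nat (int n - int i)) * E (nat (int n - int j)) - (if i = j then s else 0))\<^sup>2 / (real N)\<^sup>2"
      using ev
    proof eventually_elim
      case (elim N)
      have "(\<Sum>n=m N+1+p..m N+N. E (nat (int n - int i)) * E (nat (int n - int j)) - (if i = j then s else 0))
          = (\<Sum>k\<in>{?a N..<?b N}. E (k - (j - i)) * E k - 0)"
        using lag_product_sum_eq[OF ij(2), of "m N" E 0 p N] elim False by simp
      also have "\<dots> = (\<Sum>k\<in>{?a N..<?b N}. w k * E k)"
        using elim ij by (intro sum.cong) (auto simp: w_def)
      also have "\<dots> = (\<Sum>k<?b N. w k * E k) - (\<Sum>k<?a N. w k * E k)"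
        using elim by (intro sum_atLeastLessThan_diff diff_le_mono) simp
      finally show ?case
        using elim by (simp add: power2_eq_square)
    qed
    ultimately show ?thesis by (simp add: tendsto_cong)
  qed
qed

lemma gram_defect_tendsto: "(\<lambda>N. gram_defect \<eta> p (m N) N K s / (real N)\<^sup>2) \<longlonglongrightarrow> 0"
proof -
  have "(\<lambda>N. gram_defect (\<lambda>k. E (nat k)) p (m N) N K s / (real N)\<^sup>2) \<longlonglongrightarrow> 0"
    unfolding gram_defect_def sum_divide_distrib
  proof (intro tendsto_null_sum)
    fix i j assume i: "i \<in> {1..K}" and j: "j \<in> {1..K}"
    show "(\<lambda>N. (\<Sum>n=m N+1+p..m N+N. E (nat (int n - int i)) * E (nat (int n - int j))
      - (if i = j then s else 0))\<^sup>2 / (real N)\<^sup>2) \<longlonglongrightarrow> 0"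
    proof (cases "i \<le> j")
      case True
      then show ?thesis using lag_product_tendsto[of i j] i by simp
    next
      case False
      then show ?thesis
        using lag_product_tendsto[of j i] j by (simp add: mult.commute)
    qed
  qed
  moreover have "\<forall>\<^sub>F N in sequentially. gram_defect (\<lambda>k. E (nat k)) p (m N) N K s / (real N)\<^sup>2
      = gram_defect \<eta> p (m N) N K s / (real N)\<^sup>2"
    using filterlim_at_top[THEN iffD1, OF m_at_top, rule_format, of K]
    by eventually_elim (simp add: gram_defect_cong[of \<eta> E, OF eta_E])
  ultimately show ?thesis by (simp add: tendsto_cong)
qed

lemma eventually_beats_fixed:
  assumes "p \<le> K"
  shows "\<forall>\<^sub>F N in sequentially. \<forall>L\<le>K. L \<noteq> p \<longrightarrow>
    bridge_criterion y (m N) N p < bridge_criterion y (m N) N L"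
proof (rule eventually_true_order_beats_fixed[OF assms _ m_small noise_energy_tendsto _ gram_defect_tendsto])
  show "\<forall>\<^sub>F N in sequentially. 1 \<le> m N"
    using m_at_top by (simp add: filterlim_at_top)
qed (auto intro: score_square_tendsto)

lemma eventually_beats_all:
  assumes K: "p \<le> K" "2 * (2 * R + 2) / (\<kappa> * s) < (\<Sum>k=p+1..K. 1 / real k)"
  shows "\<forall>\<^sub>F N in sequentially. (\<Sum>l=1..m N. (filter_score N l)\<^sup>2) \<le> R * real N * real (m N) \<longrightarrow>
    gram_defect (\<lambda>k. E (nat k)) p (m N) N (m N) s \<le> (real N * s / 4)\<^sup>2 \<longrightarrow>
    (\<forall>L\<le>m N. L \<noteq> p \<longrightarrow> bridge_criterion y (m N) N p < bridge_criterion y (m N) N L)"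
  using eventually_beats_fixed[OF K(1)] eventually_score_energy_le
    eventually_true_order_beats_large[OF m_at_top m_small noise_energy_tendsto K]
proof eventually_elim
  case (elim N)
  show ?case
  proof (intro impI allI)
    fix L
    assume f: "(\<Sum>l=1..m N. (filter_score N l)\<^sup>2) \<le> R * real N * real (m N)"
      and g: "gram_defect (\<lambda>k. E (nat k)) p (m N) N (m N) s \<le> (real N * s / 4)\<^sup>2"
      and L: "L \<le> m N" "L \<noteq> p"
    have "gram_defect \<eta> p (m N) N (m N) s \<le> (real N * s / 4)\<^sup>2"
      using g by (subst gram_defect_cong[of \<eta> E, OF eta_E]) auto
    then show "bridge_criterion y (m N) N p < bridge_criterion y (m N) N L"
      using elim f L by (cases "L \<le> K") auto
  qed
qed

end

section \<open>Consistency\<close>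

lemma harmonic_tail_unbounded: "\<exists>K\<ge>p. X < (\<Sum>k=p+1..K. 1 / real k)"
proof -
  have "\<forall>\<^sub>F K in sequentially. X + harm p + 1 \<le> (harm K :: real)"
    using harm_at_top by (simp add: filterlim_at_top)
  then have "\<forall>\<^sub>F K in sequentially. p \<le> K \<and> X + harm p + 1 \<le> (harm K :: real)"
    using eventually_ge_at_top[of p] by eventually_elim auto
  then obtain K where K: "p \<le> K" "X + harm p + 1 \<le> (harm K :: real)"
    by (auto simp: eventually_sequentially)
  have "harm K = harm p + (\<Sum>k=p+1..K. 1 / real k)"
    unfolding harm_def inverse_eq_divide
    using K(1) sum.ub_add_nat[of 1 p "\<lambda>k. 1 / real k" "K - p"] by simp
  with K show ?thesis by (intro exI[of _ K]) auto
qed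

text \<open>Converts "from some path-dependent index on" into vanishing probability: the indicators
  tend to 0 almost surely and are dominated by 1.\<close>

lemma (in prob_space) prob_tendsto_0:
  assumes A: "\<And>n. A n \<in> events" and AE: "AE \<omega> in M. \<forall>\<^sub>F n in sequentially. \<omega> \<notin> A n"
  shows "(\<lambda>n. prob (A n)) \<longlonglongrightarrow> 0"
proof -
  have "(\<lambda>n. \<integral>\<omega>. indicator (A n) \<omega> \<partial>M) \<longlonglongrightarrow> (\<integral>\<omega>. 0 \<partial>M :: real)"
  proof (rule integral_dominated_convergence[where w = "\<lambda>_. 1"])
    show "AE \<omega> in M. (\<lambda>n. indicator (A n) \<omega> :: real) \<longlonglongrightarrow> 0"
      using AE
    proof eventually_elim
      case (elim \<omega>)
      then have "\<forall>\<^sub>F n in sequentially. (indicator (A n) \<omega> :: real) = 0"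
        by eventually_elim simp
      then show ?case by (rule tendsto_eventually)
    qed
  qed (use A in \<open>auto simp: indicator_def\<close>)
  then show ?thesis using A by simp
qed

text \<open>Transfers independence from the two-sided noise to its nonnegative times.\<close>

lemma (in prob_space) indep_vars_reindex_inj:
  assumes X: "indep_vars M' X I" and f: "inj_on f J" "f ` J \<subseteq> I"
  shows "indep_vars (\<lambda>j. M' (f j)) (\<lambda>j. X (f j)) J"
  unfolding indep_vars_def2
proof (intro conjI ballI indep_setsI)
  note X' = X[unfolded indep_vars_def2]
  show rv: "random_variable (M' (f j)) (X (f j))" if "j \<in> J" for j
    using X' f that by auto
  show "{X (f j) -` A \<inter> space M |A. A \<in> sets (M' (f j))} \<subseteq> events" if "j \<in> J" for j
    using measurable_sets[OF rv[OF that]] by auto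
  fix A K assume K: "K \<noteq> {}" "K \<subseteq> J" "finite K"
    and A: "\<forall>j\<in>K. A j \<in> {X (f j) -` A \<inter> space M |A. A \<in> sets (M' (f j))}"
  have inj: "inj_on f K" using f(1) K(2) by (rule inj_on_subset)
  define B where "B i = A (inv_into K f i)" for i
  have B: "B (f j) = A j" if "j \<in> K" for j
    using inj that by (simp add: B_def inv_into_f_f)
  have "prob (\<Inter>i\<in>f ` K. B i) = (\<Prod>i\<in>f ` K. prob (B i))"
  proof (rule indep_setsD[OF X'[THEN conjunct2]])
    show "\<forall>i\<in>f ` K. B i \<in> {X i -` A \<inter> space M |A. A \<in> sets (M' i)}"
      using A B by auto
  qed (use K f in auto)
  then show "prob (\<Inter>j\<in>K. A j) = (\<Prod>j\<in>K. prob (A j))"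
    using B inj by (simp add: prod.reindex)
qed

lemma arg_min_eqI:
  assumes "is_arg_min f (\<lambda>L. L \<in> C) L'" "p \<in> C" "\<And>L. L \<in> C \<Longrightarrow> L \<noteq> p \<Longrightarrow> f p < f L"
  shows "L' = p"
  using assms unfolding is_arg_min_def by blast

context gaussian_noise begin

text \<open>Countably many null sets, one for each time and each lag, are discarded together. The
  difference of x and the causal filter then solves the homogeneous recursion at all nonnegative
  times.\<close>

lemma AE_ar_noise_path:
  fixes x :: "int \<Rightarrow> 'a \<Rightarrow> real" and \<psi> :: "nat \<Rightarrow> real" and p :: nat and m :: "nat \<Rightarrow> nat"
  assumes roots: "\<And>z::complex. z ^ p + (\<Sum>l=1..p. of_real (\<psi> l) * z ^ (p - l)) = 0 \<Longrightarrow> cmod z < 1"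
    and p: "1 \<le> p" "\<psi> p \<noteq> 0"
    and x: "\<And>n::nat. AE \<omega> in M. x (int n) \<omega> + (\<Sum>l=1..p. \<psi> l * x (int n - int l) \<omega>) = e n \<omega>"
    and m: "filterlim (\<lambda>N. real (m N) / ln (ln (real N))) at_top sequentially"
      "(\<lambda>N. real (m N) / real N) \<longlonglongrightarrow> 0"
  shows "AE \<omega> in M. ar_noise_path (\<lambda>n. x n \<omega>) (\<lambda>n. x n \<omega> + (\<Sum>l=1..p. \<psi> l * x (n - int l) \<omega>))
    \<psi> p (\<sigma>\<^sup>2) (\<lambda>k. e k \<omega>) (impulse_response \<psi> p) m"
proof -
  have c: "summable (\<lambda>j. \<bar>impulse_response \<psi> p j\<bar>)"
    by (rule impulse_response_summable[OF roots])
  have "AE \<omega> in M. \<forall>n::nat. x (int n) \<omega> + (\<Sum>l=1..p. \<psi> l * x (int n - int l) \<omega>) = e n \<omega>"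
    unfolding AE_all_countable using x by blast
  moreover have "AE \<omega> in M. \<forall>d. 1 \<le> d \<longrightarrow> (\<exists>C. \<forall>n. (\<Sum>k<n. (if d \<le> k then e (k - d) \<omega> else 0) * e k \<omega>)\<^sup>2
      \<le> C * (real n + 1) * ln (ln (real n + 16)))"
    unfolding AE_all_countable
  proof
    fix d :: nat
    show "AE \<omega> in M. 1 \<le> d \<longrightarrow> (\<exists>C. \<forall>n. (\<Sum>k<n. (if d \<le> k then e (k - d) \<omega> else 0) * e k \<omega>)\<^sup>2
      \<le> C * (real n + 1) * ln (ln (real n + 16)))"
      using lil_noise_lag[of d] by (cases "1 \<le> d") auto
  qed
  moreover have "AE \<omega> in M. \<forall>l. 1 \<le> l \<longrightarrow> (\<exists>C. \<forall>n.
      (\<Sum>k<n. causal_filter (impulse_response \<psi> p) (\<lambda>i. e i \<omega>) (int k - int l) * e k \<omega>)\<^sup>2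
      \<le> C * (real n + 1) * ln (ln (real n + 16)))"
    unfolding AE_all_countable
  proof
    fix l :: nat
    show "AE \<omega> in M. 1 \<le> l \<longrightarrow> (\<exists>C. \<forall>n.
      (\<Sum>k<n. causal_filter (impulse_response \<psi> p) (\<lambda>i. e i \<omega>) (int k - int l) * e k \<omega>)\<^sup>2
      \<le> C * (real n + 1) * ln (ln (real n + 16)))"
      using lil_filter_lag[OF c, of l] by (cases "1 \<le> l") auto
  qed
  ultimately show ?thesis
    using slln_squares
  proof eventually_elim
    case (elim \<omega>)
    let ?z = "causal_filter (impulse_response \<psi> p) (\<lambda>i. e i \<omega>)"
    have "(x (int n) \<omega> - ?z (int n)) + (\<Sum>l=1..p. \<psi> l * (x (int n - int l) \<omega> - ?z (int n - int l))) = 0" for n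
      using elim(1)[rule_format, of n] impulse_response_solves[of \<psi> p "\<lambda>i. e i \<omega>" n]
      by (simp add: right_diff_distrib sum_subtractf)
    from ar_homogeneous_decay[OF roots this]
    have "\<exists>C \<rho>. 0 < \<rho> \<and> \<rho> < 1 \<and> (\<forall>n::nat. \<bar>x (int n) \<omega> - ?z (int n)\<bar> \<le> C * \<rho> ^ n)" .
    then show ?case
      using elim p sigma_pos m by unfold_locales auto
  qed
qed

end

theorem theorem2:
  fixes M :: "'a measure" and x \<epsilon> :: "int \<Rightarrow> 'a \<Rightarrow> real"
    and L\<^sub>0 :: nat and \<psi> :: "nat \<Rightarrow> real" and \<sigma> :: real and Lmax :: "nat \<Rightarrow> nat"
  assumes "prob_space M"
    and "1 \<le> L\<^sub>0"
    and "autoregression M x \<epsilon> L\<^sub>0 \<psi> \<sigma>"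
    and "\<And>N. 1 \<le> N \<Longrightarrow> 1 \<le> Lmax N"
    and "filterlim (\<lambda>N. real (Lmax N) / ln (ln (real N))) at_top sequentially"
    and "(\<lambda>N. real (Lmax N) / sqrt (real N)) \<longlonglongrightarrow> 0"
  shows "(\<forall>Lhat. bridge_selection M x Lmax (\<lambda>N. {1..Lmax N}) Lhat \<longrightarrow>
            (\<lambda>N. measure M {\<omega> \<in> space M. Lhat N \<omega> = L\<^sub>0}) \<longlonglongrightarrow> 1) \<and>
         (\<forall>C Lhat. finite C \<longrightarrow> L\<^sub>0 \<in> C \<longrightarrow> bridge_selection M x Lmax (\<lambda>_. C) Lhat \<longrightarrow>
            (\<forall>\<delta>>0. (\<lambda>N. measure M {\<omega> \<in> space M. \<bar>real (Lhat N \<omega>) - real L\<^sub>0\<bar> > \<delta>}) \<longlonglongrightarrow> 0) \<and>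
            (AE \<omega> in M. (\<lambda>N. real (Lhat N \<omega>)) \<longlonglongrightarrow> real L\<^sub>0))"
proof -
  interpret prob_space M by fact
  define e where "e n = \<epsilon> (int n)" for n :: nat
  from assms(3) have psi0: "\<psi> L\<^sub>0 \<noteq> 0"
    and roots: "\<And>z::complex. z ^ L\<^sub>0 + (\<Sum>l=1..L\<^sub>0. of_real (\<psi> l) * z ^ (L\<^sub>0 - l)) = 0 \<Longrightarrow> cmod z < 1"
    and sigma: "0 < \<sigma>" and noise: "gaussian_white_noise M \<epsilon> \<sigma>"
    and rec: "\<And>n. AE \<omega> in M. x n \<omega> + (\<Sum>l=1..L\<^sub>0. \<psi> l * x (n - int l) \<omega>) = \<epsilon> n \<omega>"
    unfolding autoregression_def by auto
  interpret gaussian_noise M e \<sigma>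
  proof
    show "indep_vars (\<lambda>_. borel) e UNIV"
      using noise indep_vars_reindex_inj[of "\<lambda>_. borel" \<epsilon> UNIV int UNIV]
      by (simp add: gaussian_white_noise_def e_def[abs_def])
    show "distributed M lborel (e n) (normal_density 0 \<sigma>)" for n
      using noise by (simp add: gaussian_white_noise_def e_def)
  qed (rule sigma)
  have L_sq: "(\<lambda>N. (real (Lmax N))\<^sup>2 / real N) \<longlonglongrightarrow> 0"
    using tendsto_power[OF assms(6), of 2] by (simp add: power_divide)
  \<comment> \<open>Since \<open>Lmax N \<ge> 1\<close>, the ratio is dominated by
    \<open>Lmax^2 / N\<close>.\<close>
  have L_N: "(\<lambda>N. real (Lmax N) / real N) \<longlonglongrightarrow> 0"
  proof (rule Lim_null_comparison[OF _ L_sq])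
    show "\<forall>\<^sub>F N in sequentially. norm (real (Lmax N) / real N) \<le> (real (Lmax N))\<^sup>2 / real N"
      using eventually_ge_at_top[of 1]
    proof eventually_elim
      case (elim N)
      have "1 \<le> real (Lmax N)" using assms(4)[OF elim] by simp
      then have "real (Lmax N) \<le> (real (Lmax N))\<^sup>2" by (simp add: power2_eq_square)
      then show ?case by (simp add: divide_right_mono)
    qed
  qed
  define c where "c = impulse_response \<psi> L\<^sub>0"
  define crit where "crit \<omega> N L = bridge_criterion (\<lambda>n. x n \<omega>) (Lmax N) N L" for \<omega> N L
  have path: "AE \<omega> in M. ar_noise_path (\<lambda>n. x n \<omega>) (\<lambda>n. x n \<omega> + (\<Sum>l=1..L\<^sub>0. \<psi> l * x (n - int l) \<omega>))
    \<psi> L\<^sub>0 (\<sigma>\<^sup>2) (\<lambda>k. e k \<omega>) c Lmax"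
    unfolding c_def
    using AE_ar_noise_path[of L\<^sub>0 \<psi> x Lmax, OF roots assms(2) psi0 _ assms(5) L_N] rec
    by (simp add: e_def)
  have fixed: "AE \<omega> in M. \<forall>\<^sub>F N in sequentially. \<forall>L\<in>C. L \<noteq> L\<^sub>0 \<longrightarrow> crit \<omega> N L\<^sub>0 < crit \<omega> N L"
    if "finite C" for C
  proof -
    obtain K where K: "\<And>L. L \<in> C \<Longrightarrow> L \<le> K"
      using \<open>finite C\<close> by (auto simp: finite_nat_set_iff_bounded_le)
    show ?thesis
      using path
    proof eventually_elim
      case (elim \<omega>)
      then interpret P: ar_noise_path "\<lambda>n. x n \<omega>" "\<lambda>n. x n \<omega> + (\<Sum>l=1..L\<^sub>0. \<psi> l * x (n - int l) \<omega>)"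
        \<psi> L\<^sub>0 "\<sigma>\<^sup>2" "\<lambda>k. e k \<omega>" c Lmax .
      have "L\<^sub>0 \<le> max K L\<^sub>0" by simp
      from P.eventually_beats_fixed[OF this] show ?case
      proof eventually_elim
        case (elim N)
        then show ?case using K unfolding crit_def by (meson max.coboundedI1)
      qed
    qed
  qed
  have "(\<forall>\<delta>>0. (\<lambda>N. prob {\<omega> \<in> space M. \<bar>real (Lhat N \<omega>) - real L\<^sub>0\<bar> > \<delta>}) \<longlonglongrightarrow> 0) \<and>
      (AE \<omega> in M. (\<lambda>N. real (Lhat N \<omega>)) \<longlonglongrightarrow> real L\<^sub>0)"
    if C: "finite C" "L\<^sub>0 \<in> C" and sel: "bridge_selection M x Lmax (\<lambda>_. C) Lhat" for C Lhat
  proof -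
    have AEeq: "AE \<omega> in M. \<forall>\<^sub>F N in sequentially. Lhat N \<omega> = L\<^sub>0"
      using fixed[OF C(1)] AE_space
    proof eventually_elim
      case (elim \<omega>)
      from elim(1) eventually_ge_at_top[of 1] show ?case
      proof eventually_elim
        case (elim N)
        have "is_arg_min (crit \<omega> N) (\<lambda>L. L \<in> C) (Lhat N \<omega>)"
          using sel elim(2) \<open>\<omega> \<in> space M\<close> unfolding bridge_selection_def crit_def by blast
        then show ?case by (rule arg_min_eqI[OF _ C(2)]) (use elim(1) in auto)
      qed
    qed
    have meas: "Lhat N \<in> measurable M (count_space UNIV)" if "1 \<le> N" for N
      using sel that unfolding bridge_selection_def by blast
    have "(\<lambda>N. prob {\<omega> \<in> space M. \<bar>real (Lhat N \<omega>) - real L\<^sub>0\<bar> > \<delta>}) \<longlonglongrightarrow> 0" if "\<delta> > 0" for \<delta>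
    proof -
      \<comment> \<open>The selection is constrained only for \<open>N \<ge> 1\<close>; the value at
        0 is replaced to have an event for every N.\<close>
      define A where "A N = (if N = 0 then {} else {\<omega> \<in> space M. \<bar>real (Lhat N \<omega>) - real L\<^sub>0\<bar> > \<delta>})" for N
      have "A N \<in> events" for N
      proof (cases "N = 0")
        case False
        then have [measurable]: "Lhat N \<in> measurable M (count_space UNIV)" using meas[of N] by simp
        have "{\<omega> \<in> space M. \<bar>real (Lhat N \<omega>) - real L\<^sub>0\<bar> > \<delta>} \<in> events" by measurable
        then show ?thesis using False by (simp add: A_def)
      qed (simp add: A_def)
      moreover have "AE \<omega> in M. \<forall>\<^sub>F N in sequentially. \<omega> \<notin> A N"
        using AEeq
      proof eventually_elim
        case (elim \<omega>)
        then show ?case by eventually_elim (use \<open>\<delta> > 0\<close> in \<open>auto simp: A_def\<close>)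
      qed
      ultimately have "(\<lambda>N. prob (A N)) \<longlonglongrightarrow> 0" by (rule prob_tendsto_0)
      moreover have "\<forall>\<^sub>F N in sequentially. prob (A N) = prob {\<omega> \<in> space M. \<bar>real (Lhat N \<omega>) - real L\<^sub>0\<bar> > \<delta>}"
        using eventually_gt_at_top[of 0] by eventually_elim (simp add: A_def)
      ultimately show ?thesis by (rule Lim_transform_eventually)
    qed
    moreover have "AE \<omega> in M. (\<lambda>N. real (Lhat N \<omega>)) \<longlonglongrightarrow> real L\<^sub>0"
      using AEeq
    proof eventually_elim
      case (elim \<omega>)
      then show ?case by (intro tendsto_eventually) (auto elim: eventually_mono)
    qed
    ultimately show ?thesis by blast
  qed
  moreover have "(\<lambda>N. prob {\<omega> \<in> space M. Lhat N \<omega> = L\<^sub>0}) \<longlonglongrightarrow> 1"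
    if sel: "bridge_selection M x Lmax (\<lambda>N. {1..Lmax N}) Lhat" for Lhat
  proof (rule LIMSEQ_I)
    fix \<delta> :: real assume \<delta>: "0 < \<delta>"
    have c: "summable (\<lambda>j. \<bar>c j\<bar>)"
      unfolding c_def by (rule impulse_response_summable[OF roots])
    define V where "V = \<sigma>^4 * (\<Sum>j. \<bar>c j\<bar>)\<^sup>2"
    \<comment> \<open>Chosen for \<open>V / R < \<delta> / 2\<close>; the summand 1 makes this
      strict and keeps R positive.\<close>
    define R where "R = 2 * V / \<delta> + 1"
    have V0: "0 \<le> V" by (simp add: V_def)
    then have R: "0 < R" using \<delta> by (simp add: R_def add_nonneg_pos)
    have VR: "V / R < \<delta> / 2"
      using R \<delta> by (simp add: R_def field_simps)
    \<comment> \<open>The constant \<kappa> is written out because it depends only on \<sigma>,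
      \<psi> and the true order: one K serves all paths.\<close>
    obtain K where K: "L\<^sub>0 \<le> K"
      "2 * (2 * R + 2) / (\<sigma>\<^sup>2 / (4 * (1 + (\<Sum>l=1..L\<^sub>0. \<bar>\<psi> l\<bar>))\<^sup>2) * \<sigma>\<^sup>2) < (\<Sum>k=L\<^sub>0+1..K. 1 / real k)"
      using harmonic_tail_unbounded by blast
    define B1 where "B1 N = {\<omega>\<in>space M. R * real N * real (Lmax N)
      < (\<Sum>l=1..Lmax N. (causal_score c (Lmax N) N l \<omega>)\<^sup>2)}" for N
    define B2 where "B2 N = {\<omega>\<in>space M. (real N * \<sigma>\<^sup>2 / 4)\<^sup>2
      < gram_defect (\<lambda>k. e (nat k) \<omega>) L\<^sub>0 (Lmax N) N (Lmax N) (\<sigma>\<^sup>2)}" for N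
    define G where "G N = {\<omega> \<in> space M. Lhat N \<omega> = L\<^sub>0}" for N
    \<comment> \<open>The selection fails although both tail events are avoided. Almost every path
      eventually leaves these sets, whereas the tail events are only improbable for each N.\<close>
    define A where "A N = (if N = 0 then {} else space M - (G N \<union> B1 N \<union> B2 N))" for N
    have B [measurable]: "B1 N \<in> events" "B2 N \<in> events" for N
      unfolding B1_def B2_def by measurable
    have G: "G N \<in> events" if "1 \<le> N" for N
    proof -
      have [measurable]: "Lhat N \<in> measurable M (count_space UNIV)"
        using sel that unfolding bridge_selection_def by blast
      show ?thesis unfolding G_def by measurable
    qed
    have "A N \<in> events" for N
      using G[of N] B by (cases "N = 0") (auto simp: A_def)
    moreover have "AE \<omega> in M. \<forall>\<^sub>F N in sequentially. \<omega> \<notin> A N"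
      using path AE_space
    proof eventually_elim
      case (elim \<omega>)
      then interpret P: ar_noise_path "\<lambda>n. x n \<omega>" "\<lambda>n. x n \<omega> + (\<Sum>l=1..L\<^sub>0. \<psi> l * x (n - int l) \<omega>)"
        \<psi> L\<^sub>0 "\<sigma>\<^sup>2" "\<lambda>k. e k \<omega>" c Lmax by simp
      have "\<forall>\<^sub>F N in sequentially. L\<^sub>0 \<le> Lmax N"
        by (rule filterlim_at_top[THEN iffD1, OF P.m_at_top, rule_format])
      with P.eventually_beats_all[OF K(1) K(2)[folded P.\<kappa>_def]] eventually_ge_at_top[of 1]
      show ?case
      proof eventually_elim
        case (elim N)
        have score: "P.filter_score N l = causal_score c (Lmax N) N l \<omega>" for l
          by (simp add: P.filter_score_def causal_score_def)
        have "Lhat N \<omega> = L\<^sub>0" if "\<omega> \<notin> B1 N" "\<omega> \<notin> B2 N"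
        proof (rule arg_min_eqI)
          show "is_arg_min (crit \<omega> N) (\<lambda>L. L \<in> {1..Lmax N}) (Lhat N \<omega>)"
            using sel elim(2) \<open>\<omega> \<in> space M\<close> unfolding bridge_selection_def crit_def by blast
          show "L\<^sub>0 \<in> {1..Lmax N}" using assms(2) elim(3) by simp
          fix L assume L: "L \<in> {1..Lmax N}" "L \<noteq> L\<^sub>0"
          have "(\<Sum>l=1..Lmax N. (P.filter_score N l)\<^sup>2) \<le> R * real N * real (Lmax N)"
            using that(1) \<open>\<omega> \<in> space M\<close> unfolding B1_def score by simp
          moreover have "gram_defect (\<lambda>k. e (nat k) \<omega>) L\<^sub>0 (Lmax N) N (Lmax N) (\<sigma>\<^sup>2) \<le> (real N * \<sigma>\<^sup>2 / 4)\<^sup>2"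
            using that(2) \<open>\<omega> \<in> space M\<close> unfolding B2_def by simp
          ultimately show "crit \<omega> N L\<^sub>0 < crit \<omega> N L"
            using elim(1) L unfolding crit_def by simp
        qed
        then show ?case using elim(2) \<open>\<omega> \<in> space M\<close> by (auto simp: A_def G_def)
      qed
    qed
    ultimately have "(\<lambda>N. prob (A N)) \<longlonglongrightarrow> 0" by (rule prob_tendsto_0)
    then have "\<forall>\<^sub>F N in sequentially. prob (A N) < \<delta> / 4"
      by (rule order_tendstoD(2)) (use \<delta> in simp)
    moreover have "(\<lambda>N. 32 * ((real (Lmax N))\<^sup>2 / real N)) \<longlonglongrightarrow> 32 * 0"
      by (intro tendsto_intros L_sq)
    then have "\<forall>\<^sub>F N in sequentially. 32 * ((real (Lmax N))\<^sup>2 / real N) < \<delta> / 4"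
      by (rule order_tendstoD(2)) (use \<delta> in simp)
    ultimately have "\<forall>\<^sub>F N in sequentially. norm (prob (G N) - 1) < \<delta>"
      using eventually_ge_at_top[of 1]
    proof eventually_elim
      case (elim N)
      have "prob (B1 N) \<le> V / R"
        unfolding B1_def V_def using elim(3) assms(4)[OF elim(3)]
        by (intro prob_causal_score_large[OF c R]) auto
      moreover have "prob (B2 N) \<le> 32 * (real (Lmax N))\<^sup>2 / real N"
        unfolding B2_def using elim(3) by (intro prob_gram_defect_large) auto
      moreover have "prob (space M - G N) \<le> prob (A N \<union> (B1 N \<union> B2 N))"
        using elim(3) G[OF elim(3)] B \<open>\<And>N. A N \<in> events\<close>
        by (intro finite_measure_mono) (auto simp: A_def)
      moreover have "prob (A N \<union> (B1 N \<union> B2 N)) \<le> prob (A N) + (prob (B1 N) + prob (B2 N))"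
        using B \<open>\<And>N. A N \<in> events\<close>
        by (intro order_trans[OF measure_Un_le] add_mono measure_Un_le) auto
      moreover have "prob (space M - G N) = 1 - prob (G N)"
        by (rule prob_compl[OF G[OF elim(3)]])
      \<comment> \<open>The budget: \<delta>/2 for the scores, \<delta>/4 for the Gram matrix and
        \<delta>/4 for \<open>A N\<close>.\<close>
      ultimately have "1 - prob (G N) < \<delta>" using elim(1,2) VR by simp
      then show ?case using prob_le_1[of "G N"] by simp
    qed
    then show "\<exists>no. \<forall>N\<ge>no. norm (prob {\<omega> \<in> space M. Lhat N \<omega> = L\<^sub>0} - 1) < \<delta>"
      unfolding eventually_sequentially G_def .
  qed
  ultimately show ?thesis by blast
qed

end
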